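(* Let $\tfrac32 < s < 2$ and let $r$ be a Lebesgue exponent with $r < s'$. Assume that there is a constant $B<\infty$ such that $$\|\mathcal{E} f\, \mathcal{E} g\|_{L^s(\mathbb{R}^3)} \le B\, \|f\|_{L^r(\mathbb{R}^2)}\|g\|_{L^r(\mathbb{R}^2)}$$ whenever $f,g\in L^r(\mathbb{R}^2)$ are supported on $1\times 1$ (axis-parallel) rectangles that are separated from one another by a distance $1$ in both the horizontal and the vertical directions. Then $\mathcal{E}$ is of restricted strong type $(s',2s)$, i.e. there is a constant $C<\infty$ such that $$\|\mathcal{E}\chi_\Omega\|_{L^{2s}(\mathbb{R}^3)} \le C |\Omega|^{1/s'} \quad\text{for every measurable } \Omega\subseteq\mathbb{R}^2 \text{ of finite measure},$$ and consequently $\mathcal{E}$ is of strong type $(\tilde s', 2\tilde s)$ for all $\tilde s > s$, i.e. for every $\tilde s>s$ there is a constant $C_{\tilde s}<\infty$ such that $\|\mathcal{E} f\|_{L^{2\tilde s}(\mathbb{R}^3)} \le C_{\tilde s} \|f\|_{L^{\tilde s'}(\mathbb{R}^2)}$ for all $f$ (say, bounded with compact support, hence, by density, $\mathcal{E}$ extends to a bounded operator from $L^{\tilde s'}(\mathbb{R}^2)$ to $L^{2\tilde s}(\mathbb{R}^3)$ when $\tilde s'<\infty$).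
   Context: $\mathcal{E}$ is the Fourier extension operator associated with the hyperbolic paraboloid $\{(\tau,\xi)\in\mathbb{R}^{1+2}:\tau=\xi_1\xi_2\}$: for $(t,x)\in\mathbb{R}\times\mathbb{R}^2$, $$\mathcal{E} f(t,x) := \int_{\mathbb{R}^2} e^{i(t\xi_1\xi_2 + x\cdot \xi)} f(\xi)\, d\xi .$$ For an exponent $p\in[1,\infty]$, $p'$ denotes the dual exponent, $\tfrac1p+\tfrac1{p'}=1$. Lebesgue exponents are taken in $[1,\infty]$. The horizontal direction is that of $\xi_1$, the vertical direction that of $\xi_2$. Two rectangles $I_1\times I_2$ and $I_1'\times I_2'$ are separated by a distance $1$ in both the horizontal and vertical directions if $\mathrm{dist}(I_1,I_1')=1$ and $\mathrm{dist}(I_2,I_2')=1$. $|\Omega|$ denotes Lebesgue measure and $\chi_\Omega$ the characteristic function of $\Omega$. *)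

theory Defs
  imports "HOL-Probability.Essential_Supremum"
begin

text \<open>
  Lebesgue exponents are the elements of \<open>[1,\<infinity>]\<close>, modelled in \<^typ>\<open>ennreal\<close>, where
  \<open>inverse 0 = \<infinity>\<close> and \<open>inverse \<infinity> = 0\<close>.
\<close>

definition dual_exponent :: "ennreal \<Rightarrow> ennreal" where
  "dual_exponent p = inverse (1 - inverse p)"

lemma dual_exponent:
  assumes "1 \<le> p"
  shows "inverse p + inverse (dual_exponent p) = 1"
proof -
  have "inverse p \<le> 1"
    using assms by (cases p) (auto simp: inverse_ennreal ennreal_le_1 inverse_le_1_iff)
  moreover have "inverse (inverse x) = x" for x :: ennreal
    by (cases x; cases "x = 0") (auto simp: inverse_ennreal zero_less_iff_neq_zero)
  ultimately show ?thesis
    by (simp add: dual_exponent_def)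
qed

text \<open>Meaningful for Lebesgue measurable \<open>f\<close> only. The inner \<open>if\<close> is the \<open>1/p\<close>-th power on \<open>[0,\<infinity>]\<close>.\<close>

definition Lp_norm :: "ennreal \<Rightarrow> ('a::euclidean_space \<Rightarrow> complex) \<Rightarrow> ennreal" where
  "Lp_norm p f =
    (if p = \<infinity> then esssup lebesgue (\<lambda>x. ennreal (norm (f x)))
     else let I = \<integral>\<^sup>+x. ennreal (norm (f x) powr enn2real p) \<partial>lebesgue
          in if I = \<infinity> then \<infinity> else ennreal (enn2real I powr (1 / enn2real p)))"

definition Lp :: "ennreal \<Rightarrow> ('a::euclidean_space \<Rightarrow> complex) set" where
  "Lp p = {f \<in> borel_measurable lebesgue. Lp_norm p f < \<infinity>}"

definition bounded_compact_support :: "('a::euclidean_space \<Rightarrow> complex) set" where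
  "bounded_compact_support =
    {f \<in> borel_measurable lebesgue. bounded (range f) \<and> compact (closure {x. f x \<noteq> 0})}"

text \<open>
  The Bochner integral is the Lebesgue integral for integrable \<open>f\<close> and \<open>0\<close> otherwise, so
  this is the intended operator on \<open>L\<^sup>1\<close> only.
\<close>

definition extension_op :: "(real \<times> real \<Rightarrow> complex) \<Rightarrow> real \<times> (real \<times> real) \<Rightarrow> complex" where
  "extension_op f = (\<lambda>(t, x). \<integral>\<xi>. exp (\<i> * of_real (t * (fst \<xi> * snd \<xi>) + x \<bullet> \<xi>)) * f \<xi> \<partial>lebesgue)"

definition separated_unit_rectangles :: "(real \<times> real) set \<Rightarrow> (real \<times> real) set \<Rightarrow> bool" where
  "separated_unit_rectangles Q Q' \<longleftrightarrow>
    (\<exists>a1 a2 b1 b2. Q = {a1..a1 + 1} \<times> {a2..a2 + 1} \<and> Q' = {b1..b1 + 1} \<times> {b2..b2 + 1} \<and>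
       setdist {a1..a1 + 1} {b1..b1 + 1} = 1 \<and> setdist {a2..a2 + 1} {b2..b2 + 1} = 1)"

definition restricted_strong_type ::
  "(('a::euclidean_space \<Rightarrow> complex) \<Rightarrow> 'b::euclidean_space \<Rightarrow> complex) \<Rightarrow> ennreal \<Rightarrow> ennreal \<Rightarrow> bool"
  where
  "restricted_strong_type T p q \<longleftrightarrow>
    (\<exists>C::real. \<forall>\<Omega>\<in>lmeasurable.
       Lp_norm q (T (indicator \<Omega>)) \<le> ennreal (C * measure lebesgue \<Omega> powr enn2real (inverse p)))"

definition strong_type ::
  "(('a::euclidean_space \<Rightarrow> complex) \<Rightarrow> 'b::euclidean_space \<Rightarrow> complex) \<Rightarrow> ennreal \<Rightarrow> ennreal \<Rightarrow> bool"
  where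
  "strong_type T p q \<longleftrightarrow>
    (\<exists>C::real. \<forall>f\<in>bounded_compact_support. Lp_norm q (T f) \<le> ennreal C * Lp_norm p f)"

text \<open>
  The extension \<open>S\<close> acts on representatives; it respects equality almost everywhere because
  linearity and the bound force \<open>S f - S g\<close> to have norm \<open>0\<close> whenever \<open>f = g\<close> almost everywhere.
\<close>

definition extends_to_bounded_operator ::
  "(('a::euclidean_space \<Rightarrow> complex) \<Rightarrow> 'b::euclidean_space \<Rightarrow> complex) \<Rightarrow> ennreal \<Rightarrow> ennreal \<Rightarrow> bool"
  where
  "extends_to_bounded_operator T p q \<longleftrightarrow>
    (\<exists>S. (\<forall>f\<in>Lp p. S f \<in> Lp q) \<and>
         (\<forall>f\<in>Lp p. \<forall>g\<in>Lp p. AE y in lebesgue. S (\<lambda>x. f x + g x) y = S f y + S g y) \<and>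
         (\<forall>c. \<forall>f\<in>Lp p. AE y in lebesgue. S (\<lambda>x. c * f x) y = c * S f y) \<and>
         (\<exists>C::real. \<forall>f\<in>Lp p. Lp_norm q (S f) \<le> ennreal C * Lp_norm p f) \<and>
         (\<forall>f\<in>bounded_compact_support. AE y in lebesgue. S f y = T f y))"

end

theory Submission
  imports Defs "HOL-Probability.Sinc_Integral"
begin

text \<open>
  Write \<open>E\<close> for the extension operator, \<open>E\<^sub>A\<close> for its value at the characteristic function of \<open>A\<close>, and
  \<open>s'\<close> for the exponent dual to \<open>s\<close>.

  Parabolic scaling with independent factors in the two frequency directions transfers the bilinear hypothesis
  to separated rectangles of all shapes (\<open>bilinear_box\<close>). Because \<open>r < s'\<close>, the scale-invariant bound comes with
  a gain when the sets occupy a small fraction of their rectangles. For two sets \<open>\<Omega>\<close> and \<open>\<Omega>'\<close> the product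
  \<open>E\<^sub>\<Omega> E\<^sub>\<Omega>'\<close> is split by a Whitney decomposition in each coordinate separately (\<open>whitney_sum_tendsto\<close>). The pairs
  of tiles of a fixed shape \<open>2 powr j\<close> by \<open>2 powr k\<close> contribute functions with boundedly overlapping frequency
  supports, so that their sum is controlled in \<open>L\<^sup>s\<close> by the \<open>\<ell>\<^sup>s\<close> sum of their norms
  (\<open>frequency_decoupling2\<close>, \<open>tile_sum\<close>).

  The sum over the two-parameter family of shapes is the crux. If all vertical fibres of \<open>\<Omega>\<close> have length about
  \<open>2 powr K\<close> and their base has length about \<open>2 powr J\<close>, then shapes other than \<open>(J, K)\<close> contribute
  geometrically less: larger tiles are filled sparsely, and smaller ones are summable because \<open>s > 3/2\<close>
  (\<open>tile_square_sum_dominated\<close>). For two such sets the bound for each shape is the geometric mean of the two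
  individual ones, so \<open>E\<^sub>\<Omega> E\<^sub>\<Omega>'\<close> gains a factor that decays exponentially in \<open>\<bar>K - K'\<bar>\<close>
  (\<open>bilinear_dominated\<close>).

  An arbitrary set of finite measure is cut into the slices \<open>\<Omega>\<^sub>K\<close> with fibres of length about \<open>2 powr K\<close>. The triangle
  inequality for the square of the sum of the \<open>E\<^sub>\<Omega>\<^sub>K\<close> would give an \<open>\<ell>\<^sup>2\<close> sum over \<open>K\<close>, which is too weak.
  Since \<open>2 s \<le> 4\<close>, the power \<open>2 s\<close> of the sum can instead be expanded into products of four factors, and the
  decay of the pairwise products bounds the result by the sum of the powers \<open>2 s\<close> of the individual bounds
  (\<open>Lq_le_sum_of_bilinear_decay\<close>). This is at most the desired power of the measure of \<open>\<Omega>\<close>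
  (\<open>restricted_estimate\<close>).

  The strong type estimates follow by real interpolation with the trivial bound from \<open>L\<^sup>1\<close> to \<open>L\<^sup>\<infinity>\<close>
  (\<open>strong_estimate\<close>), and the bounded extension by density (\<open>extension_by_density\<close>).
\<close>

section \<open>Bounds for Lebesgue norms\<close>

text \<open>
  The inequality "\<open>f\<close> has \<open>L\<^sup>q\<close> norm at most \<open>C\<close>" for real \<open>q\<close> and \<open>C\<close>, so that
  constants are manipulated as reals and no norm has to be known to be finite in advance.
\<close>

definition Lq_le :: "'a measure \<Rightarrow> real \<Rightarrow> ('a \<Rightarrow> complex) \<Rightarrow> real \<Rightarrow> bool" where
  "Lq_le M q f C \<longleftrightarrow> f \<in> borel_measurable M \<and> 0 \<le> C \<and>
     (\<integral>\<^sup>+x. ennreal (norm (f x) powr q) \<partial>M) \<le> ennreal (C powr q)"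

lemma Lq_leD:
  assumes "Lq_le M q f C"
  shows "f \<in> borel_measurable M" "0 \<le> C" "(\<integral>\<^sup>+x. ennreal (norm (f x) powr q) \<partial>M) \<le> ennreal (C powr q)"
  using assms by (auto simp: Lq_le_def)

lemma Lq_le_mono_bound:
  assumes "Lq_le M q f C" "C \<le> D" "0 < q"
  shows "Lq_le M q f D"
proof -
  have "ennreal (C powr q) \<le> ennreal (D powr q)"
    using assms by (intro ennreal_leI powr_mono2) (auto simp: Lq_le_def)
  with assms show ?thesis unfolding Lq_le_def using order_trans by fastforce
qed

lemma Lq_le_mono:
  assumes "Lq_le M q g C" "f \<in> borel_measurable M" "\<And>x. norm (f x) \<le> norm (g x)" "0 < q"
  shows "Lq_le M q f C"
proof -
  have "(\<integral>\<^sup>+x. ennreal (norm (f x) powr q) \<partial>M) \<le> (\<integral>\<^sup>+x. ennreal (norm (g x) powr q) \<partial>M)"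
    using assms by (intro nn_integral_mono ennreal_leI powr_mono2) auto
  with assms show ?thesis unfolding Lq_le_def using order_trans by blast
qed

lemma Lq_le_cmult:
  assumes "Lq_le M q f C"
  shows "Lq_le M q (\<lambda>x. c * f x) (norm c * C)"
  using assms unfolding Lq_le_def
  by (auto simp: norm_mult powr_mult ennreal_mult nn_integral_cmult mult_left_mono)

lemma Lq_le_epsilon:
  assumes "\<And>e. 0 < e \<Longrightarrow> Lq_le M q f (C + e)" "0 \<le> C" "0 < q"
  shows "Lq_le M q f C"
proof -
  have "((\<lambda>e. ennreal ((C + e) powr q)) \<longlongrightarrow> ennreal ((C + 0) powr q)) (at_right 0)"
    using assms by (intro tendsto_ennrealI tendsto_powr2 tendsto_intros) (auto simp: eventually_at_right_less intro!: eventually_at_rightI[of 0 1])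
  moreover have "eventually (\<lambda>e. (\<integral>\<^sup>+x. ennreal (norm (f x) powr q) \<partial>M) \<le> ennreal ((C + e) powr q)) (at_right 0)"
    by (rule eventually_at_rightI[of 0 1]) (use assms in \<open>auto simp: Lq_le_def\<close>)
  ultimately have "(\<integral>\<^sup>+x. ennreal (norm (f x) powr q) \<partial>M) \<le> ennreal (C powr q)"
    by (intro tendsto_lowerbound[where F="at_right (0::real)"]) auto
  then show ?thesis using assms(1)[of 1] assms(2) by (auto simp: Lq_le_def)
qed

text \<open>
  Convexity of the power function in homogeneous form: with \<open>a\<close> and \<open>b\<close> the norms of two functions,
  integrating this inequality gives Minkowski's inequality.
\<close>

lemma powr_add_le_weighted:
  fixes x y a b q :: real
  assumes "0 \<le> x" "0 \<le> y" "0 < a" "0 < b" "1 \<le> q"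
  shows "(x + y) powr q \<le> (a + b) powr q * (a / (a + b) * (x / a) powr q + b / (a + b) * (y / b) powr q)"
proof -
  have boundary: "x powr q \<le> (a + b) powr q * (a / (a + b) * (x / a) powr q)"
    if "0 \<le> x" "0 < a" "0 < b" for x a b :: real
  proof -
    have "a powr q * 1 \<le> a powr q * ((a + b) / a) powr (q - 1)"
      using that assms by (intro mult_left_mono ge_one_powr_ge_zero) auto
    also have "\<dots> = (a + b) powr q * (a / (a + b))"
    proof -
      define u v where "u = (a + b) powr q" and "v = a powr q"
      have "v \<noteq> 0" "a \<noteq> 0" using that by (auto simp: v_def)
      then have "v * (u / (a + b) / (v / a)) = u * (a / (a + b))" by simp
      then show ?thesis using that by (simp add: powr_divide powr_diff u_def v_def)
    qed
    finally have "a powr q * (x / a) powr q \<le> (a + b) powr q * (a / (a + b)) * (x / a) powr q"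
      by (intro mult_right_mono) auto
    then show ?thesis using that by (simp add: powr_divide mult.assoc)
  qed
  show ?thesis
  proof (cases "x = 0 \<or> y = 0")
    case True
    then show ?thesis using boundary[of x a b] boundary[of y b a] assms
      by (auto simp: add.commute)
  next
    case False
    then have pos: "0 < x" "0 < y" using assms by auto
    have weight: "1 - b / (a + b) = a / (a + b)" using assms by (simp add: field_simps)
    have "(a / (a + b) * (x / a) + b / (a + b) * (y / b)) powr q
      \<le> a / (a + b) * (x / a) powr q + b / (a + b) * (y / b) powr q"
      using convex_onD[OF powr_convex[OF assms(5)], of "b / (a + b)" "x / a" "y / b"] pos assms
      unfolding weight by simp
    moreover have "a / (a + b) * (x / a) + b / (a + b) * (y / b) = (x + y) / (a + b)"
      using assms by (simp add: add_divide_distrib)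
    ultimately have "((x + y) / (a + b)) powr q \<le> a / (a + b) * (x / a) powr q + b / (a + b) * (y / b) powr q"
      by simp
    from mult_left_mono[OF this, of "(a + b) powr q"] show ?thesis
      using assms by (simp add: powr_divide)
  qed
qed

lemma Lq_le_add:
  assumes f: "Lq_le M q f a" and g: "Lq_le M q g b" and q: "1 \<le> q"
  shows "Lq_le M q (\<lambda>x. f x + g x) (a + b)"
proof -
  \<comment> \<open>The weighted inequality needs positive bounds; vanishing ones are reached by a limit.\<close>
  have pos: "Lq_le M q (\<lambda>x. f x + g x) (a + b)"
    if f: "Lq_le M q f a" and g: "Lq_le M q g b" and ab: "0 < a" "0 < b" for a b
  proof -
    note [measurable] = Lq_leD(1)[OF f] Lq_leD(1)[OF g]
    have norm_f: "(\<integral>\<^sup>+x. ennreal ((norm (f x) / a) powr q) \<partial>M) \<le> 1"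
    proof -
      have "(\<integral>\<^sup>+x. ennreal ((norm (f x) / a) powr q) \<partial>M)
          = (\<integral>\<^sup>+x. ennreal (norm (f x) powr q) \<partial>M) * ennreal (1 / a powr q)"
        by (subst nn_integral_multc[symmetric])
          (use ab in \<open>auto simp: powr_divide ennreal_mult'[symmetric]\<close>)
      also have "\<dots> \<le> ennreal (a powr q) * ennreal (1 / a powr q)"
        using Lq_leD(3)[OF f] by (rule mult_right_mono) simp
      also have "\<dots> = 1" using ab by (simp add: ennreal_mult'[symmetric])
      finally show ?thesis .
    qed
    have norm_g: "(\<integral>\<^sup>+x. ennreal ((norm (g x) / b) powr q) \<partial>M) \<le> 1"
    proof -
      have "(\<integral>\<^sup>+x. ennreal ((norm (g x) / b) powr q) \<partial>M)
          = (\<integral>\<^sup>+x. ennreal (norm (g x) powr q) \<partial>M) * ennreal (1 / b powr q)"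
        by (subst nn_integral_multc[symmetric])
          (use ab in \<open>auto simp: powr_divide ennreal_mult'[symmetric]\<close>)
      also have "\<dots> \<le> ennreal (b powr q) * ennreal (1 / b powr q)"
        using Lq_leD(3)[OF g] by (rule mult_right_mono) simp
      also have "\<dots> = 1" using ab by (simp add: ennreal_mult'[symmetric])
      finally show ?thesis .
    qed
    have "(\<integral>\<^sup>+x. ennreal (norm (f x + g x) powr q) \<partial>M)
       \<le> (\<integral>\<^sup>+x. ennreal ((a + b) powr q) * (ennreal (a / (a + b)) * ennreal ((norm (f x) / a) powr q)
            + ennreal (b / (a + b)) * ennreal ((norm (g x) / b) powr q)) \<partial>M)"
    proof (rule nn_integral_mono)
      fix x
      have "norm (f x + g x) powr q \<le> (norm (f x) + norm (g x)) powr q"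
        using q by (intro powr_mono2 norm_triangle_ineq) auto
      also have "\<dots> \<le> (a + b) powr q * (a / (a + b) * (norm (f x) / a) powr q + b / (a + b) * (norm (g x) / b) powr q)"
        using ab q by (intro powr_add_le_weighted) auto
      finally have "ennreal (norm (f x + g x) powr q) \<le> ennreal \<dots>" by (rule ennreal_leI)
      then show "ennreal (norm (f x + g x) powr q) \<le> ennreal ((a + b) powr q) * (ennreal (a / (a + b)) * ennreal ((norm (f x) / a) powr q)
            + ennreal (b / (a + b)) * ennreal ((norm (g x) / b) powr q))"
        using ab by (simp add: ennreal_mult'[symmetric] ennreal_plus[symmetric] del: ennreal_plus)
    qed
    also have "\<dots> = ennreal ((a + b) powr q) * (ennreal (a / (a + b)) * (\<integral>\<^sup>+x. ennreal ((norm (f x) / a) powr q) \<partial>M)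
            + ennreal (b / (a + b)) * (\<integral>\<^sup>+x. ennreal ((norm (g x) / b) powr q) \<partial>M))"
      by (simp add: nn_integral_cmult nn_integral_add)
    also have "\<dots> \<le> ennreal ((a + b) powr q) * (ennreal (a / (a + b)) * 1 + ennreal (b / (a + b)) * 1)"
      using norm_f norm_g by (intro mult_left_mono add_mono) auto
    also have "ennreal (a / (a + b)) * 1 + ennreal (b / (a + b)) * 1 = ennreal (a / (a + b) + b / (a + b))"
      using ab by simp
    also have "a / (a + b) + b / (a + b) = 1" using ab by (simp add: add_divide_distrib[symmetric])
    finally show ?thesis using ab by (auto simp: Lq_le_def)
  qed
  show ?thesis
  proof (rule Lq_le_epsilon)
    fix e :: real assume "0 < e"
    then have "Lq_le M q (\<lambda>x. f x + g x) ((a + e / 2) + (b + e / 2))"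
      using f g q Lq_leD(2)[OF f] Lq_leD(2)[OF g]
      by (intro pos Lq_le_mono_bound[OF f] Lq_le_mono_bound[OF g]) auto
    then show "Lq_le M q (\<lambda>x. f x + g x) (a + b + e)" by (simp add: algebra_simps)
  qed (use Lq_leD(2)[OF f] Lq_leD(2)[OF g] q in auto)
qed

lemma Lq_le_sum:
  assumes "finite I" "\<And>i. i \<in> I \<Longrightarrow> Lq_le M q (f i) (c i)" "1 \<le> q"
  shows "Lq_le M q (\<lambda>x. \<Sum>i\<in>I. f i x) (\<Sum>i\<in>I. c i)"
  using assms(1,2)
proof (induction I rule: finite_induct)
  case empty
  then show ?case using assms by (simp add: Lq_le_def)
next
  case (insert i I)
  then show ?case using Lq_le_add[of M q "f i" "c i" "\<lambda>x. \<Sum>i\<in>I. f i x" "\<Sum>i\<in>I. c i"] assms(3)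
    by simp
qed

lemma Lq_le_AE_limit:
  assumes "\<And>n. Lq_le M q (f n) C" "AE x in M. (\<lambda>n. f n x) \<longlonglongrightarrow> g x" "g \<in> borel_measurable M" "0 < q"
  shows "Lq_le M q g C"
proof -
  note [measurable] = Lq_leD(1)[OF assms(1)] assms(3)
  have "(\<integral>\<^sup>+x. ennreal (norm (g x) powr q) \<partial>M) = (\<integral>\<^sup>+x. liminf (\<lambda>n. ennreal (norm (f n x) powr q)) \<partial>M)"
  proof (rule nn_integral_cong_AE, use assms(2) in eventually_elim)
    case (elim x)
    have "(\<lambda>n. norm (f n x) powr q) \<longlonglongrightarrow> norm (g x) powr q"
      using assms(4) by (intro tendsto_powr2 tendsto_norm elim) auto
    then have "(\<lambda>n. ennreal (norm (f n x) powr q)) \<longlonglongrightarrow> ennreal (norm (g x) powr q)"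
      by (rule tendsto_ennrealI)
    then show ?case using lim_imp_Liminf[OF trivial_limit_sequentially] by metis
  qed
  also have "\<dots> \<le> liminf (\<lambda>n. \<integral>\<^sup>+x. ennreal (norm (f n x) powr q) \<partial>M)"
    by (rule nn_integral_liminf) measurable
  also have "\<dots> \<le> ennreal (C powr q)"
    using Lq_leD(3)[OF assms(1)] by (intro Liminf_le) (auto intro!: always_eventually)
  finally show ?thesis using assms Lq_leD(2)[OF assms(1)] by (auto simp: Lq_le_def)
qed

lemma Lq_le_lebesgue_iff:
  assumes "f \<in> borel_measurable borel"
  shows "Lq_le lebesgue q f C \<longleftrightarrow> Lq_le lborel q f C"
  using assms unfolding Lq_le_def
  by (auto simp: nn_integral_completion measurable_completion)

lemma Lp_norm_le_iff:
  fixes f :: "'a::euclidean_space \<Rightarrow> complex"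
  assumes q: "0 < q" and C: "0 \<le> C" and f: "f \<in> borel_measurable lebesgue"
  shows "Lp_norm (ennreal q) f \<le> ennreal C \<longleftrightarrow> Lq_le lebesgue q f C"
proof -
  define I where "I = (\<integral>\<^sup>+x. ennreal (norm (f x) powr q) \<partial>lebesgue)"
  have N: "Lp_norm (ennreal q) f = (if I = \<infinity> then \<infinity> else ennreal (enn2real I powr (1 / q)))"
    using q by (simp add: Lp_norm_def I_def Let_def)
  show ?thesis
  proof (cases I)
    case (real i)
    have "i powr (1 / q) \<le> C \<longleftrightarrow> (i powr (1 / q)) powr q \<le> C powr q"
      using q C powr_mono2[of q "i powr (1 / q)" C] powr_less_mono2[of q C "i powr (1 / q)"]
      by (cases "i powr (1 / q) \<le> C") auto
    also have "(i powr (1 / q)) powr q = i" using q real by (simp add: powr_powr)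
    finally show ?thesis using real C f by (simp add: N Lq_le_def I_def[symmetric] ennreal_le_iff)
  next
    case top
    then show ?thesis using C by (simp add: N Lq_le_def I_def[symmetric] top_unique)
  qed
qed

section \<open>A kernel with trapezoidal Fourier transform\<close>

lemma integrable_inverse_one_plus_square: "integrable lborel (\<lambda>x::real. inverse (1 + x\<^sup>2))"
  using integrable_inverse_1_plus_square by (simp add: set_integrable_def einterval_def)

lemma one_minus_cos_le:
  fixes x :: real
  shows "1 - cos x \<le> x\<^sup>2 / 2"
proof -
  have "(sin (x / 2))\<^sup>2 \<le> (x / 2)\<^sup>2"
    using abs_sin_x_le_abs_x[of "x / 2"] abs_le_square_iff by blast
  then show ?thesis using cos_double_sin[of "x / 2"] by (simp add: power_divide)
qed

lemma integrable_one_minus_cos: "integrable lborel (\<lambda>x::real. (1 - cos (b * x)) / x\<^sup>2)"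
proof (cases "b = 0")
  case False
  have base: "integrable lborel (\<lambda>x::real. (1 - cos x) / x\<^sup>2)"
  proof (rule Bochner_Integration.integrable_bound)
    show "integrable lborel (\<lambda>x::real. 4 * inverse (1 + x\<^sup>2))"
      using integrable_inverse_one_plus_square by simp
    have "(1 - cos x) / x\<^sup>2 \<le> 4 * inverse (1 + x\<^sup>2)" for x :: real
    proof (cases "x = 0")
      case False
      have "(1 - cos x) * x\<^sup>2 \<le> 2 * x\<^sup>2" using cos_ge_minus_one[of x] by (intro mult_right_mono) auto
      then have "(1 - cos x) * (1 + x\<^sup>2) \<le> 4 * x\<^sup>2"
        using one_minus_cos_le[of x] by (simp add: algebra_simps) (smt (verit) zero_le_power2)
      then show ?thesis using False
        by (simp add: divide_simps add_pos_nonneg)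
    qed simp
    then show "AE x in lborel. norm ((1 - cos x) / x\<^sup>2) \<le> norm (4 * inverse (1 + x\<^sup>2) :: real)"
      by (auto simp: add_nonneg_nonneg)
  qed measurable
  have "integrable lborel (\<lambda>x::real. b\<^sup>2 * ((1 - cos (0 + b * x)) / (0 + b * x)\<^sup>2))"
    by (rule integrable_mult_right) (rule lborel_integrable_real_affine[OF base False, of 0])
  then show ?thesis using False by (simp add: power_mult_distrib)
qed simp

text \<open>
  The normalising constant of the Fejer kernel; its value is \<open>\<pi>\<close>.
\<close>

definition cos_const :: real where "cos_const = (\<integral>x. (1 - cos x) / x\<^sup>2 \<partial>lborel)"

text \<open>
  By scaling, \<open>\<bar>b\<bar>\<close> is up to a factor the regularised cosine transform of \<open>1 / x\<^sup>2\<close>. Every Fourier transform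
  below is a combination of such absolute values.
\<close>

lemma integral_one_minus_cos: "(\<integral>x. (1 - cos (b * x)) / x\<^sup>2 \<partial>lborel) = cos_const * \<bar>b\<bar>"
proof (cases "b = 0")
  case False
  have "cos_const = \<bar>b\<bar> * (\<integral>x. (1 - cos (b * x)) / (b * x)\<^sup>2 \<partial>lborel)"
    unfolding cos_const_def using lborel_integral_real_affine[OF False, of "\<lambda>x. (1 - cos x) / x\<^sup>2" 0] by simp
  also have "(\<lambda>x. (1 - cos (b * x)) / (b * x)\<^sup>2) = (\<lambda>x. 1 / b\<^sup>2 * ((1 - cos (b * x)) / x\<^sup>2))"
    by (simp add: power_mult_distrib)
  also have "\<bar>b\<bar> * (\<integral>x. 1 / b\<^sup>2 * ((1 - cos (b * x)) / x\<^sup>2) \<partial>lborel)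
      = \<bar>b\<bar> / b\<^sup>2 * (\<integral>x. (1 - cos (b * x)) / x\<^sup>2 \<partial>lborel)"
    by (simp only: integral_mult_right_zero) simp
  also have "\<bar>b\<bar> / b\<^sup>2 = 1 / \<bar>b\<bar>" by (simp add: power2_eq_square abs_if)
  finally show ?thesis using False by (simp add: field_simps)
qed simp

lemma cos_const_pos: "0 < cos_const"
proof -
  have c1: "cos 1 < (1::real)" using cos_monotone_0_pi[of 0 1] pi_gt3 by simp
  have "(\<integral>x. (1 - cos 1) / 4 * indicator {1..2::real} x \<partial>lborel) \<le> cos_const"
    unfolding cos_const_def
  proof (rule integral_mono)
    show "integrable lborel (\<lambda>x::real. (1 - cos x) / x\<^sup>2)" using integrable_one_minus_cos[of 1] by simp
    fix x :: real
    show "(1 - cos 1) / 4 * indicator {1..2} x \<le> (1 - cos x) / x\<^sup>2"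
    proof (cases "x \<in> {1..2}")
      case True
      then have "cos x \<le> cos 1" using pi_gt3 by (intro cos_monotone_0_pi_le) auto
      moreover have "x\<^sup>2 \<le> 2\<^sup>2" using True by (intro power_mono) auto
      ultimately have "(1 - cos 1) / 4 \<le> (1 - cos x) / x\<^sup>2"
        using c1 True by (intro frac_le) auto
      then show ?thesis using True by simp
    qed simp
  qed simp
  then show ?thesis using c1 by simp
qed

text \<open>
  The de la Vallee Poussin kernel. It is integrable, and convolution with it reproduces all frequencies
  in \<open>[-1, 1]\<close> and annihilates those outside \<open>[-2, 2]\<close>.
\<close>

definition vp_kernel :: "real \<Rightarrow> real" where
  "vp_kernel x = (cos x - cos (2 * x)) / (cos_const * x\<^sup>2)"

text \<open>
  The function that is \<open>1\<close> on \<open>[-1, 1]\<close>, \<open>0\<close> outside \<open>[-2, 2]\<close> and linear in between.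
\<close>

definition trapezoid :: "real \<Rightarrow> real" where
  "trapezoid a = (\<bar>a + 2\<bar> + \<bar>a - 2\<bar> - \<bar>a + 1\<bar> - \<bar>a - 1\<bar>) / 2"

lemma trapezoid_eq_1: "\<bar>a\<bar> \<le> 1 \<Longrightarrow> trapezoid a = 1"
  and trapezoid_eq_0: "2 \<le> \<bar>a\<bar> \<Longrightarrow> trapezoid a = 0"
  by (auto simp: trapezoid_def)

lemma borel_measurable_vp_kernel [measurable]: "vp_kernel \<in> borel_measurable borel"
  unfolding vp_kernel_def[abs_def] by measurable

lemma vp_kernel_even: "vp_kernel (- x) = vp_kernel x"
  by (simp add: vp_kernel_def)

lemma integrable_vp_kernel: "integrable lborel vp_kernel"
proof -
  have "integrable lborel (\<lambda>x. ((1 - cos (2 * x)) / x\<^sup>2 - (1 - cos (1 * x)) / x\<^sup>2) / cos_const)"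
    by (intro Bochner_Integration.integrable_diff integrable_divide integrable_one_minus_cos)
  also have "(\<lambda>x. ((1 - cos (2 * x)) / x\<^sup>2 - (1 - cos (1 * x)) / x\<^sup>2) / cos_const) = vp_kernel"
    by (rule ext) (simp add: vp_kernel_def diff_divide_distrib[symmetric] mult.commute)
  finally show ?thesis .
qed

lemma integrable_vp_kernel_mult:
  assumes "f \<in> borel_measurable borel" "\<And>x. norm (f x) \<le> 1"
  shows "integrable lborel (\<lambda>x. vp_kernel x * f x)"
  using assms
  by (intro Bochner_Integration.integrable_bound[OF integrable_vp_kernel])
     (auto simp: abs_mult mult_left_le)

lemma integral_vp_kernel_cos: "(\<integral>x. vp_kernel x * cos (a * x) \<partial>lborel) = trapezoid a"
proof -
  let ?D = "\<lambda>b x. (1 - cos (b * x)) / x\<^sup>2 :: real"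
  \<comment> \<open>Products of cosines are sums of cosines, and the constant terms cancel.\<close>
  have pw: "vp_kernel x * cos (a * x)
      = 1 / (2 * cos_const) * (?D (a + 2) x + ?D (a - 2) x - ?D (a + 1) x - ?D (a - 1) x)" for x
  proof -
    have "2 * (cos x * cos (a * x)) = cos ((a + 1) * x) + cos ((a - 1) * x)"
      by (simp add: cos_add cos_diff algebra_simps)
    moreover have "2 * (cos (2 * x) * cos (a * x)) = cos ((a + 2) * x) + cos ((a - 2) * x)"
      by (simp add: cos_add cos_diff algebra_simps)
    moreover have "vp_kernel x * cos (a * x) = 1 / (2 * cos_const) *
        ((2 * (cos x * cos (a * x)) - 2 * (cos (2 * x) * cos (a * x))) / x\<^sup>2)"
      by (simp add: vp_kernel_def algebra_simps diff_divide_distrib)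
    ultimately show ?thesis
      by (simp add: add_divide_distrib diff_divide_distrib)
  qed
  have "(\<integral>x. vp_kernel x * cos (a * x) \<partial>lborel) = 1 / (2 * cos_const) *
     (cos_const * \<bar>a + 2\<bar> + cos_const * \<bar>a - 2\<bar> - cos_const * \<bar>a + 1\<bar> - cos_const * \<bar>a - 1\<bar>)"
    unfolding pw
    by (simp only: integral_mult_right_zero Bochner_Integration.integral_diff
        Bochner_Integration.integral_add Bochner_Integration.integrable_diff
        Bochner_Integration.integrable_add integrable_one_minus_cos integral_one_minus_cos)
  also have "\<dots> = trapezoid a"
    using cos_const_pos by (simp add: trapezoid_def field_simps)
  finally show ?thesis .
qed

lemma integral_vp_kernel_cis: "(\<integral>x. of_real (vp_kernel x) * cis (a * x) \<partial>lborel) = of_real (trapezoid a)"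
proof -
  have i1: "integrable lborel (\<lambda>x. vp_kernel x * cos (a * x))"
    and i2: "integrable lborel (\<lambda>x. vp_kernel x * sin (a * x))"
    by (intro integrable_vp_kernel_mult; simp)+
  have odd: "(\<integral>x. vp_kernel x * sin (a * x) \<partial>lborel) = 0"
    using lborel_integral_real_affine[of "-1" "\<lambda>x. vp_kernel x * sin (a * x)" 0]
    by (simp add: vp_kernel_even)
  have "(\<integral>x. of_real (vp_kernel x) * cis (a * x) \<partial>lborel)
     = (\<integral>x. of_real (vp_kernel x * cos (a * x)) + \<i> * of_real (vp_kernel x * sin (a * x)) \<partial>lborel)"
    by (intro Bochner_Integration.integral_cong) (auto simp: complex_eq_iff)
  also have "\<dots> = of_real (\<integral>x. vp_kernel x * cos (a * x) \<partial>lborel)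
      + \<i> * of_real (\<integral>x. vp_kernel x * sin (a * x) \<partial>lborel)"
    using i1 i2 by (subst Bochner_Integration.integral_add) (auto simp del: of_real_mult)
  finally show ?thesis using odd integral_vp_kernel_cos by simp
qed

text \<open>
  Fourier inversion for the kernel, checked by integrating the trapezoid on its two pieces \<open>[0, 1]\<close> and
  \<open>[1, 2]\<close>; the common endpoint has measure zero.
\<close>

lemma vp_kernel_eq_integral:
  assumes "y \<noteq> 0"
  shows "vp_kernel y = 1 / cos_const *
    (\<integral>w. (indicator {0..1} w + indicator {1..2} w * (2 - w)) * cos (w * y) \<partial>lborel)"
proof -
  have c1: "has_bochner_integral lborel (\<lambda>w. indicator {0..1} w *\<^sub>R cos (w * y))
      (sin (1 * y) / y - sin (0 * y) / y)"
    by (rule has_bochner_integral_FTC_Icc)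
      (use assms in \<open>auto intro!: derivative_eq_intros continuous_intros
        simp flip: has_real_derivative_iff_has_vector_derivative\<close>)
  have c2: "has_bochner_integral lborel (\<lambda>w. indicator {1..2} w *\<^sub>R ((2 - w) * cos (w * y)))
      (((2 - 2) * sin (2 * y) / y - cos (2 * y) / y\<^sup>2) - ((2 - 1) * sin (1 * y) / y - cos (1 * y) / y\<^sup>2))"
    by (rule has_bochner_integral_FTC_Icc)
      (use assms in \<open>auto intro!: derivative_eq_intros continuous_intros
        simp: field_simps power2_eq_square simp flip: has_real_derivative_iff_has_vector_derivative\<close>)
  from has_bochner_integral_add[OF c1 c2]
  have "has_bochner_integral lborel (\<lambda>w. (indicator {0..1} w + indicator {1..2} w * (2 - w)) * cos (w * y))
     ((cos y - cos (2 * y)) / y\<^sup>2)"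
    by (simp add: algebra_simps diff_divide_distrib)
  then show ?thesis
    by (simp add: vp_kernel_def has_bochner_integral_integral_eq)
qed

section \<open>Almost orthogonality of frequency projections\<close>

definition vp_mass :: real where "vp_mass = (\<integral>x. \<bar>vp_kernel x\<bar> \<partial>lborel)"

definition modulated_vp :: "real \<Rightarrow> real \<Rightarrow> complex" where
  "modulated_vp c x = of_real (vp_kernel x) * cis (c * x)"

text \<open>
  A smooth projection to the frequencies within distance \<open>1\<close> of \<open>c\<close>.
\<close>

definition freq_conv :: "real \<Rightarrow> (real \<Rightarrow> complex) \<Rightarrow> real \<Rightarrow> complex" where
  "freq_conv c G x = (\<integral>y. modulated_vp c (x - y) * G y \<partial>lborel)"

lemma borel_measurable_cis [measurable]: "cis \<in> borel_measurable borel"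
  by (intro borel_measurable_continuous_onI continuous_intros)

lemma borel_measurable_modulated_vp [measurable]: "modulated_vp c \<in> borel_measurable borel"
  unfolding modulated_vp_def[abs_def] by measurable

lemma norm_modulated_vp: "norm (modulated_vp c x) = \<bar>vp_kernel x\<bar>"
  by (simp add: modulated_vp_def norm_mult)

lemma vp_mass_nonneg: "0 \<le> vp_mass"
  by (simp add: vp_mass_def)

lemma nn_integral_vp_kernel_translate: "(\<integral>\<^sup>+x. ennreal \<bar>vp_kernel (x - y)\<bar> \<partial>lborel) = ennreal vp_mass"
proof -
  have "(\<integral>\<^sup>+x. ennreal \<bar>vp_kernel x\<bar> \<partial>lborel) = ennreal vp_mass"
    unfolding vp_mass_def using integrable_vp_kernel by (intro nn_integral_eq_integral) auto
  moreover have "(\<integral>\<^sup>+x. ennreal \<bar>vp_kernel (x - y)\<bar> \<partial>lborel) = (\<integral>\<^sup>+x. ennreal \<bar>vp_kernel x\<bar> \<partial>lborel)"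
    using nn_integral_real_affine[of "\<lambda>x. ennreal \<bar>vp_kernel x\<bar>" 1 "- y"] by simp
  ultimately show ?thesis by simp
qed

lemma nn_integral_vp_kernel_reflect: "(\<integral>\<^sup>+y. ennreal \<bar>vp_kernel (x - y)\<bar> \<partial>lborel) = ennreal vp_mass"
  using nn_integral_vp_kernel_translate[of x] vp_kernel_even[of "_ - x"] by (simp add: minus_diff_eq)

lemma integrable_freq_conv:
  assumes [measurable]: "G \<in> borel_measurable borel" and "\<And>x. norm (G x) \<le> B"
  shows "integrable lborel (\<lambda>y. modulated_vp c (x - y) * G y)"
proof (rule Bochner_Integration.integrable_bound)
  show "integrable lborel (\<lambda>y. B * \<bar>vp_kernel (x - y)\<bar>)"
    using lborel_integrable_real_affine[OF integrable_vp_kernel, of "-1" x]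
    by (intro integrable_mult_right integrable_abs) simp
  have "0 \<le> B" using assms(2)[of 0] norm_ge_zero order_trans by blast
  then show "AE y in lborel. norm (modulated_vp c (x - y) * G y) \<le> norm (B * \<bar>vp_kernel (x - y)\<bar>)"
    using assms(2) by (auto simp: norm_mult norm_modulated_vp mult.commute[of B] intro!: mult_left_mono)
qed measurable

lemma borel_measurable_freq_conv [measurable]:
  assumes [measurable]: "G \<in> borel_measurable borel"
  shows "freq_conv c G \<in> borel_measurable borel"
  unfolding freq_conv_def[abs_def] by measurable

lemma norm_freq_conv_le:
  assumes [measurable]: "G \<in> borel_measurable borel"
  shows "ennreal (norm (freq_conv c G x)) \<le> (\<integral>\<^sup>+y. ennreal \<bar>vp_kernel (x - y)\<bar> * ennreal (norm (G y)) \<partial>lborel)"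
proof -
  have "ennreal (norm (freq_conv c G x)) \<le> (\<integral>\<^sup>+y. ennreal (norm (modulated_vp c (x - y) * G y)) \<partial>lborel)"
    unfolding freq_conv_def
    by (cases "integrable lborel (\<lambda>y. modulated_vp c (x - y) * G y)")
      (auto simp: not_integrable_integral_eq intro: integral_norm_bound_ennreal)
  then show ?thesis by (simp add: norm_mult norm_modulated_vp ennreal_mult)
qed

lemma freq_conv_add:
  assumes "G \<in> borel_measurable borel" "\<And>x. norm (G x) \<le> B" "H \<in> borel_measurable borel" "\<And>x. norm (H x) \<le> B'"
  shows "freq_conv c (\<lambda>x. G x + H x) x = freq_conv c G x + freq_conv c H x"
  unfolding freq_conv_def
  using integrable_freq_conv[OF assms(1,2)] integrable_freq_conv[OF assms(3,4)]
  by (simp add: distrib_left)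

lemma nn_integral_freq_conv_le:
  assumes [measurable]: "G \<in> borel_measurable borel"
  shows "(\<integral>\<^sup>+x. ennreal (norm (freq_conv c G x)) \<partial>lborel) \<le> ennreal vp_mass * (\<integral>\<^sup>+x. ennreal (norm (G x)) \<partial>lborel)"
proof -
  have "(\<integral>\<^sup>+x. ennreal (norm (freq_conv c G x)) \<partial>lborel)
     \<le> (\<integral>\<^sup>+x. (\<integral>\<^sup>+y. ennreal \<bar>vp_kernel (x - y)\<bar> * ennreal (norm (G y)) \<partial>lborel) \<partial>lborel)"
    by (intro nn_integral_mono norm_freq_conv_le) measurable
  also have "\<dots> = (\<integral>\<^sup>+y. (\<integral>\<^sup>+x. ennreal \<bar>vp_kernel (x - y)\<bar> * ennreal (norm (G y)) \<partial>lborel) \<partial>lborel)"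
    by (rule lborel_pair.Fubini') measurable
  also have "\<dots> = ennreal vp_mass * (\<integral>\<^sup>+x. ennreal (norm (G x)) \<partial>lborel)"
    by (simp add: nn_integral_multc nn_integral_cmult nn_integral_vp_kernel_translate)
  finally show ?thesis .
qed

lemma nn_integral_freq_conv_square_le:
  assumes [measurable]: "G \<in> borel_measurable borel"
  shows "(\<integral>\<^sup>+x. (ennreal (norm (freq_conv c G x)))\<^sup>2 \<partial>lborel)
     \<le> ennreal (vp_mass\<^sup>2) * (\<integral>\<^sup>+x. (ennreal (norm (G x)))\<^sup>2 \<partial>lborel)"
proof -
  have pw: "(ennreal (norm (freq_conv c G x)))\<^sup>2
      \<le> ennreal vp_mass * (\<integral>\<^sup>+y. ennreal \<bar>vp_kernel (x - y)\<bar> * (ennreal (norm (G y)))\<^sup>2 \<partial>lborel)" for x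
  proof -
    let ?k = "\<lambda>y. ennreal (sqrt \<bar>vp_kernel (x - y)\<bar>)"
    have k: "?k y * (?k y * z) = ennreal \<bar>vp_kernel (x - y)\<bar> * z" "(?k y)\<^sup>2 = ennreal \<bar>vp_kernel (x - y)\<bar>" for y z
      by (simp_all add: mult.assoc[symmetric] ennreal_mult'[symmetric] ennreal_power)
    have "(ennreal (norm (freq_conv c G x)))\<^sup>2 \<le> (\<integral>\<^sup>+y. ?k y * (?k y * ennreal (norm (G y))) \<partial>lborel)\<^sup>2"
      unfolding k by (intro power_mono norm_freq_conv_le) auto
    also have "\<dots> \<le> (\<integral>\<^sup>+y. (?k y)\<^sup>2 \<partial>lborel) * (\<integral>\<^sup>+y. (?k y * ennreal (norm (G y)))\<^sup>2 \<partial>lborel)"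
      by (rule Cauchy_Schwarz_nn_integral) measurable
    finally show ?thesis
      by (simp add: power_mult_distrib k nn_integral_vp_kernel_reflect)
  qed
  have "(\<integral>\<^sup>+x. (ennreal (norm (freq_conv c G x)))\<^sup>2 \<partial>lborel)
     \<le> (\<integral>\<^sup>+x. ennreal vp_mass * (\<integral>\<^sup>+y. ennreal \<bar>vp_kernel (x - y)\<bar> * (ennreal (norm (G y)))\<^sup>2 \<partial>lborel) \<partial>lborel)"
    by (intro nn_integral_mono pw)
  also have "\<dots> = ennreal vp_mass * (\<integral>\<^sup>+y. (\<integral>\<^sup>+x. ennreal \<bar>vp_kernel (x - y)\<bar> * (ennreal (norm (G y)))\<^sup>2 \<partial>lborel) \<partial>lborel)"
    by (subst nn_integral_cmult, measurable, subst lborel_pair.Fubini', measurable)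
  also have "\<dots> = ennreal (vp_mass\<^sup>2) * (\<integral>\<^sup>+x. (ennreal (norm (G x)))\<^sup>2 \<partial>lborel)"
    using vp_mass_nonneg
    by (simp add: nn_integral_multc nn_integral_cmult nn_integral_vp_kernel_translate power2_eq_square ennreal_mult mult.assoc)
  finally show ?thesis .
qed

lemma integrable_vp_product:
  assumes [measurable]: "f \<in> borel_measurable borel" and "\<And>x. norm (f x) \<le> B"
  shows "integrable lborel (\<lambda>x. complex_of_real (vp_kernel (x - u)) * f x)"
proof (rule Bochner_Integration.integrable_bound)
  show "integrable lborel (\<lambda>x. B * \<bar>vp_kernel (x - u)\<bar>)"
    using lborel_integrable_real_affine[OF integrable_vp_kernel, of "1" "-u"]
    by (intro integrable_mult_right integrable_abs) simp
  have "0 \<le> B" using assms(2)[of 0] norm_ge_zero order_trans by blast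
  then show "AE x in lborel. norm (complex_of_real (vp_kernel (x - u)) * f x) \<le> norm (B * \<bar>vp_kernel (x - u)\<bar>)"
    using assms(2) by (auto simp: norm_mult mult.commute[of B] intro!: mult_left_mono)
qed measurable

lemma integral_vp_kernel_cis_translate:
  "(\<integral>x. of_real (vp_kernel (x - u)) * cis (a * x) \<partial>lborel) = cis (a * u) * of_real (trapezoid a)"
proof -
  have "(\<integral>x. of_real (vp_kernel (x - u)) * cis (a * x) \<partial>lborel)
      = (\<integral>x. of_real (vp_kernel x) * cis (a * (u + x)) \<partial>lborel)"
    using lborel_integral_real_affine[of 1 "\<lambda>x. of_real (vp_kernel (x - u)) * cis (a * x)" u] by simp
  also have "\<dots> = (\<integral>x. cis (a * u) * (of_real (vp_kernel x) * cis (a * x)) \<partial>lborel)"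
    by (intro Bochner_Integration.integral_cong) (auto simp: cis_mult[symmetric] distrib_left)
  also have "\<dots> = cis (a * u) * of_real (trapezoid a)"
    by (simp add: integral_vp_kernel_cis)
  finally show ?thesis .
qed

text \<open>
  By Fourier inversion the second kernel is a superposition of cosines of frequency at most \<open>2\<close>. Multiplied
  by a wave of frequency \<open>c\<close> with \<open>\<bar>c\<bar> \<ge> 4\<close> these have frequencies of size at least \<open>2\<close>, where the
  transform of the first kernel vanishes. This is the orthogonality expressed by Plancherel's theorem.
\<close>

lemma vp_kernel_orthogonal:
  assumes "4 \<le> \<bar>c\<bar>"
  shows "(\<integral>x. of_real (vp_kernel (x - u) * vp_kernel (x - v)) * cis (c * x) \<partial>lborel) = 0"
proof -
  define h where "h = (\<lambda>w::real. indicator {0..1} w + indicator {1..2} w * (2 - w) :: real)"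
  have [measurable]: "h \<in> borel_measurable borel" unfolding h_def by measurable
  have h_supp: "h w = 0" if "w \<notin> {0..2}" for w using that by (auto simp: h_def indicator_def)
  have h_le: "\<bar>h w\<bar> \<le> 2" for w by (auto simp: h_def indicator_def)
  have wave: "(\<integral>x. of_real (vp_kernel (x - u)) * (cis (c * x) * of_real (cos (w * (x - v)))) \<partial>lborel) = 0"
    if "w \<in> {0..2}" for w
  proof -
    have z: "trapezoid (c + w) = 0" "trapezoid (c - w) = 0"
      using that assms by (auto intro!: trapezoid_eq_0)
    have eq: "cis (c * x) * of_real (cos (w * (x - v)))
        = cis (- w * v) / 2 * cis ((c + w) * x) + cis (w * v) / 2 * cis ((c - w) * x)" for x
      by (simp add: complex_eq_iff cos_add sin_add cos_diff sin_diff algebra_simps)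
        (simp add: field_simps)
    have i: "integrable lborel (\<lambda>x. of_real (vp_kernel (x - u)) * (k * cis (b * x)))" for k b
      by (rule integrable_vp_product[of _ "norm k"]) (auto simp: norm_mult)
    have "(\<integral>x. of_real (vp_kernel (x - u)) * (cis (c * x) * of_real (cos (w * (x - v)))) \<partial>lborel)
      = (\<integral>x. of_real (vp_kernel (x - u)) * (cis (- w * v) / 2 * cis ((c + w) * x)) \<partial>lborel)
        + (\<integral>x. of_real (vp_kernel (x - u)) * (cis (w * v) / 2 * cis ((c - w) * x)) \<partial>lborel)"
      unfolding eq distrib_left by (intro Bochner_Integration.integral_add i)
    also have "\<dots> = cis (- w * v) / 2 * (\<integral>x. of_real (vp_kernel (x - u)) * cis ((c + w) * x) \<partial>lborel)
        + cis (w * v) / 2 * (\<integral>x. of_real (vp_kernel (x - u)) * cis ((c - w) * x) \<partial>lborel)"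
      by (simp only: integral_mult_right_zero mult.left_commute[of "of_real _"])
    also have "\<dots> = 0" by (simp only: integral_vp_kernel_cis_translate z) simp
    finally show ?thesis .
  qed
  define \<Phi> where "\<Phi> = (\<lambda>x w. of_real (vp_kernel (x - u)) * (cis (c * x) * of_real (h w * cos (w * (x - v)))) :: complex)"
  have [measurable]: "case_prod \<Phi> \<in> borel_measurable (lborel \<Otimes>\<^sub>M lborel)"
    unfolding \<Phi>_def by measurable
  have int: "integrable (lborel \<Otimes>\<^sub>M lborel) (case_prod \<Phi>)"
  proof (rule integrableI_bounded)
    have "(\<integral>\<^sup>+z. ennreal (norm (case_prod \<Phi> z)) \<partial>(lborel \<Otimes>\<^sub>M lborel))
       = (\<integral>\<^sup>+x. \<integral>\<^sup>+w. ennreal (norm (\<Phi> x w)) \<partial>lborel \<partial>lborel)"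
      by (subst lborel.nn_integral_fst[symmetric]) auto
    also have "\<dots> \<le> (\<integral>\<^sup>+x. \<integral>\<^sup>+w. ennreal \<bar>vp_kernel (x - u)\<bar> * (2 * indicator {0..2::real} w) \<partial>lborel \<partial>lborel)"
    proof (intro nn_integral_mono)
      fix x w
      have "norm (\<Phi> x w) = \<bar>vp_kernel (x - u)\<bar> * (\<bar>h w\<bar> * \<bar>cos (w * (x - v))\<bar>)"
        by (simp add: \<Phi>_def norm_mult abs_mult)
      also have "\<dots> \<le> \<bar>vp_kernel (x - u)\<bar> * (2 * indicator {0..2} w)"
      proof (rule mult_left_mono)
        show "\<bar>h w\<bar> * \<bar>cos (w * (x - v))\<bar> \<le> 2 * indicator {0..2} w"
          using h_supp[of w] h_le[of w] mult_mono[of "\<bar>h w\<bar>" 2 "\<bar>cos (w * (x - v))\<bar>" 1]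
          by (cases "w \<in> {0..2}") auto
      qed simp
      finally have "ennreal (norm (\<Phi> x w)) \<le> ennreal (\<bar>vp_kernel (x - u)\<bar> * (2 * indicator {0..2} w))"
        by (rule ennreal_leI)
      then show "ennreal (norm (\<Phi> x w)) \<le> ennreal \<bar>vp_kernel (x - u)\<bar> * (2 * indicator {0..2} w)"
        by (auto simp: ennreal_mult ennreal_indicator split: split_indicator)
    qed
    also have "\<dots> = ennreal vp_mass * 4"
      by (simp add: nn_integral_cmult nn_integral_multc nn_integral_vp_kernel_translate)
    also have "\<dots> < \<infinity>" by (simp add: ennreal_mult_less_top)
    finally show "(\<integral>\<^sup>+z. ennreal (norm (case_prod \<Phi> z)) \<partial>(lborel \<Otimes>\<^sub>M lborel)) < \<infinity>" .
  qed measurable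
  have "(\<integral>x. of_real (vp_kernel (x - u) * vp_kernel (x - v)) * cis (c * x) \<partial>lborel)
     = (\<integral>x. of_real (1 / cos_const) * (\<integral>w. \<Phi> x w \<partial>lborel) \<partial>lborel)"
  proof (rule integral_cong_AE)
    have "AE x in lborel. x \<noteq> v" by (rule AE_lborel_singleton)
    then show "AE x in lborel. of_real (vp_kernel (x - u) * vp_kernel (x - v)) * cis (c * x)
        = of_real (1 / cos_const) * (\<integral>w. \<Phi> x w \<partial>lborel)"
    proof eventually_elim
      case (elim x)
      have "(\<integral>w. \<Phi> x w \<partial>lborel) = of_real (vp_kernel (x - u)) * (cis (c * x) *
         of_real (\<integral>w. h w * cos (w * (x - v)) \<partial>lborel))"
        unfolding \<Phi>_def by (simp only: integral_mult_right_zero integral_complex_of_real)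
      then show ?case
        using vp_kernel_eq_integral[of "x - v"] elim by (simp add: h_def)
    qed
  qed measurable
  also have "\<dots> = of_real (1 / cos_const) * (\<integral>w. \<integral>x. \<Phi> x w \<partial>lborel \<partial>lborel)"
    using lborel_pair.Fubini_integral[OF int] by simp
  also have "(\<integral>w. \<integral>x. \<Phi> x w \<partial>lborel \<partial>lborel) = (\<integral>w. 0 \<partial>(lborel :: real measure))"
  proof (rule Bochner_Integration.integral_cong)
    fix w
    have "(\<integral>x. \<Phi> x w \<partial>lborel) = of_real (h w) * (\<integral>x. of_real (vp_kernel (x - u)) * (cis (c * x) * of_real (cos (w * (x - v)))) \<partial>lborel)"
      unfolding integral_mult_right_zero[symmetric] \<Phi>_def
      by (intro Bochner_Integration.integral_cong) (auto simp: algebra_simps)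
    also have "\<dots> = 0" using wave[of w] h_supp[of w] by (cases "w \<in> {0..2}") auto
    finally show "(\<integral>x. \<Phi> x w \<partial>lborel) = 0" .
  qed simp
  finally show ?thesis by simp
qed

lemma borel_measurable_cnj [measurable]: "cnj \<in> borel_measurable borel"
  by (intro borel_measurable_continuous_onI continuous_intros)

lemma freq_conv_kernel_orthogonal:
  assumes [measurable]: "H \<in> borel_measurable borel" and H: "\<And>x. norm (H x) \<le> B" and cd: "4 \<le> \<bar>c - d\<bar>"
  shows "(\<integral>x. modulated_vp c (x - u) * cnj (freq_conv d H x) \<partial>lborel) = 0"
proof -
  define \<Phi> where "\<Phi> = (\<lambda>x v. cnj (modulated_vp c (x - u)) * (modulated_vp d (x - v) * H v))"
  have [measurable]: "case_prod \<Phi> \<in> borel_measurable (lborel \<Otimes>\<^sub>M lborel)"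
    unfolding \<Phi>_def by measurable
  have B0: "0 \<le> B" using H[of 0] norm_ge_zero order_trans by blast
  have int: "integrable (lborel \<Otimes>\<^sub>M lborel) (case_prod \<Phi>)"
  proof (rule integrableI_bounded)
    have "(\<integral>\<^sup>+z. ennreal (norm (case_prod \<Phi> z)) \<partial>(lborel \<Otimes>\<^sub>M lborel))
       = (\<integral>\<^sup>+x. \<integral>\<^sup>+v. ennreal (norm (\<Phi> x v)) \<partial>lborel \<partial>lborel)"
      by (subst lborel.nn_integral_fst[symmetric]) auto
    also have "\<dots> \<le> (\<integral>\<^sup>+x. \<integral>\<^sup>+v. ennreal \<bar>vp_kernel (x - u)\<bar> * (ennreal \<bar>vp_kernel (x - v)\<bar> * ennreal B) \<partial>lborel \<partial>lborel)"
      using H B0 by (intro nn_integral_mono)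
        (auto simp: \<Phi>_def norm_mult norm_modulated_vp ennreal_mult'[symmetric] intro!: ennreal_leI mult_left_mono)
    also have "\<dots> = ennreal vp_mass * (ennreal vp_mass * ennreal B)"
      by (simp add: nn_integral_cmult nn_integral_multc nn_integral_vp_kernel_translate nn_integral_vp_kernel_reflect)
    also have "\<dots> < \<infinity>" by (simp add: ennreal_mult_less_top)
    finally show "(\<integral>\<^sup>+z. ennreal (norm (case_prod \<Phi> z)) \<partial>(lborel \<Otimes>\<^sub>M lborel)) < \<infinity>" .
  qed measurable
  have "(\<integral>x. modulated_vp c (x - u) * cnj (freq_conv d H x) \<partial>lborel) = (\<integral>x. cnj (\<integral>v. \<Phi> x v \<partial>lborel) \<partial>lborel)"
    unfolding \<Phi>_def freq_conv_def by (simp only: integral_mult_right_zero complex_cnj_mult complex_cnj_cnj)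
  also have "\<dots> = cnj (\<integral>v. \<integral>x. \<Phi> x v \<partial>lborel \<partial>lborel)"
    using lborel_pair.Fubini_integral[OF int] by simp
  also have "(\<integral>v. \<integral>x. \<Phi> x v \<partial>lborel \<partial>lborel) = (\<integral>v. 0 \<partial>(lborel :: real measure))"
  proof (rule Bochner_Integration.integral_cong)
    fix v
    have "\<Phi> x v = (H v * cis (c * u - d * v)) *
        (of_real (vp_kernel (x - u) * vp_kernel (x - v)) * cis ((d - c) * x))" for x
    proof -
      have "cis (- (c * (x - u))) * cis (d * (x - v)) = cis (c * u - d * v) * cis ((d - c) * x)"
        unfolding cis_mult by (simp add: algebra_simps)
      then show ?thesis
        by (simp add: \<Phi>_def modulated_vp_def cis_cnj algebra_simps)
    qed
    then have "(\<integral>x. \<Phi> x v \<partial>lborel) = (H v * cis (c * u - d * v)) *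
        (\<integral>x. of_real (vp_kernel (x - u) * vp_kernel (x - v)) * cis ((d - c) * x) \<partial>lborel)"
      by (simp only: integral_mult_right_zero)
    then show "(\<integral>x. \<Phi> x v \<partial>lborel) = 0"
      using vp_kernel_orthogonal[of "d - c" u v] cd by (simp add: abs_minus_commute)
  qed simp
  finally show ?thesis by simp
qed

text \<open>
  Fubini's theorem moves both convolutions onto the kernels. The factor \<open>\<bar>G u\<bar> \<bar>g x\<bar>\<close> is absolutely
  integrable against the kernel because it is at most \<open>\<bar>G u\<bar>\<^sup>2 + \<bar>g x\<bar>\<^sup>2\<close>.
\<close>

lemma freq_conv_orthogonal:
  assumes [measurable]: "G \<in> borel_measurable borel" "H \<in> borel_measurable borel"
    and H: "\<And>x. norm (H x) \<le> B"
    and G2: "(\<integral>\<^sup>+x. (ennreal (norm (G x)))\<^sup>2 \<partial>lborel) < \<infinity>"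
    and H2: "(\<integral>\<^sup>+x. (ennreal (norm (H x)))\<^sup>2 \<partial>lborel) < \<infinity>"
    and cd: "4 \<le> \<bar>c - d\<bar>"
  shows "(\<integral>x. freq_conv c G x * cnj (freq_conv d H x) \<partial>lborel) = 0"
proof -
  define g where "g = freq_conv d H"
  have [measurable]: "g \<in> borel_measurable borel" unfolding g_def by measurable
  define \<Phi> where "\<Phi> = (\<lambda>x u. modulated_vp c (x - u) * G u * cnj (g x))"
  have [measurable]: "case_prod \<Phi> \<in> borel_measurable (lborel \<Otimes>\<^sub>M lborel)"
    unfolding \<Phi>_def by measurable
  have g2: "(\<integral>\<^sup>+x. (ennreal (norm (g x)))\<^sup>2 \<partial>lborel) < \<infinity>"
    using nn_integral_freq_conv_square_le[of H d] H2 unfolding g_def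
    by (auto intro: le_less_trans simp: ennreal_mult_less_top)
  have int: "integrable (lborel \<Otimes>\<^sub>M lborel) (case_prod \<Phi>)"
  proof (rule integrableI_bounded)
    have "(\<integral>\<^sup>+z. ennreal (norm (case_prod \<Phi> z)) \<partial>(lborel \<Otimes>\<^sub>M lborel))
       = (\<integral>\<^sup>+x. \<integral>\<^sup>+u. ennreal (norm (\<Phi> x u)) \<partial>lborel \<partial>lborel)"
      by (subst lborel.nn_integral_fst[symmetric]) auto
    also have "\<dots> \<le> (\<integral>\<^sup>+x. \<integral>\<^sup>+u. ennreal \<bar>vp_kernel (x - u)\<bar> * (ennreal (norm (G u)))\<^sup>2
        + ennreal \<bar>vp_kernel (x - u)\<bar> * (ennreal (norm (g x)))\<^sup>2 \<partial>lborel \<partial>lborel)"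
    proof (intro nn_integral_mono)
      fix x u
      have "norm (G u) * norm (g x) \<le> (norm (G u))\<^sup>2 + (norm (g x))\<^sup>2"
        using sum_squares_bound[of "norm (G u)" "norm (g x)"]
          mult_nonneg_nonneg[OF norm_ge_zero[of "G u"] norm_ge_zero[of "g x"]] by linarith
      from mult_left_mono[OF this abs_ge_zero[of "vp_kernel (x - u)"]]
      have "norm (\<Phi> x u) \<le> \<bar>vp_kernel (x - u)\<bar> * (norm (G u))\<^sup>2 + \<bar>vp_kernel (x - u)\<bar> * (norm (g x))\<^sup>2"
        by (simp add: \<Phi>_def norm_mult norm_modulated_vp distrib_left mult.assoc)
      from ennreal_leI[OF this]
      show "ennreal (norm (\<Phi> x u)) \<le> ennreal \<bar>vp_kernel (x - u)\<bar> * (ennreal (norm (G u)))\<^sup>2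
        + ennreal \<bar>vp_kernel (x - u)\<bar> * (ennreal (norm (g x)))\<^sup>2"
        by (simp add: ennreal_mult ennreal_power)
    qed
    also have "\<dots> = ennreal vp_mass * (\<integral>\<^sup>+x. (ennreal (norm (G x)))\<^sup>2 \<partial>lborel)
       + ennreal vp_mass * (\<integral>\<^sup>+x. (ennreal (norm (g x)))\<^sup>2 \<partial>lborel)"
    proof -
      have "(\<integral>\<^sup>+x. \<integral>\<^sup>+u. ennreal \<bar>vp_kernel (x - u)\<bar> * (ennreal (norm (G u)))\<^sup>2 \<partial>lborel \<partial>lborel)
        = (\<integral>\<^sup>+u. \<integral>\<^sup>+x. ennreal \<bar>vp_kernel (x - u)\<bar> * (ennreal (norm (G u)))\<^sup>2 \<partial>lborel \<partial>lborel)"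
        by (rule lborel_pair.Fubini') measurable
      then show ?thesis
        by (simp add: nn_integral_add nn_integral_cmult nn_integral_multc nn_integral_vp_kernel_translate
            nn_integral_vp_kernel_reflect)
    qed
    also have "\<dots> < \<infinity>" using G2 g2 by (simp add: ennreal_mult_less_top)
    finally show "(\<integral>\<^sup>+z. ennreal (norm (case_prod \<Phi> z)) \<partial>(lborel \<Otimes>\<^sub>M lborel)) < \<infinity>" .
  qed measurable
  have "(\<integral>x. freq_conv c G x * cnj (g x) \<partial>lborel) = (\<integral>x. \<integral>u. \<Phi> x u \<partial>lborel \<partial>lborel)"
    unfolding \<Phi>_def freq_conv_def by (simp only: integral_mult_left_zero)
  also have "\<dots> = (\<integral>u. \<integral>x. \<Phi> x u \<partial>lborel \<partial>lborel)"
    using lborel_pair.Fubini_integral[OF int] by simp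
  also have "\<dots> = (\<integral>u. 0 \<partial>(lborel :: real measure))"
  proof (rule Bochner_Integration.integral_cong)
    fix u
    have "(\<integral>x. \<Phi> x u \<partial>lborel) = G u * (\<integral>x. modulated_vp c (x - u) * cnj (g x) \<partial>lborel)"
      unfolding \<Phi>_def integral_mult_right_zero[symmetric]
      by (intro Bochner_Integration.integral_cong) (auto simp: mult_ac)
    then show "(\<integral>x. \<Phi> x u \<partial>lborel) = 0"
      unfolding g_def using freq_conv_kernel_orthogonal[OF assms(2) H cd] by simp
  qed simp
  finally show ?thesis by (simp add: g_def)
qed

text \<open>
  Only neighbouring indices interact, so in the expanded square each function meets at most three others,
  itself included.
\<close>

lemma nn_integral_almost_orthogonal_sum:
  fixes g :: "int \<Rightarrow> 'a \<Rightarrow> complex"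
  assumes fin: "finite I" and [measurable]: "\<And>m. g m \<in> borel_measurable M"
    and g2: "\<And>m. m \<in> I \<Longrightarrow> (\<integral>\<^sup>+x. (ennreal (norm (g m x)))\<^sup>2 \<partial>M) < \<infinity>"
    and orth: "\<And>m n. m \<in> I \<Longrightarrow> n \<in> I \<Longrightarrow> 2 \<le> \<bar>m - n\<bar> \<Longrightarrow> (\<integral>x. g m x * cnj (g n x) \<partial>M) = 0"
  shows "(\<integral>\<^sup>+x. (ennreal (norm (\<Sum>m\<in>I. g m x)))\<^sup>2 \<partial>M) \<le> 3 * (\<Sum>m\<in>I. \<integral>\<^sup>+x. (ennreal (norm (g m x)))\<^sup>2 \<partial>M)"
proof -
  have int2: "integrable M (\<lambda>x. (norm (g m x))\<^sup>2)" if "m \<in> I" for m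
    by (rule integrableI_bounded) (use g2[OF that] in \<open>auto simp: ennreal_power\<close>)
  define E where "E m = (\<integral>x. (norm (g m x))\<^sup>2 \<partial>M)" for m
  have E: "(\<integral>\<^sup>+x. (ennreal (norm (g m x)))\<^sup>2 \<partial>M) = ennreal (E m)" if "m \<in> I" for m
    unfolding E_def using nn_integral_eq_integral[OF int2[OF that]] by (simp add: ennreal_power)
  have E0: "0 \<le> E m" for m unfolding E_def by simp
  have le: "norm (g m x * cnj (g n x)) \<le> ((norm (g m x))\<^sup>2 + (norm (g n x))\<^sup>2) / 2" for m n x
    using sum_squares_bound[of "norm (g m x)" "norm (g n x)"] by (simp add: norm_mult)
  have int_mn: "integrable M (\<lambda>x. g m x * cnj (g n x))" if "m \<in> I" "n \<in> I" for m n
  proof (rule Bochner_Integration.integrable_bound)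
    show "integrable M (\<lambda>x. ((norm (g m x))\<^sup>2 + (norm (g n x))\<^sup>2) / 2)" using int2 that by auto
    show "(\<lambda>x. g m x * cnj (g n x)) \<in> borel_measurable M" by measurable
    show "AE x in M. norm (g m x * cnj (g n x)) \<le> norm (((norm (g m x))\<^sup>2 + (norm (g n x))\<^sup>2) / 2)"
      using le[of m _ n] by (intro AE_I2) (simp add: abs_of_nonneg)
  qed
  have inner_le: "Re (\<integral>x. g m x * cnj (g n x) \<partial>M) \<le> (if \<bar>m - n\<bar> \<le> 1 then (E m + E n) / 2 else 0)"
    if "m \<in> I" "n \<in> I" for m n
  proof (cases "\<bar>m - n\<bar> \<le> 1")
    case True
    have "Re (\<integral>x. g m x * cnj (g n x) \<partial>M) \<le> norm (\<integral>x. g m x * cnj (g n x) \<partial>M)"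
      by (rule complex_Re_le_cmod)
    also have "\<dots> \<le> (\<integral>x. norm (g m x * cnj (g n x)) \<partial>M)" by (rule integral_norm_bound)
    also have "\<dots> \<le> (\<integral>x. ((norm (g m x))\<^sup>2 + (norm (g n x))\<^sup>2) / 2 \<partial>M)"
      using le int2 that int_mn by (intro integral_mono integrable_norm) auto
    also have "\<dots> = (E m + E n) / 2" using int2 that by (simp add: E_def)
    finally show ?thesis using True by simp
  next
    case False
    then show ?thesis using orth[OF that] by simp
  qed
  have pw: "(norm (\<Sum>m\<in>I. g m x))\<^sup>2 = Re (\<Sum>m\<in>I. \<Sum>n\<in>I. g m x * cnj (g n x))" for x
    unfolding sum_product[symmetric] cnj_sum[symmetric] complex_norm_square[symmetric] by simp
  have "integrable M (\<lambda>x. (norm (\<Sum>m\<in>I. g m x))\<^sup>2)"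
    unfolding pw using int_mn by (intro integrable_Re Bochner_Integration.integrable_sum) auto
  then have "(\<integral>\<^sup>+x. ennreal ((norm (\<Sum>m\<in>I. g m x))\<^sup>2) \<partial>M)
      = ennreal (\<integral>x. (norm (\<Sum>m\<in>I. g m x))\<^sup>2 \<partial>M)"
    by (intro nn_integral_eq_integral) simp_all
  also have "(\<integral>x. (norm (\<Sum>m\<in>I. g m x))\<^sup>2 \<partial>M) = Re (\<integral>x. (\<Sum>m\<in>I. \<Sum>n\<in>I. g m x * cnj (g n x)) \<partial>M)"
    unfolding pw using int_mn by (intro integral_Re Bochner_Integration.integrable_sum) auto
  also have "\<dots> = (\<Sum>m\<in>I. \<Sum>n\<in>I. Re (\<integral>x. g m x * cnj (g n x) \<partial>M))"
    using int_mn by (simp add: Bochner_Integration.integral_sum Bochner_Integration.integrable_sum)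
  also have "\<dots> \<le> (\<Sum>m\<in>I. \<Sum>n\<in>I. if \<bar>m - n\<bar> \<le> 1 then (E m + E n) / 2 else 0)"
    by (intro sum_mono inner_le)
  also have "\<dots> = (\<Sum>m\<in>I. \<Sum>n\<in>I. if \<bar>m - n\<bar> \<le> 1 then E m / 2 else 0)
      + (\<Sum>m\<in>I. \<Sum>n\<in>I. if \<bar>m - n\<bar> \<le> 1 then E n / 2 else 0)"
    unfolding sum.distrib[symmetric] by (intro sum.cong refl) (simp add: add_divide_distrib)
  also have "(\<Sum>m\<in>I. \<Sum>n\<in>I. if \<bar>m - n\<bar> \<le> 1 then E n / 2 else 0)
      = (\<Sum>m\<in>I. \<Sum>n\<in>I. if \<bar>m - n\<bar> \<le> 1 then E m / 2 else 0)"
    by (subst sum.swap) (simp add: abs_minus_commute)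
  also have "(\<Sum>m\<in>I. \<Sum>n\<in>I. if \<bar>m - n\<bar> \<le> 1 then E m / 2 else 0)
      + (\<Sum>m\<in>I. \<Sum>n\<in>I. if \<bar>m - n\<bar> \<le> 1 then E m / 2 else 0)
      = (\<Sum>m\<in>I. real (card {n \<in> I. \<bar>m - n\<bar> \<le> 1}) * E m)"
    unfolding sum.distrib[symmetric]
    using fin by (intro sum.cong refl) (simp add: sum.If_cases Int_def flip: sum_distrib_left)
  also have "\<dots> \<le> (\<Sum>m\<in>I. 3 * E m)"
  proof (intro sum_mono mult_right_mono E0)
    fix m
    have "card {n \<in> I. \<bar>m - n\<bar> \<le> 1} \<le> card {m - 1..m + 1}" by (intro card_mono) auto
    then show "real (card {n \<in> I. \<bar>m - n\<bar> \<le> 1}) \<le> 3" by simp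
  qed
  also have "ennreal (\<Sum>m\<in>I. 3 * E m) = 3 * (\<Sum>m\<in>I. \<integral>\<^sup>+x. (ennreal (norm (g m x)))\<^sup>2 \<partial>M)"
    using E0 by (simp add: E ennreal_mult sum_nonneg flip: sum_distrib_left)
  finally show ?thesis by (simp add: ennreal_power ennreal_leI)
qed

section \<open>Decoupling of separated frequency intervals\<close>

text \<open>
  An upper bound, uniform in \<open>t\<close>, for \<open>\<Sum>j. 2 powr (- c * \<bar>j - t\<bar>)\<close> over all integers \<open>j\<close>; the factor
  \<open>2 powr c\<close> pays for rounding \<open>t\<close> to an integer.
\<close>

definition geo_const :: "real \<Rightarrow> real" where
  "geo_const c = 2 powr c * (2 / (1 - 2 powr (- c)))"

lemma geo_const_pos: "0 < c \<Longrightarrow> 0 < geo_const c"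
  by (simp add: geo_const_def powr_less_one)

lemma sum_powr_dist_le:
  assumes c: "0 < c" and S: "finite (S :: int set)"
  shows "(\<Sum>j\<in>S. 2 powr (- c * \<bar>of_int j - t\<bar>)) \<le> geo_const c"
proof -
  define q :: real where "q = 2 powr (- c)"
  define l where "l = \<lfloor>t\<rfloor>"
  have q: "0 < q" "q < 1" using c by (auto simp: q_def powr_less_one)
  have nat_sum: "(\<Sum>k\<in>K. q ^ k) \<le> 1 / (1 - q)" if "finite K" for K
    using sum_le_suminf[of "\<lambda>k. q ^ k" K] q that by (simp add: suminf_geometric summable_geometric)
  have half: "(\<Sum>j\<in>R. q ^ nat \<bar>j - l\<bar>) \<le> 1 / (1 - q)"
    if "inj_on (\<lambda>j. nat \<bar>j - l\<bar>) R" "finite R" for R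
    using nat_sum[of "(\<lambda>j. nat \<bar>j - l\<bar>) ` R"] that by (simp add: sum.reindex)
  have "(\<Sum>j\<in>S. q ^ nat \<bar>j - l\<bar>) = (\<Sum>j\<in>S \<inter> {l..}. q ^ nat \<bar>j - l\<bar>) + (\<Sum>j\<in>S \<inter> {..<l}. q ^ nat \<bar>j - l\<bar>)"
    using S by (subst sum.union_disjoint[symmetric]) (auto intro!: sum.cong)
  also have "\<dots> \<le> 1 / (1 - q) + 1 / (1 - q)"
    using S by (intro add_mono half) (auto simp: inj_on_def)
  finally have main: "(\<Sum>j\<in>S. q ^ nat \<bar>j - l\<bar>) \<le> 2 / (1 - q)" by simp
  have "2 powr (- c * \<bar>of_int j - t\<bar>) \<le> 2 powr c * q ^ nat \<bar>j - l\<bar>" for j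
  proof -
    have "real_of_int \<bar>j - l\<bar> \<le> \<bar>of_int j - t\<bar> + 1"
      unfolding l_def by linarith
    then have "- c * \<bar>of_int j - t\<bar> \<le> c + - c * real_of_int \<bar>j - l\<bar>"
      using mult_left_mono[of "real_of_int \<bar>j - l\<bar>" "\<bar>of_int j - t\<bar> + 1" c] c by (simp add: algebra_simps)
    then have "2 powr (- c * \<bar>of_int j - t\<bar>) \<le> 2 powr (c + - c * real_of_int \<bar>j - l\<bar>)"
      by (intro powr_mono) auto
    also have "\<dots> = 2 powr c * q ^ nat \<bar>j - l\<bar>"
      by (simp add: q_def powr_powr flip: powr_realpow powr_add)
    finally show ?thesis .
  qed
  then have "(\<Sum>j\<in>S. 2 powr (- c * \<bar>of_int j - t\<bar>)) \<le> (\<Sum>j\<in>S. 2 powr c * q ^ nat \<bar>j - l\<bar>)"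
    by (rule sum_mono)
  also have "\<dots> \<le> geo_const c"
    using mult_left_mono[OF main, of "2 powr c"] by (simp add: geo_const_def q_def sum_distrib_left)
  finally show ?thesis .
qed

lemma nn_integral_le_of_pointwise_limit:
  fixes f :: "nat \<Rightarrow> 'a \<Rightarrow> ennreal"
  assumes [measurable]: "\<And>n. f n \<in> borel_measurable M"
    and lim: "AE x in M. (\<lambda>n. f n x) \<longlonglongrightarrow> g x" and le: "\<And>n. (\<integral>\<^sup>+x. f n x \<partial>M) \<le> C"
  shows "(\<integral>\<^sup>+x. g x \<partial>M) \<le> C"
proof -
  have "(\<integral>\<^sup>+x. g x \<partial>M) = (\<integral>\<^sup>+x. liminf (\<lambda>n. f n x) \<partial>M)"
    by (rule nn_integral_cong_AE, use lim in eventually_elim)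
      (metis lim_imp_Liminf trivial_limit_sequentially)
  also have "\<dots> \<le> liminf (\<lambda>n. \<integral>\<^sup>+x. f n x \<partial>M)"
    by (rule nn_integral_liminf) measurable
  also have "\<dots> \<le> C"
    using le by (intro Liminf_le) (auto intro!: always_eventually)
  finally show ?thesis .
qed

text \<open>
  The two geometric series of real interpolation: for truncation heights above \<open>y\<close> the \<open>L\<^sup>2\<close> term decays
  because \<open>s < 2\<close>, and for heights below \<open>y\<close> the \<open>L\<^sup>1\<close> term decays because \<open>1 < s\<close>.
\<close>

lemma sum_truncated_powers_le:
  assumes s: "1 < s" "s < 2" and y: "0 \<le> (y::real)" and S: "finite (S :: int set)" and A: "0 \<le> a" "0 \<le> b"
  shows "(\<Sum>N\<in>S. a * 2 powr (of_int N * (s - 2)) * (if y \<le> 2 powr of_int N then y else 0)\<^sup>2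
      + b * 2 powr (of_int N * (s - 1)) * (if y \<le> 2 powr of_int N then 0 else y))
    \<le> (a * geo_const (2 - s) + b * geo_const (s - 1)) * y powr s"
proof (cases "y = 0")
  case False
  with y have y: "0 < y" by simp
  define t where "t = log 2 y"
  have yt: "y = 2 powr t" using y by (simp add: t_def)
  have le_iff: "y \<le> 2 powr of_int N \<longleftrightarrow> t \<le> of_int N" for N :: int unfolding yt by simp
  have sq: "y\<^sup>2 = 2 powr (2 * t)" by (simp add: yt power2_eq_square flip: powr_add)
  have ys: "y powr s = 2 powr (t * s)" by (simp add: yt powr_powr)
  have low: "2 powr (of_int N * (s - 2)) * (if y \<le> 2 powr of_int N then y else 0)\<^sup>2
       \<le> 2 powr (- (2 - s) * \<bar>of_int N - t\<bar>) * y powr s" for N :: int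
    unfolding le_iff using s
    by (auto simp: sq ys algebra_simps simp flip: powr_add)
  have high: "2 powr (of_int N * (s - 1)) * (if y \<le> 2 powr of_int N then 0 else y)
       \<le> 2 powr (- (s - 1) * \<bar>of_int N - t\<bar>) * y powr s" for N :: int
  proof (cases "t \<le> of_int N")
    case False
    then show ?thesis unfolding le_iff ys using s by (simp add: yt algebra_simps flip: powr_add)
  qed (simp add: le_iff)
  have "(\<Sum>N\<in>S. a * 2 powr (of_int N * (s - 2)) * (if y \<le> 2 powr of_int N then y else 0)\<^sup>2
      + b * 2 powr (of_int N * (s - 1)) * (if y \<le> 2 powr of_int N then 0 else y))
    \<le> (\<Sum>N\<in>S. a * (2 powr (- (2 - s) * \<bar>of_int N - t\<bar>) * y powr s)
        + b * (2 powr (- (s - 1) * \<bar>of_int N - t\<bar>) * y powr s))"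
    unfolding mult.assoc using low high A by (intro sum_mono add_mono mult_left_mono)
  also have "\<dots> = (a * (\<Sum>N\<in>S. 2 powr (- (2 - s) * \<bar>of_int N - t\<bar>))
      + b * (\<Sum>N\<in>S. 2 powr (- (s - 1) * \<bar>of_int N - t\<bar>))) * y powr s"
    by (simp add: sum.distrib sum_distrib_left sum_distrib_right distrib_right mult.assoc)
  also have "\<dots> \<le> (a * geo_const (2 - s) + b * geo_const (s - 1)) * y powr s"
    using s S A by (intro mult_right_mono add_mono mult_left_mono sum_powr_dist_le) auto
  finally show ?thesis .
qed simp

definition decoupling_const :: "real \<Rightarrow> real" where
  "decoupling_const s = 48 * vp_mass\<^sup>2 * geo_const (2 - s) + 2 * vp_mass * geo_const (s - 1) + 1"

lemma decoupling_const_pos: "1 < s \<Longrightarrow> s < 2 \<Longrightarrow> 0 < decoupling_const s"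
  using geo_const_pos[of "2 - s"] geo_const_pos[of "s - 1"] vp_mass_nonneg
  by (auto simp: decoupling_const_def intro!: add_nonneg_pos add_nonneg_nonneg mult_nonneg_nonneg)

text \<open>
  The map \<open>(G\<^sub>m) \<mapsto> \<Sum>m. freq_conv (c m) (G\<^sub>m)\<close> is bounded from \<open>\<ell>\<^sup>1(L\<^sup>1)\<close> to \<open>L\<^sup>1\<close> trivially and from
  \<open>\<ell>\<^sup>2(L\<^sup>2)\<close> to \<open>L\<^sup>2\<close> by almost orthogonality, hence from \<open>\<ell>\<^sup>s(L\<^sup>s)\<close> to \<open>L\<^sup>s\<close> by real interpolation. It is
  applied to functions which it reproduces. Each \<open>F\<^sub>m\<close> is cut at every height \<open>2 powr N\<close>, and at a point where
  the sum \<open>H\<close> has size about \<open>2 powr N\<close> one of the two pieces of that height carries at least half of it.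
\<close>

lemma frequency_decoupling:
  fixes F :: "int \<Rightarrow> real \<Rightarrow> complex"
  assumes s: "1 < s" "s < 2" and I: "finite I"
    and sep: "\<And>m n. m \<in> I \<Longrightarrow> n \<in> I \<Longrightarrow> 2 \<le> \<bar>m - n\<bar> \<Longrightarrow> 4 \<le> \<bar>c m - c n\<bar>"
    and [measurable]: "\<And>m. F m \<in> borel_measurable borel"
    and bd: "\<And>m x. norm (F m x) \<le> B"
    and repr: "\<And>m x. m \<in> I \<Longrightarrow> freq_conv (c m) (F m) x = F m x"
  shows "(\<integral>\<^sup>+x. ennreal (norm (\<Sum>m\<in>I. F m x) powr s) \<partial>lborel)
     \<le> ennreal (decoupling_const s) * (\<Sum>m\<in>I. \<integral>\<^sup>+x. ennreal (norm (F m x) powr s) \<partial>lborel)"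
proof (cases "\<forall>m\<in>I. (\<integral>\<^sup>+x. ennreal (norm (F m x) powr s) \<partial>lborel) < \<infinity>")
  case False
  then have "(\<Sum>m\<in>I. \<integral>\<^sup>+x. ennreal (norm (F m x) powr s) \<partial>lborel) = \<infinity>"
    using I by (auto simp: less_top[symmetric])
  then show ?thesis using decoupling_const_pos[OF s] by (simp add: ennreal_mult_top)
next
  case fin: True
  define H where "H x = (\<Sum>m\<in>I. F m x)" for x
  define low where "low N m x = (if norm (F m x) \<le> 2 powr real_of_int N then F m x else 0)" for N m x
  define high where "high N m x = (if norm (F m x) \<le> 2 powr real_of_int N then 0 else F m x)" for N m x
  define TL where "TL N x = (\<Sum>m\<in>I. freq_conv (c m) (low N m) x)" for N x
  define TH where "TH N x = (\<Sum>m\<in>I. freq_conv (c m) (high N m) x)" for N x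
  have [measurable]: "low N m \<in> borel_measurable borel" "high N m \<in> borel_measurable borel" for N m
    unfolding low_def[abs_def] high_def[abs_def] by measurable
  have [measurable]: "H \<in> borel_measurable borel" unfolding H_def[abs_def] by measurable
  have [measurable]: "TL N \<in> borel_measurable borel" "TH N \<in> borel_measurable borel" for N
    unfolding TL_def[abs_def] TH_def[abs_def] by measurable
  have B0: "0 \<le> B" using bd[of undefined undefined] norm_ge_zero order_trans by blast
  have low_bd: "norm (low N m x) \<le> B" and high_bd: "norm (high N m x) \<le> B" for N m x
    using bd B0 by (auto simp: low_def high_def)
  have split: "H x = TL N x + TH N x" for N x
  proof -
    have "F m x = freq_conv (c m) (low N m) x + freq_conv (c m) (high N m) x" if "m \<in> I" for m
    proof -
      have "F m = (\<lambda>x. low N m x + high N m x)" by (auto simp: low_def high_def)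
      then have "freq_conv (c m) (F m) x = freq_conv (c m) (\<lambda>x. low N m x + high N m x) x" by simp
      also have "\<dots> = freq_conv (c m) (low N m) x + freq_conv (c m) (high N m) x"
        by (rule freq_conv_add[OF _ low_bd _ high_bd]) measurable
      finally show ?thesis using repr[OF that] by simp
    qed
    then show ?thesis by (simp add: H_def TL_def TH_def sum.distrib)
  qed
  have L2: "(\<integral>\<^sup>+x. (ennreal (norm (TL N x)))\<^sup>2 \<partial>lborel)
      \<le> 3 * ennreal (vp_mass\<^sup>2) * (\<Sum>m\<in>I. \<integral>\<^sup>+x. (ennreal (norm (low N m x)))\<^sup>2 \<partial>lborel)" for N
  proof -
    have low2: "(\<integral>\<^sup>+x. (ennreal (norm (low N m x)))\<^sup>2 \<partial>lborel) < \<infinity>" if "m \<in> I" for m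
    proof -
      have "(\<integral>\<^sup>+x. (ennreal (norm (low N m x)))\<^sup>2 \<partial>lborel)
         \<le> (\<integral>\<^sup>+x. ennreal ((2 powr N) powr (2 - s)) * ennreal (norm (F m x) powr s) \<partial>lborel)"
      proof (rule nn_integral_mono)
        fix x
        have "(norm (low N m x))\<^sup>2 \<le> (2 powr N) powr (2 - s) * norm (F m x) powr s"
        proof (cases "norm (F m x) \<le> 2 powr N \<and> F m x \<noteq> 0")
          case True
          have "(norm (low N m x))\<^sup>2 = norm (F m x) powr (2 - s) * norm (F m x) powr s"
            using True by (simp add: low_def powr_add[symmetric] powr_numeral)
          also have "\<dots> \<le> (2 powr N) powr (2 - s) * norm (F m x) powr s"
            using True s by (intro mult_right_mono powr_mono2) auto
          finally show ?thesis .
        qed (auto simp: low_def)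
        then show "(ennreal (norm (low N m x)))\<^sup>2 \<le> ennreal ((2 powr N) powr (2 - s)) * ennreal (norm (F m x) powr s)"
          by (simp add: ennreal_power ennreal_mult'[symmetric] ennreal_leI)
      qed
      also have "\<dots> < \<infinity>" using fin that by (simp add: nn_integral_cmult ennreal_mult_less_top)
      finally show ?thesis .
    qed
    have "(\<integral>\<^sup>+x. (ennreal (norm (TL N x)))\<^sup>2 \<partial>lborel)
      \<le> 3 * (\<Sum>m\<in>I. \<integral>\<^sup>+x. (ennreal (norm (freq_conv (c m) (low N m) x)))\<^sup>2 \<partial>lborel)"
      unfolding TL_def
    proof (rule nn_integral_almost_orthogonal_sum[OF I])
      fix m assume "m \<in> I"
      then show "(\<integral>\<^sup>+x. (ennreal (norm (freq_conv (c m) (low N m) x)))\<^sup>2 \<partial>lborel) < \<infinity>"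
        using nn_integral_freq_conv_square_le[of "low N m" "c m"] low2[of m]
        by (auto intro: le_less_trans simp: ennreal_mult_less_top)
    next
      fix m n assume "m \<in> I" "n \<in> I" "2 \<le> \<bar>m - n\<bar>"
      then show "(\<integral>x. freq_conv (c m) (low N m) x * cnj (freq_conv (c n) (low N n) x) \<partial>lborel) = 0"
        by (intro freq_conv_orthogonal[OF _ _ low_bd] low2 sep) auto
    qed measurable
    also have "\<dots> \<le> 3 * (\<Sum>m\<in>I. ennreal (vp_mass\<^sup>2) * (\<integral>\<^sup>+x. (ennreal (norm (low N m x)))\<^sup>2 \<partial>lborel))"
      by (intro mult_left_mono sum_mono nn_integral_freq_conv_square_le) auto
    finally show ?thesis by (simp add: sum_distrib_left mult.assoc)
  qed
  have L1: "(\<integral>\<^sup>+x. ennreal (norm (TH N x)) \<partial>lborel)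
      \<le> ennreal vp_mass * (\<Sum>m\<in>I. \<integral>\<^sup>+x. ennreal (norm (high N m x)) \<partial>lborel)" for N
  proof -
    have "(\<integral>\<^sup>+x. ennreal (norm (TH N x)) \<partial>lborel)
      \<le> (\<integral>\<^sup>+x. (\<Sum>m\<in>I. ennreal (norm (freq_conv (c m) (high N m) x))) \<partial>lborel)"
      unfolding TH_def by (intro nn_integral_mono) (auto simp: sum_ennreal intro!: ennreal_leI norm_sum)
    also have "\<dots> = (\<Sum>m\<in>I. \<integral>\<^sup>+x. ennreal (norm (freq_conv (c m) (high N m) x)) \<partial>lborel)"
      by (rule nn_integral_sum) measurable
    also have "\<dots> \<le> (\<Sum>m\<in>I. ennreal vp_mass * (\<integral>\<^sup>+x. ennreal (norm (high N m x)) \<partial>lborel))"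
      by (intro sum_mono nn_integral_freq_conv_le) measurable
    finally show ?thesis by (simp add: sum_distrib_left)
  qed
  define D where "D n x = (if 2 powr (- real n) < norm (H x) \<and> norm (H x) \<le> 2 powr n
      then ennreal (norm (H x) powr s) else 0)" for n :: nat and x
  have [measurable]: "D n \<in> borel_measurable borel" for n unfolding D_def[abs_def] by measurable
  have pw: "D n x \<le> (\<Sum>N\<in>{- int n..int n}. ennreal (16 * 2 powr (of_int N * (s - 2))) * (ennreal (norm (TL N x)))\<^sup>2
       + ennreal (2 * 2 powr (of_int N * (s - 1))) * ennreal (norm (TH N x)))" for n x
  proof (cases "2 powr (- real n) < norm (H x) \<and> norm (H x) \<le> 2 powr n")
    case True
    define y where "y = norm (H x)"
    have y: "0 < y" using True unfolding y_def by (meson le_less_trans powr_ge_zero)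
    \<comment> \<open>The height is chosen so that \<open>2 powr (N - 1) < y \<le> 2 powr N\<close>.\<close>
    define N where "N = \<lceil>log 2 y\<rceil>"
    have lN: "log 2 y \<le> of_int N" "of_int N - 1 < log 2 y" unfolding N_def by linarith+
    have "- real n < log 2 y" "log 2 y \<le> real n"
      using True y by (auto simp: y_def[symmetric] less_log_iff log_le_iff)
    then have N_in: "N \<in> {- int n..int n}" using lN by auto
    have yN: "y \<le> 2 powr N" "2 powr (N - 1) < y"
      using lN y by (simp_all add: log_le_iff less_log_iff)
    have tri: "y \<le> norm (TL N x) + norm (TH N x)"
      unfolding y_def split[of x N] by (rule norm_triangle_ineq)
    have "y powr s \<le> 16 * 2 powr (of_int N * (s - 2)) * (norm (TL N x))\<^sup>2 + 2 * 2 powr (of_int N * (s - 1)) * norm (TH N x)"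
    proof (cases "y \<le> 2 * norm (TL N x)")
      case True
      have "y powr s = y powr (s - 2) * y\<^sup>2"
        using y by (simp add: powr_add[symmetric] flip: powr_numeral)
      also have "\<dots> \<le> (2 powr (N - 1)) powr (s - 2) * (2 * norm (TL N x))\<^sup>2"
        using yN y s True by (intro mult_mono powr_mono2' power_mono) auto
      also have "(2 powr (N - 1)) powr (s - 2) = 2 powr (of_int N * (s - 2)) * 2 powr (2 - s)"
        by (simp add: powr_powr algebra_simps flip: powr_add)
      also have "2 powr (2 - s) \<le> 2 powr 2" using s by (intro powr_mono) auto
      finally have "y powr s \<le> 2 powr (of_int N * (s - 2)) * 4 * (2 * norm (TL N x))\<^sup>2"
        by (simp add: mult_left_mono mult_right_mono)
      then show ?thesis by (simp add: power_mult_distrib add_increasing2)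
    next
      case False
      have "y powr s = y powr (s - 1) * y"
        using y by (simp add: powr_mult_base mult.commute[of _ y])
      also have "\<dots> \<le> (2 powr N) powr (s - 1) * (2 * norm (TH N x))"
        using yN y s False tri by (intro mult_mono powr_mono2) auto
      finally show ?thesis by (simp add: powr_powr add_increasing)
    qed
    then have "ennreal (y powr s) \<le> ennreal (16 * 2 powr (of_int N * (s - 2))) * (ennreal (norm (TL N x)))\<^sup>2
        + ennreal (2 * 2 powr (of_int N * (s - 1))) * ennreal (norm (TH N x))"
      by (simp add: ennreal_power ennreal_mult'[symmetric] ennreal_plus[symmetric] ennreal_leI del: ennreal_plus)
    also have "\<dots> \<le> (\<Sum>N\<in>{- int n..int n}. ennreal (16 * 2 powr (of_int N * (s - 2))) * (ennreal (norm (TL N x)))\<^sup>2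
       + ennreal (2 * 2 powr (of_int N * (s - 1))) * ennreal (norm (TH N x)))"
      using N_in by (intro member_le_sum[where f="\<lambda>N. ennreal (16 * 2 powr (of_int N * (s - 2))) * (ennreal (norm (TL N x)))\<^sup>2
       + ennreal (2 * 2 powr (of_int N * (s - 1))) * ennreal (norm (TH N x))"]) auto
    finally show ?thesis using True by (simp add: D_def y_def)
  qed (auto simp: D_def)
  have intD: "(\<integral>\<^sup>+x. D n x \<partial>lborel)
     \<le> ennreal (decoupling_const s) * (\<Sum>m\<in>I. \<integral>\<^sup>+x. ennreal (norm (F m x) powr s) \<partial>lborel)" for n
  proof -
    let ?S = "{- int n..int n}"
    let ?a = "\<lambda>N. 16 * 2 powr (of_int N * (s - 2)) :: real" and ?b = "\<lambda>N. 2 * 2 powr (of_int N * (s - 1)) :: real"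
    have "(\<integral>\<^sup>+x. D n x \<partial>lborel) \<le> (\<integral>\<^sup>+x. (\<Sum>N\<in>?S. ennreal (?a N) * (ennreal (norm (TL N x)))\<^sup>2
       + ennreal (?b N) * ennreal (norm (TH N x))) \<partial>lborel)"
      by (intro nn_integral_mono pw)
    also have "\<dots> = (\<Sum>N\<in>?S. ennreal (?a N) * (\<integral>\<^sup>+x. (ennreal (norm (TL N x)))\<^sup>2 \<partial>lborel)
       + ennreal (?b N) * (\<integral>\<^sup>+x. ennreal (norm (TH N x)) \<partial>lborel))"
      by (simp add: nn_integral_sum nn_integral_add nn_integral_cmult)
    also have "\<dots> \<le> (\<Sum>N\<in>?S. ennreal (?a N) * (3 * ennreal (vp_mass\<^sup>2) * (\<Sum>m\<in>I. \<integral>\<^sup>+x. (ennreal (norm (low N m x)))\<^sup>2 \<partial>lborel))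
       + ennreal (?b N) * (ennreal vp_mass * (\<Sum>m\<in>I. \<integral>\<^sup>+x. ennreal (norm (high N m x)) \<partial>lborel)))"
      by (intro sum_mono add_mono mult_left_mono L1 L2) auto
    also have "\<dots> = (\<Sum>m\<in>I. \<integral>\<^sup>+x. (\<Sum>N\<in>?S. ennreal (?a N) * (3 * ennreal (vp_mass\<^sup>2)) * (ennreal (norm (low N m x)))\<^sup>2
       + ennreal (?b N) * ennreal vp_mass * ennreal (norm (high N m x))) \<partial>lborel)"
      by (simp add: nn_integral_sum nn_integral_add nn_integral_cmult sum.distrib sum_distrib_left mult.assoc
          sum.swap[of _ I ?S])
    also have "\<dots> \<le> (\<Sum>m\<in>I. \<integral>\<^sup>+x. ennreal (decoupling_const s) * ennreal (norm (F m x) powr s) \<partial>lborel)"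
    proof (intro sum_mono nn_integral_mono)
      fix m x
      have "(\<Sum>N\<in>?S. ennreal (?a N) * (3 * ennreal (vp_mass\<^sup>2)) * (ennreal (norm (low N m x)))\<^sup>2
          + ennreal (?b N) * ennreal vp_mass * ennreal (norm (high N m x)))
        = ennreal (\<Sum>N\<in>?S. 48 * vp_mass\<^sup>2 * 2 powr (of_int N * (s - 2)) * (if norm (F m x) \<le> 2 powr of_int N then norm (F m x) else 0)\<^sup>2
          + 2 * vp_mass * 2 powr (of_int N * (s - 1)) * (if norm (F m x) \<le> 2 powr of_int N then 0 else norm (F m x)))"
      proof -
        have combine: "ennreal a * (3 * ennreal v) * (ennreal y)\<^sup>2 + ennreal b * ennreal w * ennreal z
            = ennreal (a * (3 * v) * y\<^sup>2 + b * w * z)"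
          if "0 \<le> a" "0 \<le> v" "0 \<le> y" "0 \<le> b" "0 \<le> w" "0 \<le> z" for a v y b w z :: real
          using that by (simp add: ennreal_mult ennreal_power ennreal_plus)
        have norms: "norm (low N m x) = (if norm (F m x) \<le> 2 powr of_int N then norm (F m x) else 0)"
          "norm (high N m x) = (if norm (F m x) \<le> 2 powr of_int N then 0 else norm (F m x))" for N
          by (auto simp: low_def high_def)
        have term_eq: "ennreal (?a N) * (3 * ennreal (vp_mass\<^sup>2)) * (ennreal (norm (low N m x)))\<^sup>2
              + ennreal (?b N) * ennreal vp_mass * ennreal (norm (high N m x))
            = ennreal (48 * vp_mass\<^sup>2 * 2 powr (of_int N * (s - 2)) * (norm (low N m x))\<^sup>2
              + 2 * vp_mass * 2 powr (of_int N * (s - 1)) * norm (high N m x))" for N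
          using vp_mass_nonneg by (subst combine) (auto simp: mult_ac)
        show ?thesis
          unfolding term_eq norms[symmetric] using vp_mass_nonneg by (intro sum_ennreal) auto
      qed
      also have "\<dots> \<le> ennreal ((48 * vp_mass\<^sup>2 * geo_const (2 - s) + 2 * vp_mass * geo_const (s - 1)) * norm (F m x) powr s)"
        using s vp_mass_nonneg by (intro ennreal_leI sum_truncated_powers_le) auto
      also have "\<dots> \<le> ennreal (decoupling_const s * norm (F m x) powr s)"
        by (intro ennreal_leI mult_right_mono) (auto simp: decoupling_const_def)
      also have "\<dots> = ennreal (decoupling_const s) * ennreal (norm (F m x) powr s)"
        using decoupling_const_pos[OF s] by (simp add: ennreal_mult)
      finally show "(\<Sum>N\<in>?S. ennreal (?a N) * (3 * ennreal (vp_mass\<^sup>2)) * (ennreal (norm (low N m x)))\<^sup>2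
          + ennreal (?b N) * ennreal vp_mass * ennreal (norm (high N m x)))
        \<le> ennreal (decoupling_const s) * ennreal (norm (F m x) powr s)" .
    qed
    finally show ?thesis by (simp add: nn_integral_cmult sum_distrib_left)
  qed
  have lim: "(\<lambda>n. D n x) \<longlonglongrightarrow> ennreal (norm (H x) powr s)" for x
  proof (cases "H x = 0")
    case True
    then show ?thesis using s by (simp add: D_def)
  next
    case False
    obtain k :: nat where k: "\<bar>log 2 (norm (H x))\<bar> < k" using reals_Archimedean2 by blast
    have "eventually (\<lambda>n. D n x = ennreal (norm (H x) powr s)) sequentially"
      using eventually_ge_at_top[of k]
    proof eventually_elim
      case (elim n)
      then have "- real n < log 2 (norm (H x))" "log 2 (norm (H x)) \<le> real n" using k by linarith+
      then show ?case using False by (simp add: D_def less_log_iff log_le_iff)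
    qed
    then show ?thesis by (rule tendsto_eventually)
  qed
  show ?thesis
    unfolding H_def[symmetric]
    by (rule nn_integral_le_of_pointwise_limit[of D, OF _ _ intD]) (auto simp: lim)
qed

section \<open>The extension operator on integrable functions\<close>

definition phase :: "real \<times> (real \<times> real) \<Rightarrow> real \<times> real \<Rightarrow> complex" where
  "phase z \<xi> = cis (fst z * (fst \<xi> * snd \<xi>) + snd z \<bullet> \<xi>)"

lemma norm_phase [simp]: "norm (phase z \<xi>) = 1"
  by (simp add: phase_def)

lemma continuous_on_phase: "continuous_on UNIV (\<lambda>p. phase (fst p) (snd p))"
  unfolding phase_def by (intro continuous_intros)

lemma borel_measurable_phase [measurable]:
  "case_prod phase \<in> borel_measurable (borel \<Otimes>\<^sub>M borel)"
  using borel_measurable_continuous_onI[OF continuous_on_phase] by (simp add: borel_prod case_prod_beta')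

lemma borel_measurable_phase_snd [measurable]: "phase z \<in> borel_measurable borel"
  unfolding phase_def[abs_def] by (intro borel_measurable_continuous_onI continuous_intros)

lemma extension_op_eq:
  assumes "f \<in> borel_measurable borel"
  shows "extension_op f z = (\<integral>\<xi>. phase z \<xi> * f \<xi> \<partial>lborel)"
proof -
  note [measurable] = assms
  have "extension_op f z = (\<integral>\<xi>. phase z \<xi> * f \<xi> \<partial>lebesgue)"
    by (cases z) (simp add: extension_op_def phase_def cis_conv_exp)
  also have "\<dots> = (\<integral>\<xi>. phase z \<xi> * f \<xi> \<partial>lborel)"
    by (rule integral_completion) measurable
  finally show ?thesis .
qed

lemma extension_op_cong_AE:
  assumes "f \<in> borel_measurable lebesgue" "g \<in> borel_measurable lebesgue" "AE \<xi> in lebesgue. f \<xi> = g \<xi>"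
  shows "extension_op f = extension_op g"
proof
  fix z
  have ph: "phase z \<in> borel_measurable lebesgue"
    by (intro measurable_completion) simp
  have "(\<integral>\<xi>. phase z \<xi> * f \<xi> \<partial>lebesgue) = (\<integral>\<xi>. phase z \<xi> * g \<xi> \<partial>lebesgue)"
    by (rule integral_cong_AE) (use assms ph in \<open>auto intro!: borel_measurable_times\<close>)
  then show "extension_op f z = extension_op g z"
    by (cases z) (simp add: extension_op_def phase_def cis_conv_exp)
qed

lemma borel_measurable_extension_op:
  assumes [measurable]: "f \<in> borel_measurable borel"
  shows "extension_op f \<in> borel_measurable borel"
proof -
  have "(\<lambda>z. \<integral>\<xi>. phase z \<xi> * f \<xi> \<partial>lborel) \<in> borel_measurable borel"
    by measurable
  moreover have "extension_op f = (\<lambda>z. \<integral>\<xi>. phase z \<xi> * f \<xi> \<partial>lborel)"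
    by (rule ext) (rule extension_op_eq[OF assms])
  ultimately show ?thesis by simp
qed

lemma integrable_phase_mult:
  assumes "integrable lborel f"
  shows "integrable lborel (\<lambda>\<xi>. phase z \<xi> * f \<xi>)"
  using assms borel_measurable_integrable[OF assms]
  by (auto intro!: Bochner_Integration.integrable_bound[OF assms] simp: norm_mult)

lemma norm_extension_op_le:
  assumes "integrable lborel f"
  shows "norm (extension_op f z) \<le> (\<integral>\<xi>. norm (f \<xi>) \<partial>lborel)"
proof -
  have "norm (extension_op f z) \<le> (\<integral>\<xi>. norm (phase z \<xi> * f \<xi>) \<partial>lborel)"
    using assms by (subst extension_op_eq) auto
  then show ?thesis by (simp add: norm_mult)
qed

lemma extension_op_cmult:
  assumes "integrable lborel f"
  shows "extension_op (\<lambda>\<xi>. c * f \<xi>) z = c * extension_op f z"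
  using assms by (simp add: extension_op_eq mult.left_commute[of _ c] integrable_phase_mult)

lemma extension_op_sum:
  assumes "\<And>i. i \<in> I \<Longrightarrow> integrable lborel (f i)"
  shows "extension_op (\<lambda>\<xi>. \<Sum>i\<in>I. f i \<xi>) z = (\<Sum>i\<in>I. extension_op (f i) z)"
  using assms
  by (subst extension_op_eq) (auto simp: extension_op_eq sum_distrib_left integrable_phase_mult
      Bochner_Integration.integral_sum intro!: borel_measurable_sum)

lemma (in pair_sigma_finite) integral_product_functions:
  fixes f :: "'a \<Rightarrow> complex" and g :: "'b \<Rightarrow> complex"
  assumes f: "integrable M1 f" and g: "integrable M2 g"
  shows "integrable (M1 \<Otimes>\<^sub>M M2) (\<lambda>p. f (fst p) * g (snd p))"
    and "(\<integral>p. f (fst p) * g (snd p) \<partial>(M1 \<Otimes>\<^sub>M M2)) = integral\<^sup>L M1 f * integral\<^sup>L M2 g"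
proof -
  have [measurable]: "f \<in> borel_measurable M1" "g \<in> borel_measurable M2" using f g by auto
  have int: "integrable (M1 \<Otimes>\<^sub>M M2) (case_prod (\<lambda>x y. f x * g y))"
  proof (rule integrableI_bounded)
    have "(\<integral>\<^sup>+p. ennreal (norm (case_prod (\<lambda>x y. f x * g y) p)) \<partial>(M1 \<Otimes>\<^sub>M M2))
      = (\<integral>\<^sup>+x. \<integral>\<^sup>+y. ennreal (norm (f x)) * ennreal (norm (g y)) \<partial>M2 \<partial>M1)"
      by (subst M2.nn_integral_fst[symmetric]) (auto simp: norm_mult ennreal_mult)
    also have "\<dots> = (\<integral>\<^sup>+x. ennreal (norm (f x)) \<partial>M1) * (\<integral>\<^sup>+y. ennreal (norm (g y)) \<partial>M2)"
      by (simp add: nn_integral_cmult nn_integral_multc)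
    also have "\<dots> < \<infinity>"
      using f g by (simp add: integrable_iff_bounded ennreal_mult_less_top)
    finally show "(\<integral>\<^sup>+p. ennreal (norm (case_prod (\<lambda>x y. f x * g y) p)) \<partial>(M1 \<Otimes>\<^sub>M M2)) < \<infinity>" .
  qed measurable
  then show "integrable (M1 \<Otimes>\<^sub>M M2) (\<lambda>p. f (fst p) * g (snd p))" by (simp add: case_prod_beta')
  have "(\<integral>p. f (fst p) * g (snd p) \<partial>(M1 \<Otimes>\<^sub>M M2)) = (\<integral>x. \<integral>y. f x * g y \<partial>M2 \<partial>M1)"
    using integral_fst[OF int] by (simp add: case_prod_beta')
  then show "(\<integral>p. f (fst p) * g (snd p) \<partial>(M1 \<Otimes>\<^sub>M M2)) = integral\<^sup>L M1 f * integral\<^sup>L M2 g" by simp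
qed

lemma extension_op_mult:
  assumes f: "integrable lborel f" and g: "integrable lborel g"
  shows "extension_op f z * extension_op g z =
    (\<integral>p. (phase z (fst p) * f (fst p)) * (phase z (snd p) * g (snd p)) \<partial>(lborel \<Otimes>\<^sub>M lborel))"
  using assms
  by (subst lborel_pair.integral_product_functions(2)) (auto simp: extension_op_eq integrable_phase_mult)

text \<open>
  A superposition of waves whose frequencies all lie within \<open>1\<close> of \<open>c\<close> is reproduced, by Fubini's theorem
  and the value \<open>1\<close> of the transform on the plateau.
\<close>

lemma freq_conv_superposition:
  fixes h :: "'a \<Rightarrow> complex"
  assumes M: "sigma_finite_measure M" and h: "integrable M h" and [measurable]: "\<omega> \<in> borel_measurable M"
    and supp: "\<And>w. h w \<noteq> 0 \<Longrightarrow> \<bar>\<omega> w - c\<bar> \<le> 1"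
  shows "freq_conv c (\<lambda>x. \<integral>w. cis (x * \<omega> w) * h w \<partial>M) x = (\<integral>w. cis (x * \<omega> w) * h w \<partial>M)"
proof -
  interpret M: sigma_finite_measure M by fact
  interpret P: pair_sigma_finite lborel M ..
  have [measurable]: "h \<in> borel_measurable M" using h by simp
  define \<Phi> where "\<Phi> = (\<lambda>y w. modulated_vp c (x - y) * (cis (y * \<omega> w) * h w))"
  have int: "integrable (lborel \<Otimes>\<^sub>M M) (case_prod \<Phi>)"
  proof (rule Bochner_Integration.integrable_bound)
    have "integrable lborel (\<lambda>y. modulated_vp c (x - y))"
      using integrable_freq_conv[of "\<lambda>_. 1" 1 c x] by simp
    from P.integral_product_functions(1)[OF this h]
    show "integrable (lborel \<Otimes>\<^sub>M M) (\<lambda>p. modulated_vp c (x - fst p) * h (snd p))" .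
    show "case_prod \<Phi> \<in> borel_measurable (lborel \<Otimes>\<^sub>M M)" unfolding \<Phi>_def by measurable
  qed (auto simp: \<Phi>_def norm_mult)
  have wave: "(\<integral>y. \<Phi> y w \<partial>lborel) = cis (x * \<omega> w) * h w" for w
  proof -
    have "(\<integral>y. \<Phi> y w \<partial>lborel) = (\<integral>u. \<Phi> (x - u) w \<partial>lborel)"
      using lborel_integral_real_affine[of "-1" "\<lambda>y. \<Phi> y w" x] by simp
    also have "\<dots> = (\<integral>u. cis (x * \<omega> w) * h w * (of_real (vp_kernel u) * cis ((c - \<omega> w) * u)) \<partial>lborel)"
    proof (rule Bochner_Integration.integral_cong)
      fix u
      have "cis (c * u) * cis ((x - u) * \<omega> w) = cis (x * \<omega> w) * cis ((c - \<omega> w) * u)"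
        unfolding cis_mult by (simp add: algebra_simps)
      then show "\<Phi> (x - u) w = cis (x * \<omega> w) * h w * (of_real (vp_kernel u) * cis ((c - \<omega> w) * u))"
        by (simp add: \<Phi>_def modulated_vp_def mult_ac)
    qed simp
    also have "\<dots> = cis (x * \<omega> w) * h w * of_real (trapezoid (c - \<omega> w))"
      by (simp only: integral_mult_right_zero integral_vp_kernel_cis)
    also have "\<dots> = cis (x * \<omega> w) * h w"
      using supp[of w] trapezoid_eq_1[of "c - \<omega> w"] by (cases "h w = 0") (auto simp: abs_minus_commute)
    finally show ?thesis .
  qed
  have "freq_conv c (\<lambda>x. \<integral>w. cis (x * \<omega> w) * h w \<partial>M) x = (\<integral>y. \<integral>w. \<Phi> y w \<partial>M \<partial>lborel)"
    unfolding freq_conv_def \<Phi>_def by simp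
  also have "\<dots> = (\<integral>w. \<integral>y. \<Phi> y w \<partial>lborel \<partial>M)"
    using P.Fubini_integral[OF int] by simp
  also have "\<dots> = (\<integral>w. cis (x * \<omega> w) * h w \<partial>M)" by (simp only: wave)
  finally show ?thesis .
qed

lemma phase_split:
  "phase (t, x1, x2) \<xi> = cis (x1 * fst \<xi>) * phase (t, 0, x2) \<xi>"
  "phase (t, x1, x2) \<xi> = cis (x2 * snd \<xi>) * phase (t, x1, 0) \<xi>"
  by (cases \<xi>; simp add: phase_def cis_mult algebra_simps)+

text \<open>
  As a function of \<open>x1\<close> the product of two extensions has frequencies in the sum of the horizontal
  projections of the supports, here an interval of length \<open>2\<close> with centre \<open>a + b + 1\<close>; likewise for \<open>x2\<close>.
\<close>

lemma freq_conv_extension_op_mult: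
  assumes f: "integrable lborel f" and g: "integrable lborel g"
  shows "(\<And>\<xi>. f \<xi> \<noteq> 0 \<Longrightarrow> fst \<xi> \<in> {a..a + 1}) \<Longrightarrow> (\<And>\<xi>. g \<xi> \<noteq> 0 \<Longrightarrow> fst \<xi> \<in> {b..b + 1}) \<Longrightarrow>
      freq_conv (a + b + 1) (\<lambda>x1. extension_op f (t, x1, x2) * extension_op g (t, x1, x2)) x1
        = extension_op f (t, x1, x2) * extension_op g (t, x1, x2)"
    and "(\<And>\<xi>. f \<xi> \<noteq> 0 \<Longrightarrow> snd \<xi> \<in> {a..a + 1}) \<Longrightarrow> (\<And>\<xi>. g \<xi> \<noteq> 0 \<Longrightarrow> snd \<xi> \<in> {b..b + 1}) \<Longrightarrow>
      freq_conv (a + b + 1) (\<lambda>x2. extension_op f (t, x1, x2) * extension_op g (t, x1, x2)) x2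
        = extension_op f (t, x1, x2) * extension_op g (t, x1, x2)"
proof -
  have sf: "sigma_finite_measure (lborel \<Otimes>\<^sub>M lborel :: ((real \<times> real) \<times> (real \<times> real)) measure)"
    unfolding lborel_prod ..
  note int = lborel_pair.integral_product_functions(1)[OF integrable_phase_mult[OF f] integrable_phase_mult[OF g]]
  {
    assume fs: "\<And>\<xi>. f \<xi> \<noteq> 0 \<Longrightarrow> fst \<xi> \<in> {a..a + 1}" and gs: "\<And>\<xi>. g \<xi> \<noteq> 0 \<Longrightarrow> fst \<xi> \<in> {b..b + 1}"
    define h where "h = (\<lambda>p. (phase (t, 0, x2) (fst p) * f (fst p)) * (phase (t, 0, x2) (snd p) * g (snd p)))"
    have eq: "extension_op f (t, x1, x2) * extension_op g (t, x1, x2)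
       = (\<integral>p. cis (x1 * (fst (fst p) + fst (snd p))) * h p \<partial>(lborel \<Otimes>\<^sub>M lborel))" for x1
      unfolding extension_op_mult[OF f g] h_def phase_split(1)[of t x1 x2] distrib_left cis_mult[symmetric]
      by (simp add: mult_ac)
    have "freq_conv (a + b + 1) (\<lambda>x1. \<integral>p. cis (x1 * (fst (fst p) + fst (snd p))) * h p \<partial>(lborel \<Otimes>\<^sub>M lborel)) x1
      = (\<integral>p. cis (x1 * (fst (fst p) + fst (snd p))) * h p \<partial>(lborel \<Otimes>\<^sub>M lborel))"
    proof (rule freq_conv_superposition[OF sf])
      show "integrable (lborel \<Otimes>\<^sub>M lborel) h" unfolding h_def by (rule int)
      show "(\<lambda>p. fst (fst p) + fst (snd p)) \<in> borel_measurable (lborel \<Otimes>\<^sub>M lborel :: ((real \<times> real) \<times> (real \<times> real)) measure)"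
        unfolding lborel_prod measurable_lborel2 by (intro borel_measurable_continuous_onI continuous_intros)
      fix p assume "h p \<noteq> 0"
      then have "f (fst p) \<noteq> 0" "g (snd p) \<noteq> 0" by (auto simp: h_def)
      from fs[OF this(1)] gs[OF this(2)] show "\<bar>fst (fst p) + fst (snd p) - (a + b + 1)\<bar> \<le> 1" by auto
    qed
    then show "freq_conv (a + b + 1) (\<lambda>x1. extension_op f (t, x1, x2) * extension_op g (t, x1, x2)) x1
        = extension_op f (t, x1, x2) * extension_op g (t, x1, x2)" unfolding eq .
  }
  {
    assume fs: "\<And>\<xi>. f \<xi> \<noteq> 0 \<Longrightarrow> snd \<xi> \<in> {a..a + 1}" and gs: "\<And>\<xi>. g \<xi> \<noteq> 0 \<Longrightarrow> snd \<xi> \<in> {b..b + 1}"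
    define h where "h = (\<lambda>p. (phase (t, x1, 0) (fst p) * f (fst p)) * (phase (t, x1, 0) (snd p) * g (snd p)))"
    have eq: "extension_op f (t, x1, x2) * extension_op g (t, x1, x2)
       = (\<integral>p. cis (x2 * (snd (fst p) + snd (snd p))) * h p \<partial>(lborel \<Otimes>\<^sub>M lborel))" for x2
      unfolding extension_op_mult[OF f g] h_def phase_split(2)[of t x1 x2] distrib_left cis_mult[symmetric]
      by (simp add: mult_ac)
    have "freq_conv (a + b + 1) (\<lambda>x2. \<integral>p. cis (x2 * (snd (fst p) + snd (snd p))) * h p \<partial>(lborel \<Otimes>\<^sub>M lborel)) x2
      = (\<integral>p. cis (x2 * (snd (fst p) + snd (snd p))) * h p \<partial>(lborel \<Otimes>\<^sub>M lborel))"
    proof (rule freq_conv_superposition[OF sf])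
      show "integrable (lborel \<Otimes>\<^sub>M lborel) h" unfolding h_def by (rule int)
      show "(\<lambda>p. snd (fst p) + snd (snd p)) \<in> borel_measurable (lborel \<Otimes>\<^sub>M lborel :: ((real \<times> real) \<times> (real \<times> real)) measure)"
        unfolding lborel_prod measurable_lborel2 by (intro borel_measurable_continuous_onI continuous_intros)
      fix p assume "h p \<noteq> 0"
      then have "f (fst p) \<noteq> 0" "g (snd p) \<noteq> 0" by (auto simp: h_def)
      from fs[OF this(1)] gs[OF this(2)] show "\<bar>snd (fst p) + snd (snd p) - (a + b + 1)\<bar> \<le> 1" by auto
    qed
    then show "freq_conv (a + b + 1) (\<lambda>x2. extension_op f (t, x1, x2) * extension_op g (t, x1, x2)) x2
        = extension_op f (t, x1, x2) * extension_op g (t, x1, x2)" unfolding eq .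
  }
qed

text \<open>
  The hyperbolic paraboloid is invariant under \<open>(\<tau>, \<xi>\<^sub>1, \<xi>\<^sub>2) \<mapsto> (h\<^sub>1 h\<^sub>2 \<tau>, h\<^sub>1 \<xi>\<^sub>1, h\<^sub>2 \<xi>\<^sub>2)\<close> with independent
  factors \<open>h\<^sub>1\<close> and \<open>h\<^sub>2\<close>; this and the next lemma are the corresponding changes of variables.
\<close>

lemma lborel_scale2:
  fixes h1 h2 :: real
  assumes "0 < h1" "0 < h2"
  shows "(lborel :: (real \<times> real) measure)
    = density (distr lborel borel (\<lambda>\<xi>. (h1 * fst \<xi>, h2 * snd \<xi>))) (\<lambda>_. ennreal (h1 * h2))"
proof -
  define c where "c j = (if j = (1, 0) then h1 else h2)" for j :: "real \<times> real"
  have B: "Basis = {(1, 0), (0, 1) :: real \<times> real}" by (auto simp: Basis_prod_def)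
  have "c j \<noteq> 0" if "j \<in> Basis" for j using assms by (simp add: c_def)
  from lborel_affine_euclidean[of c 0, OF this] show ?thesis
    unfolding B using assms by (simp add: c_def case_prod_beta' inner_prod_def)
qed

lemma lborel_scale3:
  fixes h0 h1 h2 :: real
  assumes "0 < h0" "0 < h1" "0 < h2"
  shows "(lborel :: (real \<times> real \<times> real) measure)
    = density (distr lborel borel (\<lambda>z. (h0 * fst z, h1 * fst (snd z), h2 * snd (snd z)))) (\<lambda>_. ennreal (h0 * (h1 * h2)))"
proof -
  define c where "c j = (if j = (1, 0, 0) then h0 else if j = (0, 1, 0) then h1 else h2)" for j :: "real \<times> real \<times> real"
  have B: "Basis = {(1, 0, 0), (0, 1, 0), (0, 0, 1) :: real \<times> real \<times> real}"
    by (auto simp: Basis_prod_def zero_prod_def)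
  have "c j \<noteq> 0" if "j \<in> Basis" for j using assms by (simp add: c_def)
  from lborel_affine_euclidean[of c 0, OF this] show ?thesis
    unfolding B using assms by (simp add: c_def case_prod_beta' inner_prod_def ennreal_mult)
qed

section \<open>Parabolic scaling and decoupling in both frequency directions\<close>

abbreviation ext_ind :: "(real \<times> real) set \<Rightarrow> real \<times> real \<times> real \<Rightarrow> complex" where
  "ext_ind A \<equiv> extension_op (indicator A)"

definition fin_borel :: "(real \<times> real) set \<Rightarrow> bool" where
  "fin_borel A \<longleftrightarrow> A \<in> sets borel \<and> emeasure lborel A < \<infinity>"

lemma fin_borelD [measurable_dest]: "fin_borel A \<Longrightarrow> A \<in> sets borel"
  by (simp add: fin_borel_def)

lemma fin_borel_Int:
  assumes "fin_borel A" "T \<in> sets borel"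
  shows "fin_borel (A \<inter> T)"
proof -
  have "emeasure lborel (A \<inter> T) \<le> emeasure lborel A"
    using assms by (intro emeasure_mono) (auto simp: fin_borel_def)
  then show ?thesis using assms by (auto simp: fin_borel_def)
qed

lemma integrable_indicator_fin_borel: "fin_borel A \<Longrightarrow> integrable lborel (indicator A :: _ \<Rightarrow> complex)"
proof -
  assume A: "fin_borel A"
  have "integrable lborel (\<lambda>\<xi>. complex_of_real (indicator A \<xi>))"
    using A by (intro integrable_of_real integrable_real_indicator) (auto simp: fin_borel_def)
  moreover have "(\<lambda>\<xi>. complex_of_real (indicator A \<xi>)) = indicator A" by (auto simp: indicator_def)
  ultimately show ?thesis by simp
qed

lemma norm_ext_ind_le: "fin_borel A \<Longrightarrow> norm (ext_ind A z) \<le> measure lborel A"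
proof -
  assume A: "fin_borel A"
  have "norm (ext_ind A z) \<le> (\<integral>\<xi>. norm (indicator A \<xi> :: complex) \<partial>lborel)"
    by (rule norm_extension_op_le[OF integrable_indicator_fin_borel[OF A]])
  also have "(\<lambda>\<xi>. norm (indicator A \<xi> :: complex)) = indicator A" by (auto simp: indicator_def)
  finally show ?thesis using A by (simp add: fin_borel_def)
qed

lemma borel_measurable_ext_ind [measurable]: "fin_borel A \<Longrightarrow> ext_ind A \<in> borel_measurable borel"
  by (intro borel_measurable_extension_op borel_measurable_indicator) (simp add: fin_borel_def)

lemma fin_borel_dilate:
  assumes h: "0 < h1" "0 < h2" and A: "fin_borel A"
  shows "fin_borel {\<xi>. (h1 * fst \<xi>, h2 * snd \<xi>) \<in> A}"
    and "measure lborel {\<xi>. (h1 * fst \<xi>, h2 * snd \<xi>) \<in> A} = measure lborel A / (h1 * h2)"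
proof -
  let ?T = "\<lambda>\<xi> :: real \<times> real. (h1 * fst \<xi>, h2 * snd \<xi>)"
  have T[measurable]: "?T \<in> borel \<rightarrow>\<^sub>M borel"
    by (intro borel_measurable_continuous_onI continuous_intros)
  have A': "A \<in> sets borel" "emeasure lborel A < \<infinity>" using A by (auto simp: fin_borel_def)
  have pre: "{\<xi>. ?T \<xi> \<in> A} \<in> sets borel" using measurable_sets[OF T A'(1)] by (simp add: vimage_def)
  have "emeasure lborel A = emeasure (density (distr lborel borel ?T) (\<lambda>_. ennreal (h1 * h2))) A"
    using lborel_scale2[OF h] by simp
  also have "\<dots> = ennreal (h1 * h2) * emeasure lborel {\<xi>. ?T \<xi> \<in> A}"
    using A' by (subst emeasure_density_const) (simp_all add: emeasure_distr vimage_def)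
  finally have e: "emeasure lborel A = ennreal (h1 * h2) * emeasure lborel {\<xi>. ?T \<xi> \<in> A}" .
  then have "emeasure lborel {\<xi>. ?T \<xi> \<in> A} < \<infinity>"
    using A' h by (auto simp: ennreal_mult_less_top)
  with pre show "fin_borel {\<xi>. ?T \<xi> \<in> A}" by (simp add: fin_borel_def)
  show "measure lborel {\<xi>. ?T \<xi> \<in> A} = measure lborel A / (h1 * h2)"
    using h by (simp add: measure_def e enn2real_mult)
qed

text \<open>
  The phase is unchanged when \<open>t\<close> absorbs \<open>h1 * h2\<close> and each \<open>x\<^sub>i\<close> absorbs its own factor.
\<close>

lemma ext_ind_dilate:
  assumes h: "0 < h1" "0 < h2" and A: "fin_borel A"
  shows "ext_ind A (t, x1, x2) = of_real (h1 * h2) *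
     ext_ind {\<xi>. (h1 * fst \<xi>, h2 * snd \<xi>) \<in> A} (h1 * h2 * t, h1 * x1, h2 * x2)"
proof -
  let ?T = "\<lambda>\<xi> :: real \<times> real. (h1 * fst \<xi>, h2 * snd \<xi>)"
  have T[measurable]: "?T \<in> borel \<rightarrow>\<^sub>M borel"
    by (intro borel_measurable_continuous_onI continuous_intros)
  note [measurable] = fin_borelD[OF A] fin_borelD[OF fin_borel_dilate(1)[OF h A]]
  have "ext_ind A (t, x1, x2) = (\<integral>\<xi>. phase (t, x1, x2) \<xi> * indicator A \<xi>
     \<partial>(density (distr lborel borel ?T) (\<lambda>_. ennreal (h1 * h2))))"
    using lborel_scale2[OF h] by (subst extension_op_eq) auto
  also have "\<dots> = (\<integral>\<xi>. (h1 * h2) *\<^sub>R (phase (t, x1, x2) (?T \<xi>) * indicator A (?T \<xi>)) \<partial>lborel)"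
    using h by (subst integral_density) (auto simp: integral_distr)
  also have "\<dots> = (\<integral>\<xi>. of_real (h1 * h2) * (phase (h1 * h2 * t, h1 * x1, h2 * x2) \<xi> * indicator {\<xi>. ?T \<xi> \<in> A} \<xi>) \<partial>lborel)"
    by (intro Bochner_Integration.integral_cong)
      (auto simp: phase_def scaleR_conv_of_real indicator_def inner_prod_def algebra_simps)
  also have "\<dots> = of_real (h1 * h2) * ext_ind {\<xi>. ?T \<xi> \<in> A} (h1 * h2 * t, h1 * x1, h2 * x2)"
    by (subst extension_op_eq) auto
  finally show ?thesis .
qed

lemma Lq_le_dilate:
  assumes h: "0 < h0" "0 < h1" "0 < h2" and G: "Lq_le lborel q G K" and q: "0 < q"
  shows "Lq_le lborel q (\<lambda>z. G (h0 * fst z, h1 * fst (snd z), h2 * snd (snd z))) ((h0 * (h1 * h2)) powr (- 1 / q) * K)"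
proof -
  let ?T = "\<lambda>z :: real \<times> real \<times> real. (h0 * fst z, h1 * fst (snd z), h2 * snd (snd z))"
  define H where "H = h0 * (h1 * h2)"
  have H: "0 < H" using h by (simp add: H_def)
  have T[measurable]: "?T \<in> borel \<rightarrow>\<^sub>M borel"
    by (intro borel_measurable_continuous_onI continuous_intros)
  have [measurable]: "G \<in> borel_measurable borel" using Lq_leD(1)[OF G] by simp
  have "(\<integral>\<^sup>+z. ennreal (norm (G z) powr q) \<partial>lborel)
     = (\<integral>\<^sup>+z. ennreal (norm (G z) powr q) \<partial>(density (distr lborel borel ?T) (\<lambda>_. ennreal H)))"
    using lborel_scale3[OF h] by (simp add: H_def)
  also have "\<dots> = ennreal H * (\<integral>\<^sup>+z. ennreal (norm (G (?T z)) powr q) \<partial>lborel)"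
    by (simp add: nn_integral_density nn_integral_distr nn_integral_cmult)
  finally have "ennreal H * (\<integral>\<^sup>+z. ennreal (norm (G (?T z)) powr q) \<partial>lborel) \<le> ennreal (K powr q)"
    using Lq_leD(3)[OF G] by simp
  then have "ennreal (1 / H) * (ennreal H * (\<integral>\<^sup>+z. ennreal (norm (G (?T z)) powr q) \<partial>lborel)) \<le> ennreal (1 / H) * ennreal (K powr q)"
    by (rule mult_left_mono) simp
  moreover have "ennreal (1 / H) * (ennreal H * X) = X" for X
    using H by (simp add: mult.assoc[symmetric] ennreal_mult'[symmetric])
  moreover have "ennreal (1 / H) * ennreal (K powr q) = ennreal ((H powr (- 1 / q) * K) powr q)"
  proof -
    have "(H powr (- 1 / q) * K) powr q = (H powr (- 1 / q)) powr q * K powr q"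
      using Lq_leD(2)[OF G] by (intro powr_mult)
    also have "(H powr (- 1 / q)) powr q = 1 / H"
      unfolding powr_powr using H q by (simp add: powr_minus_divide)
    finally show ?thesis using H by (simp add: ennreal_mult'[symmetric])
  qed
  ultimately show ?thesis
    using Lq_leD(2)[OF G] unfolding Lq_le_def H_def[symmetric] by simp
qed

text \<open>
  The prefactor collects \<open>(h1 * h2)\<^sup>2\<close> from the two extensions and \<open>(h1 * h2) powr (- 2 / q)\<close> from the
  dilation of space-time, whose Jacobian is \<open>(h1 * h2)\<^sup>2\<close>.
\<close>

lemma Lq_le_sum_ext_ind_dilate:
  assumes h: "0 < h1" "0 < h2" and q: "0 < q"
    and A: "\<And>i. i \<in> I \<Longrightarrow> fin_borel (A i)" "\<And>i. i \<in> I \<Longrightarrow> fin_borel (A' i)"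
    and le: "Lq_le lborel q (\<lambda>z. \<Sum>i\<in>I. ext_ind {\<xi>. (h1 * fst \<xi>, h2 * snd \<xi>) \<in> A i} z
        * ext_ind {\<xi>. (h1 * fst \<xi>, h2 * snd \<xi>) \<in> A' i} z) K"
  shows "Lq_le lborel q (\<lambda>z. \<Sum>i\<in>I. ext_ind (A i) z * ext_ind (A' i) z) ((h1 * h2) powr (2 - 2 / q) * K)"
proof -
  define H where "H = h1 * h2"
  have H: "0 < H" using h by (simp add: H_def)
  have eq: "(\<Sum>i\<in>I. ext_ind (A i) z * ext_ind (A' i) z) =
     of_real (H\<^sup>2) * (\<Sum>i\<in>I. ext_ind {\<xi>. (h1 * fst \<xi>, h2 * snd \<xi>) \<in> A i} (H * fst z, h1 * fst (snd z), h2 * snd (snd z))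
        * ext_ind {\<xi>. (h1 * fst \<xi>, h2 * snd \<xi>) \<in> A' i} (H * fst z, h1 * fst (snd z), h2 * snd (snd z)))" for z
  proof -
    obtain t x1 x2 where z: "z = (t, x1, x2)" by (cases z)
    show ?thesis unfolding z sum_distrib_left
      by (rule sum.cong[OF refl])
        (simp add: A ext_ind_dilate[OF h, where t=t and ?x1.0=x1 and ?x2.0=x2] H_def power2_eq_square mult_ac)
  qed
  have "Lq_le lborel q (\<lambda>z. \<Sum>i\<in>I. ext_ind (A i) z * ext_ind (A' i) z)
     (norm (complex_of_real (H\<^sup>2)) * ((H * (h1 * h2)) powr (- 1 / q) * K))"
    unfolding eq using Lq_le_cmult[OF Lq_le_dilate[OF H h le q], of "of_real (H\<^sup>2)"] by simp
  also have "norm (complex_of_real (H\<^sup>2)) * ((H * (h1 * h2)) powr (- 1 / q) * K) = H powr (2 - 2 / q) * K"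
  proof -
    have "norm (complex_of_real (H\<^sup>2)) = H powr 2" using H by (simp add: powr_numeral norm_power)
    moreover have "(H * (h1 * h2)) powr (- 1 / q) = H powr (- 2 / q)"
    proof -
      have "H * (h1 * h2) = H powr 2" using H by (simp add: H_def power2_eq_square powr_numeral)
      then show ?thesis by (simp add: powr_powr)
    qed
    moreover have "H powr (2 - 2 / q) = H powr 2 * H powr (- 2 / q)"
      unfolding powr_add[symmetric] by simp
    ultimately show ?thesis by (simp only: mult.assoc)
  qed
  finally show ?thesis by (simp add: H_def)
qed

lemma freq_conv_sum:
  assumes "finite J" "\<And>j. j \<in> J \<Longrightarrow> G j \<in> borel_measurable borel" "\<And>j x. j \<in> J \<Longrightarrow> norm (G j x) \<le> B"
  shows "freq_conv c (\<lambda>x. \<Sum>j\<in>J. G j x) x = (\<Sum>j\<in>J. freq_conv c (G j) x)"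
  unfolding freq_conv_def using integrable_freq_conv[OF assms(2,3)]
  by (simp add: sum_distrib_left Bochner_Integration.integral_sum)

lemma nn_integral_lborel3:
  fixes f :: "real \<times> real \<times> real \<Rightarrow> ennreal"
  assumes [measurable]: "f \<in> borel_measurable borel"
  shows "(\<integral>\<^sup>+z. f z \<partial>lborel) = (\<integral>\<^sup>+t. \<integral>\<^sup>+x1. \<integral>\<^sup>+x2. f (t, x1, x2) \<partial>lborel \<partial>lborel \<partial>lborel)"
    and "(\<integral>\<^sup>+z. f z \<partial>lborel) = (\<integral>\<^sup>+t. \<integral>\<^sup>+x2. \<integral>\<^sup>+x1. f (t, x1, x2) \<partial>lborel \<partial>lborel \<partial>lborel)"
proof -
  have m[measurable]: "f \<in> borel_measurable (lborel \<Otimes>\<^sub>M (lborel \<Otimes>\<^sub>M lborel))"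
    by (simp add: lborel_prod)
  have "(\<integral>\<^sup>+z. f z \<partial>lborel) = (\<integral>\<^sup>+z. f z \<partial>(lborel \<Otimes>\<^sub>M (lborel \<Otimes>\<^sub>M lborel)))" by (simp add: lborel_prod)
  also have "\<dots> = (\<integral>\<^sup>+t. \<integral>\<^sup>+y. f (t, y) \<partial>(lborel \<Otimes>\<^sub>M lborel) \<partial>lborel)"
    by (subst lborel_pair.nn_integral_fst[symmetric])
      (use m in \<open>simp_all add: lborel_prod\<close>)
  also have "\<dots> = (\<integral>\<^sup>+t. \<integral>\<^sup>+x1. \<integral>\<^sup>+x2. f (t, x1, x2) \<partial>lborel \<partial>lborel \<partial>lborel)"
    by (intro nn_integral_cong, subst lborel.nn_integral_fst[symmetric]) auto
  finally show 1: "(\<integral>\<^sup>+z. f z \<partial>lborel) = (\<integral>\<^sup>+t. \<integral>\<^sup>+x1. \<integral>\<^sup>+x2. f (t, x1, x2) \<partial>lborel \<partial>lborel \<partial>lborel)" .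
  show "(\<integral>\<^sup>+z. f z \<partial>lborel) = (\<integral>\<^sup>+t. \<integral>\<^sup>+x2. \<integral>\<^sup>+x1. f (t, x1, x2) \<partial>lborel \<partial>lborel \<partial>lborel)"
    unfolding 1 by (rule nn_integral_cong, rule lborel_pair.Fubini') measurable
qed

text \<open>
  Decoupling is applied in \<open>x1\<close> for fixed \<open>(t, x2)\<close> to the sums over \<open>n\<close>, and then in \<open>x2\<close> for fixed
  \<open>(t, x1)\<close> to the single terms.
\<close>

lemma frequency_decoupling2:
  fixes F :: "int \<Rightarrow> int \<Rightarrow> real \<times> real \<times> real \<Rightarrow> complex" and I J :: "int set"
  assumes s: "1 < s" "s < 2" and I: "finite I" and J: "finite J"
    and sep: "\<And>m n. 2 \<le> \<bar>m - n\<bar> \<Longrightarrow> 4 \<le> \<bar>c m - c n\<bar>" "\<And>m n. 2 \<le> \<bar>m - n\<bar> \<Longrightarrow> 4 \<le> \<bar>d m - d n\<bar>"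
    and meas[measurable]: "\<And>m n. F m n \<in> borel_measurable borel" and bd: "\<And>m n z. norm (F m n z) \<le> B"
    and repr1: "\<And>m n t x1 x2. freq_conv (c m) (\<lambda>x1. F m n (t, x1, x2)) x1 = F m n (t, x1, x2)"
    and repr2: "\<And>m n t x1 x2. freq_conv (d n) (\<lambda>x2. F m n (t, x1, x2)) x2 = F m n (t, x1, x2)"
  shows "(\<integral>\<^sup>+z. ennreal (norm (\<Sum>m\<in>I. \<Sum>n\<in>J. F m n z) powr s) \<partial>lborel)
    \<le> ennreal ((decoupling_const s)\<^sup>2) * (\<Sum>m\<in>I. \<Sum>n\<in>J. \<integral>\<^sup>+z. ennreal (norm (F m n z) powr s) \<partial>lborel)"
proof -
  let ?C = "ennreal (decoupling_const s)"
  have C0: "0 < decoupling_const s" by (rule decoupling_const_pos[OF s])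
  have B0: "0 \<le> B" using bd norm_ge_zero order_trans by blast
  have m1[measurable]: "(\<lambda>x1. F m n (t, x1, x2)) \<in> borel_measurable borel"
    and m2[measurable]: "(\<lambda>x2. F m n (t, x1, x2)) \<in> borel_measurable borel" for m n t x1 x2
    by (rule measurable_compose[OF _ meas], intro borel_measurable_continuous_onI continuous_intros)+
  have "(\<integral>\<^sup>+z. ennreal (norm (\<Sum>m\<in>I. \<Sum>n\<in>J. F m n z) powr s) \<partial>lborel)
     = (\<integral>\<^sup>+t. \<integral>\<^sup>+x2. \<integral>\<^sup>+x1. ennreal (norm (\<Sum>m\<in>I. \<Sum>n\<in>J. F m n (t, x1, x2)) powr s) \<partial>lborel \<partial>lborel \<partial>lborel)"
    by (rule nn_integral_lborel3(2)) measurable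
  also have "\<dots> \<le> (\<integral>\<^sup>+t. \<integral>\<^sup>+x2. ?C * (\<Sum>m\<in>I. \<integral>\<^sup>+x1. ennreal (norm (\<Sum>n\<in>J. F m n (t, x1, x2)) powr s) \<partial>lborel) \<partial>lborel \<partial>lborel)"
  proof (intro nn_integral_mono frequency_decoupling[OF s I, where c=c and B="card J * B"])
    fix t x2 m x
    show "norm (\<Sum>n\<in>J. F m n (t, x, x2)) \<le> card J * B"
      using bd by (intro order_trans[OF norm_sum] sum_bounded_above)
    show "freq_conv (c m) (\<lambda>x1. \<Sum>n\<in>J. F m n (t, x1, x2)) x = (\<Sum>n\<in>J. F m n (t, x, x2))"
      using repr1 by (subst freq_conv_sum[OF J, where B=B]) (auto intro: bd)
  qed (auto intro: sep)
  also have "\<dots> = ?C * (\<Sum>m\<in>I. \<integral>\<^sup>+t. \<integral>\<^sup>+x2. \<integral>\<^sup>+x1. ennreal (norm (\<Sum>n\<in>J. F m n (t, x1, x2)) powr s) \<partial>lborel \<partial>lborel \<partial>lborel)"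
    by (simp add: nn_integral_cmult nn_integral_sum)
  also have "\<dots> = ?C * (\<Sum>m\<in>I. \<integral>\<^sup>+z. ennreal (norm (\<Sum>n\<in>J. F m n z) powr s) \<partial>lborel)"
    by (simp add: nn_integral_lborel3(2))
  also have "\<dots> \<le> ?C * (\<Sum>m\<in>I. ?C * (\<Sum>n\<in>J. \<integral>\<^sup>+z. ennreal (norm (F m n z) powr s) \<partial>lborel))"
  proof (intro mult_left_mono sum_mono)
    fix m
    have "(\<integral>\<^sup>+z. ennreal (norm (\<Sum>n\<in>J. F m n z) powr s) \<partial>lborel)
      = (\<integral>\<^sup>+t. \<integral>\<^sup>+x1. \<integral>\<^sup>+x2. ennreal (norm (\<Sum>n\<in>J. F m n (t, x1, x2)) powr s) \<partial>lborel \<partial>lborel \<partial>lborel)"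
      by (rule nn_integral_lborel3(1)) measurable
    also have "\<dots> \<le> (\<integral>\<^sup>+t. \<integral>\<^sup>+x1. ?C * (\<Sum>n\<in>J. \<integral>\<^sup>+x2. ennreal (norm (F m n (t, x1, x2)) powr s) \<partial>lborel) \<partial>lborel \<partial>lborel)"
      by (intro nn_integral_mono frequency_decoupling[OF s J, where c=d and B=B])
        (auto intro: sep bd repr2)
    also have "\<dots> = ?C * (\<Sum>n\<in>J. \<integral>\<^sup>+z. ennreal (norm (F m n z) powr s) \<partial>lborel)"
      by (simp add: nn_integral_cmult nn_integral_sum nn_integral_lborel3(1))
    finally show "(\<integral>\<^sup>+z. ennreal (norm (\<Sum>n\<in>J. F m n z) powr s) \<partial>lborel)
      \<le> ?C * (\<Sum>n\<in>J. \<integral>\<^sup>+z. ennreal (norm (F m n z) powr s) \<partial>lborel)" .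
  qed auto
  finally show ?thesis
    using C0 by (simp add: sum_distrib_left power2_eq_square ennreal_mult mult.assoc)
qed

section \<open>The bilinear estimate summed over tiles of one shape\<close>

lemma borel_measurable_fst_pair [measurable]:
    "fst \<in> borel_measurable (borel :: ('a::second_countable_topology \<times> 'b::second_countable_topology) measure)"
  and borel_measurable_snd_pair [measurable]:
    "snd \<in> borel_measurable (borel :: ('a \<times> 'b) measure)"
  by (intro borel_measurable_continuous_onI continuous_intros)+

definition tile :: "real \<Rightarrow> real \<Rightarrow> int \<Rightarrow> int \<Rightarrow> (real \<times> real) set" where
  "tile h1 h2 m n = {\<xi>. \<lfloor>fst \<xi> / h1\<rfloor> = m \<and> \<lfloor>snd \<xi> / h2\<rfloor> = n}"

lemma tile_in_sets_borel [measurable]: "tile h1 h2 m n \<in> sets borel"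
  unfolding tile_def by measurable

lemma fin_borel_Int_tile: "fin_borel \<Omega> \<Longrightarrow> fin_borel (\<Omega> \<inter> tile h1 h2 m n)"
  by (rule fin_borel_Int) (auto intro: tile_in_sets_borel)

lemma unit_tile_subset: "tile 1 1 m n \<subseteq> {real_of_int m..real_of_int m + 1} \<times> {real_of_int n..real_of_int n + 1}"
  by (auto simp: tile_def; linarith)

text \<open>
  The possible differences of the indices of two dyadic intervals of equal length that are not adjacent
  while their parents coincide or are adjacent.
\<close>

definition whitney_offsets :: "int set" where "whitney_offsets = {2, -2, 3, -3}"

text \<open>
  The hypothesis concerns intervals at distance exactly their length. Index distance \<open>2\<close> is this case; two
  unit intervals at index distance \<open>3\<close> lie at the outer ends of two intervals of length \<open>4/3\<close> with gap \<open>4/3\<close>.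
\<close>

lemma whitney_offset_enlarge:
  assumes "\<delta> \<in> whitney_offsets"
  obtains h a b :: real where "1 \<le> h" "\<bar>b - a\<bar> = 2 * h"
    "{real_of_int m..real_of_int m + 1} \<subseteq> {a..a + h}"
    "{real_of_int (m + \<delta>)..real_of_int (m + \<delta>) + 1} \<subseteq> {b..b + h}"
proof -
  consider "\<delta> = 2" | "\<delta> = -2" | "\<delta> = 3" | "\<delta> = -3"
    using assms by (auto simp: whitney_offsets_def)
  then show thesis
  proof cases
    case 1
    then show thesis by (intro that[of 1 "m + 2" m]) auto
  next
    case 2
    then show thesis by (intro that[of 1 "m - 2" m]) auto
  next
    case 3
    then show thesis by (intro that[of "4/3" "m + 8/3" m]) auto
  next
    case 4
    then show thesis by (intro that[of "4/3" "m - 3" "m - 1/3"]) auto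
  qed
qed

text \<open>
  The hypothesis of the theorem for characteristic functions and real exponents; \<open>s / (s - 1)\<close> is the exponent
  dual to \<open>s\<close>.
\<close>

locale bilinear_extension_estimate =
  fixes s r B :: real
  assumes s_gt: "3 / 2 < s" and s_lt: "s < 2" and r_ge: "1 \<le> r" and r_lt: "r < s / (s - 1)" and B_nonneg: "0 \<le> B"
    and unit_bilinear: "\<And>a1 a2 b1 b2 A A'. \<bar>b1 - a1\<bar> = 2 \<Longrightarrow> \<bar>b2 - a2\<bar> = 2 \<Longrightarrow>
      fin_borel A \<Longrightarrow> fin_borel A' \<Longrightarrow>
      A \<subseteq> {a1..a1 + 1} \<times> {a2..a2 + 1} \<Longrightarrow> A' \<subseteq> {b1..b1 + 1} \<times> {b2..b2 + 1} \<Longrightarrow>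
      Lq_le lborel s (\<lambda>z. ext_ind A z * ext_ind A' z) (B * (measure lborel A * measure lborel A') powr (1 / r))"
begin

text \<open>
  Twice the gap between \<open>1 / r\<close> and \<open>1 / s'\<close>. It is the gain when a set fills only a small part of its tile.
\<close>

definition \<alpha> :: real where "\<alpha> = 2 / r + 2 / s - 2"

lemma \<alpha>_pos: "0 < \<alpha>"
proof -
  have "1 / (s / (s - 1)) < 1 / r" using r_lt r_ge s_gt by (intro divide_strict_left_mono) auto
  then show ?thesis using s_gt by (simp add: \<alpha>_def diff_divide_distrib)
qed

text \<open>
  The scaling symmetry turns the unit rectangles into arbitrary ones. In terms of \<open>A\<close> as a fraction of the
  rectangle, the bound is the scale-invariant one times a power with exponent \<open>\<alpha>\<close> of the relative sizes.
\<close>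

lemma bilinear_box:
  assumes h: "0 < h1" "0 < h2" and ab: "\<bar>b1 - a1\<bar> = 2 * h1" "\<bar>b2 - a2\<bar> = 2 * h2"
    and A: "fin_borel A" "fin_borel A'"
    and sub: "A \<subseteq> {a1..a1 + h1} \<times> {a2..a2 + h2}" "A' \<subseteq> {b1..b1 + h1} \<times> {b2..b2 + h2}"
  shows "Lq_le lborel s (\<lambda>z. ext_ind A z * ext_ind A' z)
    (B * (h1 * h2) powr (- \<alpha>) * (measure lborel A * measure lborel A') powr (1 / r))"
proof -
  let ?D = "\<lambda>A. {\<xi> :: real \<times> real. (h1 * fst \<xi>, h2 * snd \<xi>) \<in> A}"
  have box: "?D A \<subseteq> {a1 / h1..a1 / h1 + 1} \<times> {a2 / h2..a2 / h2 + 1}"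
    if "A \<subseteq> {a1..a1 + h1} \<times> {a2..a2 + h2}" for A a1 a2
    using that h by (force simp: field_simps)
  have dist: "\<bar>b1 / h1 - a1 / h1\<bar> = 2" "\<bar>b2 / h2 - a2 / h2\<bar> = 2"
    using ab h by (simp_all flip: diff_divide_distrib)
  have "Lq_le lborel s (\<lambda>z. ext_ind (?D A) z * ext_ind (?D A') z)
    (B * (measure lborel (?D A) * measure lborel (?D A')) powr (1 / r))"
    by (rule unit_bilinear[OF dist]) (use fin_borel_dilate(1)[OF h] A box sub in auto)
  then have "Lq_le lborel s (\<lambda>z. \<Sum>i\<in>{()}. ext_ind (?D A) z * ext_ind (?D A') z)
    (B * (measure lborel (?D A) * measure lborel (?D A')) powr (1 / r))" by simp
  from Lq_le_sum_ext_ind_dilate[OF h _ _ _ this] A s_gt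
  have "Lq_le lborel s (\<lambda>z. ext_ind A z * ext_ind A' z)
     ((h1 * h2) powr (2 - 2 / s) * (B * (measure lborel (?D A) * measure lborel (?D A')) powr (1 / r)))"
    by simp
  also have "measure lborel (?D A) * measure lborel (?D A') = (measure lborel A * measure lborel A') * (h1 * h2) powr (- 2)"
    using A h by (simp add: fin_borel_dilate(2)[OF h] powr_minus_divide powr_numeral power2_eq_square)
  also have "(h1 * h2) powr (2 - 2 / s) * (B * ((measure lborel A * measure lborel A') * (h1 * h2) powr (- 2)) powr (1 / r))
    = B * ((h1 * h2) powr (2 - 2 / s) * (h1 * h2) powr (- 2 * (1 / r))) * (measure lborel A * measure lborel A') powr (1 / r)"
    by (subst powr_mult) (auto simp: powr_powr)
  also have "(h1 * h2) powr (2 - 2 / s) * (h1 * h2) powr (- 2 * (1 / r)) = (h1 * h2) powr (- \<alpha>)"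
    unfolding powr_add[symmetric] \<alpha>_def by (rule arg_cong[where f="\<lambda>x. (h1 * h2) powr x"]) simp
  finally show ?thesis .
qed

text \<open>
  Enlarging the tiles costs nothing because the exponent of the enlargement factor is negative.
\<close>

lemma bilinear_tile:
  assumes \<delta>: "\<delta>1 \<in> whitney_offsets" "\<delta>2 \<in> whitney_offsets" and A: "fin_borel A" "fin_borel A'"
    and sub: "A \<subseteq> tile 1 1 m n" "A' \<subseteq> tile 1 1 (m + \<delta>1) (n + \<delta>2)"
  shows "Lq_le lborel s (\<lambda>z. ext_ind A z * ext_ind A' z) (B * (measure lborel A * measure lborel A') powr (1 / r))"
proof -
  obtain h1 a1 b1 where 1: "1 \<le> h1" "\<bar>b1 - a1\<bar> = 2 * h1"
    "{real_of_int m..real_of_int m + 1} \<subseteq> {a1..a1 + h1}"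
    "{real_of_int (m + \<delta>1)..real_of_int (m + \<delta>1) + 1} \<subseteq> {b1..b1 + h1}"
    using whitney_offset_enlarge[OF \<delta>(1)] by metis
  obtain h2 a2 b2 where 2: "1 \<le> h2" "\<bar>b2 - a2\<bar> = 2 * h2"
    "{real_of_int n..real_of_int n + 1} \<subseteq> {a2..a2 + h2}"
    "{real_of_int (n + \<delta>2)..real_of_int (n + \<delta>2) + 1} \<subseteq> {b2..b2 + h2}"
    using whitney_offset_enlarge[OF \<delta>(2)] by metis
  have le: "Lq_le lborel s (\<lambda>z. ext_ind A z * ext_ind A' z)
    (B * (h1 * h2) powr (- \<alpha>) * (measure lborel A * measure lborel A') powr (1 / r))"
    by (rule bilinear_box[OF _ _ 1(2) 2(2) A])
      (use 1 2 sub unit_tile_subset[of m n] unit_tile_subset[of "m + \<delta>1" "n + \<delta>2"] in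
        \<open>auto intro: order_trans[OF order_trans Sigma_mono]\<close>)
  have "1 \<le> h1 * h2" using mult_mono[of 1 h1 1 h2] 1 2 by simp
  then have "(h1 * h2) powr (- \<alpha>) \<le> (h1 * h2) powr 0" using \<alpha>_pos by (intro powr_mono) auto
  then have "(h1 * h2) powr (- \<alpha>) \<le> 1" using 1 2 by simp
  from mult_left_mono[OF this B_nonneg]
  show ?thesis using s_gt by (intro Lq_le_mono_bound[OF le] mult_right_mono) auto
qed

definition tile_const :: real where "tile_const = (decoupling_const s) powr (2 / s) * B"

lemma tile_const_nonneg: "0 \<le> tile_const"
  unfolding tile_const_def using B_nonneg by simp

text \<open>
  For a fixed offset the products of neighbouring tiles have frequencies in boxes of side \<open>2\<close> centred at
  the points of a shifted lattice \<open>(2 \<int>)\<^sup>2\<close>, so that they decouple.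
\<close>

lemma unit_tile_sum:
  assumes \<delta>: "\<delta>1 \<in> whitney_offsets" "\<delta>2 \<in> whitney_offsets" and I: "finite I" and J: "finite J"
    and \<Omega>: "fin_borel \<Omega>" "fin_borel \<Omega>'"
  shows "Lq_le lborel s (\<lambda>z. \<Sum>(m, n)\<in>I \<times> J. ext_ind (\<Omega> \<inter> tile 1 1 m n) z * ext_ind (\<Omega>' \<inter> tile 1 1 (m + \<delta>1) (n + \<delta>2)) z)
    (tile_const * (\<Sum>(m, n)\<in>I \<times> J. (measure lborel (\<Omega> \<inter> tile 1 1 m n) *
        measure lborel (\<Omega>' \<inter> tile 1 1 (m + \<delta>1) (n + \<delta>2))) powr (s / r)) powr (1 / s))"
proof -
  define F where "F m n z = ext_ind (\<Omega> \<inter> tile 1 1 m n) z * ext_ind (\<Omega>' \<inter> tile 1 1 (m + \<delta>1) (n + \<delta>2)) z" for m n z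
  define \<mu> where "\<mu> m n = measure lborel (\<Omega> \<inter> tile 1 1 m n) * measure lborel (\<Omega>' \<inter> tile 1 1 (m + \<delta>1) (n + \<delta>2))" for m n
  have s: "1 < s" "s < 2" "0 < s" using s_gt s_lt by auto
  note fb = fin_borel_Int_tile[OF \<Omega>(1)] fin_borel_Int_tile[OF \<Omega>(2)]
  note ib = integrable_indicator_fin_borel[OF fb(1)] integrable_indicator_fin_borel[OF fb(2)]
  have [measurable]: "F m n \<in> borel_measurable borel" for m n
    unfolding F_def[abs_def] using fb by (intro borel_measurable_times borel_measurable_ext_ind)
  have bd: "norm (F m n z) \<le> measure lborel \<Omega> * measure lborel \<Omega>'" for m n z
  proof -
    have "measure lborel (\<Omega> \<inter> T) \<le> measure lborel \<Omega>" if "fin_borel \<Omega>" "T \<in> sets borel" for \<Omega> T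
      using that by (intro measure_mono_fmeasurable) (auto simp: fin_borel_def fmeasurable_def)
    then show ?thesis
      unfolding F_def norm_mult using \<Omega>
      by (intro mult_mono order_trans[OF norm_ext_ind_le[OF fb(1)]] order_trans[OF norm_ext_ind_le[OF fb(2)]])
        (auto intro: tile_in_sets_borel)
  qed
  have bilinear: "(\<integral>\<^sup>+z. ennreal (norm (F m n z) powr s) \<partial>lborel) \<le> ennreal (B powr s * \<mu> m n powr (s / r))" for m n
  proof -
    have "Lq_le lborel s (F m n) (B * \<mu> m n powr (1 / r))"
      unfolding F_def \<mu>_def by (rule bilinear_tile[OF \<delta> fb]) auto
    from Lq_leD(3)[OF this] show ?thesis
      using B_nonneg by (simp add: powr_mult powr_powr)
  qed
  have "(\<integral>\<^sup>+z. ennreal (norm (\<Sum>m\<in>I. \<Sum>n\<in>J. F m n z) powr s) \<partial>lborel)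
    \<le> ennreal ((decoupling_const s)\<^sup>2) * (\<Sum>m\<in>I. \<Sum>n\<in>J. \<integral>\<^sup>+z. ennreal (norm (F m n z) powr s) \<partial>lborel)"
  proof (rule frequency_decoupling2[OF s(1,2) I J, where c="\<lambda>m. real_of_int m + real_of_int (m + \<delta>1) + 1"
        and d="\<lambda>n. real_of_int n + real_of_int (n + \<delta>2) + 1" and B="measure lborel \<Omega> * measure lborel \<Omega>'"])
    show "4 \<le> \<bar>(real_of_int m + real_of_int (m + \<delta>1) + 1) - (real_of_int n + real_of_int (n + \<delta>1) + 1)\<bar>" if "2 \<le> \<bar>m - n\<bar>" for m n
      using that by linarith
    show "4 \<le> \<bar>(real_of_int m + real_of_int (m + \<delta>2) + 1) - (real_of_int n + real_of_int (n + \<delta>2) + 1)\<bar>" if "2 \<le> \<bar>m - n\<bar>" for m n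
      using that by linarith
    have supp: "fst \<xi> \<in> {real_of_int m..real_of_int m + 1} \<and> snd \<xi> \<in> {real_of_int n..real_of_int n + 1}"
      if "indicator (\<Omega> \<inter> tile 1 1 m n) \<xi> \<noteq> (0 :: complex)" for \<xi> \<Omega> m n
      using that unit_tile_subset[of m n] by (auto simp: indicator_def split: if_splits)
    show "freq_conv (real_of_int m + real_of_int (m + \<delta>1) + 1) (\<lambda>x1. F m n (t, x1, x2)) x1 = F m n (t, x1, x2)" for m n t x1 x2
      unfolding F_def by (rule freq_conv_extension_op_mult(1)[OF ib]) (use supp in blast)+
    show "freq_conv (real_of_int n + real_of_int (n + \<delta>2) + 1) (\<lambda>x2. F m n (t, x1, x2)) x2 = F m n (t, x1, x2)" for m n t x1 x2
      unfolding F_def by (rule freq_conv_extension_op_mult(2)[OF ib]) (use supp in blast)+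
  qed (auto intro: bd)
  also have "\<dots> \<le> ennreal ((decoupling_const s)\<^sup>2) * (\<Sum>m\<in>I. \<Sum>n\<in>J. ennreal (B powr s * \<mu> m n powr (s / r)))"
    by (intro mult_left_mono sum_mono bilinear) auto
  also have "\<dots> = ennreal ((decoupling_const s)\<^sup>2 * (B powr s * (\<Sum>m\<in>I. \<Sum>n\<in>J. \<mu> m n powr (s / r))))"
  proof -
    have "(\<Sum>m\<in>I. \<Sum>n\<in>J. ennreal (B powr s * \<mu> m n powr (s / r)))
        = ennreal (B powr s * (\<Sum>m\<in>I. \<Sum>n\<in>J. \<mu> m n powr (s / r)))"
      by (simp add: sum_ennreal sum_nonneg sum_distrib_left)
    then show ?thesis by (simp add: ennreal_mult'[symmetric])
  qed
  also have "(decoupling_const s)\<^sup>2 * (B powr s * (\<Sum>m\<in>I. \<Sum>n\<in>J. \<mu> m n powr (s / r)))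
    = (tile_const * (\<Sum>m\<in>I. \<Sum>n\<in>J. \<mu> m n powr (s / r)) powr (1 / s)) powr s"
  proof -
    have "0 \<le> (\<Sum>m\<in>I. \<Sum>n\<in>J. \<mu> m n powr (s / r))" by (intro sum_nonneg) auto
    moreover have "decoupling_const s powr 2 = (decoupling_const s)\<^sup>2"
      using decoupling_const_pos[OF s(1,2)] by (simp add: powr_numeral)
    ultimately show ?thesis
      using s B_nonneg by (simp add: tile_const_def powr_mult powr_powr)
  qed
  finally have "Lq_le lborel s (\<lambda>z. \<Sum>m\<in>I. \<Sum>n\<in>J. F m n z)
     (tile_const * (\<Sum>m\<in>I. \<Sum>n\<in>J. \<mu> m n powr (s / r)) powr (1 / s))"
    using tile_const_nonneg by (auto simp: Lq_le_def)
  then show ?thesis by (simp add: sum.cartesian_product F_def \<mu>_def)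
qed

lemma tile_sum:
  assumes \<delta>: "\<delta>1 \<in> whitney_offsets" "\<delta>2 \<in> whitney_offsets" and I: "finite I" and J: "finite J"
    and \<Omega>: "fin_borel \<Omega>" "fin_borel \<Omega>'" and h: "0 < h1" "0 < h2"
  shows "Lq_le lborel s (\<lambda>z. \<Sum>(m, n)\<in>I \<times> J. ext_ind (\<Omega> \<inter> tile h1 h2 m n) z * ext_ind (\<Omega>' \<inter> tile h1 h2 (m + \<delta>1) (n + \<delta>2)) z)
    (tile_const * (h1 * h2) powr (- \<alpha>) * (\<Sum>(m, n)\<in>I \<times> J. (measure lborel (\<Omega> \<inter> tile h1 h2 m n) *
        measure lborel (\<Omega>' \<inter> tile h1 h2 (m + \<delta>1) (n + \<delta>2))) powr (s / r)) powr (1 / s))"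
proof -
  let ?D = "\<lambda>A. {\<xi> :: real \<times> real. (h1 * fst \<xi>, h2 * snd \<xi>) \<in> A}"
  define S where "S = (\<Sum>(m, n)\<in>I \<times> J. (measure lborel (\<Omega> \<inter> tile h1 h2 m n) *
        measure lborel (\<Omega>' \<inter> tile h1 h2 (m + \<delta>1) (n + \<delta>2))) powr (s / r))"
  have S0: "0 \<le> S" unfolding S_def by (intro sum_nonneg) auto
  have s: "0 < s" using s_gt by simp
  have H: "0 < h1 * h2" using h by simp
  have D: "?D (\<Omega> \<inter> tile h1 h2 m n) = ?D \<Omega> \<inter> tile 1 1 m n" for \<Omega> m n
    using h by (auto simp: tile_def)
  note fb = fin_borel_Int_tile[OF \<Omega>(1)] fin_borel_Int_tile[OF \<Omega>(2)]
  have meas: "measure lborel (?D \<Omega> \<inter> tile 1 1 m n) = measure lborel (\<Omega> \<inter> tile h1 h2 m n) / (h1 * h2)"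
    if "fin_borel \<Omega>" for \<Omega> m n
    unfolding D[symmetric] by (rule fin_borel_dilate(2)[OF h fin_borel_Int_tile[OF that]])
  have "Lq_le lborel s (\<lambda>z. \<Sum>(m, n)\<in>I \<times> J. ext_ind (?D \<Omega> \<inter> tile 1 1 m n) z * ext_ind (?D \<Omega>' \<inter> tile 1 1 (m + \<delta>1) (n + \<delta>2)) z)
    (tile_const * (\<Sum>(m, n)\<in>I \<times> J. (measure lborel (?D \<Omega> \<inter> tile 1 1 m n) *
        measure lborel (?D \<Omega>' \<inter> tile 1 1 (m + \<delta>1) (n + \<delta>2))) powr (s / r)) powr (1 / s))"
    by (intro unit_tile_sum \<delta> I J fin_borel_dilate(1) h \<Omega>)
  also have "(\<Sum>(m, n)\<in>I \<times> J. (measure lborel (?D \<Omega> \<inter> tile 1 1 m n) *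
        measure lborel (?D \<Omega>' \<inter> tile 1 1 (m + \<delta>1) (n + \<delta>2))) powr (s / r))
     = ((h1 * h2) powr (- 2)) powr (s / r) * S"
  proof -
    have H2: "x / (h1 * h2) * (y / (h1 * h2)) = (h1 * h2) powr (- 2) * (x * y)" for x y
      using H by (simp add: powr_minus_divide powr_numeral power2_eq_square)
    show ?thesis
      unfolding S_def sum_distrib_left meas[OF \<Omega>(1)] meas[OF \<Omega>(2)] H2
      by (intro sum.cong refl) (auto simp: powr_mult)
  qed
  finally have "Lq_le lborel s (\<lambda>z. \<Sum>p\<in>I \<times> J. ext_ind (?D (\<Omega> \<inter> tile h1 h2 (fst p) (snd p))) z
      * ext_ind (?D (\<Omega>' \<inter> tile h1 h2 (fst p + \<delta>1) (snd p + \<delta>2))) z)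
     (tile_const * (((h1 * h2) powr (- 2)) powr (s / r) * S) powr (1 / s))"
    unfolding D by (simp add: case_prod_beta')
  from Lq_le_sum_ext_ind_dilate[OF h s _ _ this] fb
  have "Lq_le lborel s (\<lambda>z. \<Sum>p\<in>I \<times> J. ext_ind (\<Omega> \<inter> tile h1 h2 (fst p) (snd p)) z
      * ext_ind (\<Omega>' \<inter> tile h1 h2 (fst p + \<delta>1) (snd p + \<delta>2)) z)
     ((h1 * h2) powr (2 - 2 / s) * (tile_const * (((h1 * h2) powr (- 2)) powr (s / r) * S) powr (1 / s)))"
    by blast
  also have "(h1 * h2) powr (2 - 2 / s) * (tile_const * (((h1 * h2) powr (- 2)) powr (s / r) * S) powr (1 / s))
     = tile_const * ((h1 * h2) powr (2 - 2 / s) * (h1 * h2) powr (- 2 / r)) * S powr (1 / s)"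
    using S0 s by (simp add: powr_mult powr_powr)
  also have "(h1 * h2) powr (2 - 2 / s) * (h1 * h2) powr (- 2 / r) = (h1 * h2) powr (- \<alpha>)"
    unfolding powr_add[symmetric] \<alpha>_def by (rule arg_cong[where f="\<lambda>x. (h1 * h2) powr x"]) simp
  finally show ?thesis by (simp add: S_def case_prod_beta')
qed

end

section \<open>Summing over all shapes of tiles\<close>

text \<open>
  What is used of a set with fibres of length about \<open>2 powr K\<close> over a base of length about \<open>2 powr J\<close>: it has
  the measure of the corresponding rectangle and meets every tile in no more than such a rectangle could.
\<close>

definition box_dominated :: "int \<Rightarrow> int \<Rightarrow> (real \<times> real) set \<Rightarrow> bool" where
  "box_dominated J K \<Omega> \<longleftrightarrow> fin_borel \<Omega> \<and> 2 powr J * 2 powr K \<le> measure lborel \<Omega> \<and>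
     (\<forall>(j :: int) (k :: int) m n. measure lborel (\<Omega> \<inter> tile (2 powr j) (2 powr k) m n)
        \<le> 4 * min (2 powr j) (2 powr J) * min (2 powr k) (2 powr K))"

text \<open>
  The left-hand side grows like \<open>(2 powr j) powr g\<close> until \<open>j\<close> reaches \<open>J\<close> and then decays like
  \<open>(2 powr j) powr (- a)\<close>.
\<close>

lemma min_powr_le:
  fixes j J :: int
  assumes "0 < a" "0 < g"
  shows "(2 powr j) powr (- a) * (min (2 powr j) (2 powr J)) powr (a + g)
     \<le> (2 powr J) powr g * 2 powr (- min a g * \<bar>real_of_int j - real_of_int J\<bar>)"
proof (cases "j \<le> J")
  case True
  then have "(2 powr j) powr (- a) * (min (2 powr j) (2 powr J)) powr (a + g) = 2 powr (j * g)"
    by (simp add: powr_powr algebra_simps flip: powr_add)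
  also have "j * g \<le> J * g + - min a g * \<bar>real_of_int j - real_of_int J\<bar>"
  proof -
    have "min a g * (real_of_int J - real_of_int j) \<le> g * (real_of_int J - real_of_int j)"
      using True by (intro mult_right_mono) auto
    then show ?thesis using True by (simp add: algebra_simps)
  qed
  then have "2 powr (j * g) \<le> 2 powr (J * g + - min a g * \<bar>real_of_int j - real_of_int J\<bar>)"
    by (rule powr_mono) simp
  also have "\<dots> = (2 powr J) powr g * 2 powr (- min a g * \<bar>real_of_int j - real_of_int J\<bar>)"
    unfolding powr_add by (simp add: powr_powr)
  finally show ?thesis .
next
  case False
  then have "(2 powr j) powr (- a) * (min (2 powr j) (2 powr J)) powr (a + g) = 2 powr (- (j * a) + J * (a + g))"
    by (simp add: powr_powr flip: powr_add)
  also have "- (j * a) + J * (a + g) \<le> J * g + - min a g * \<bar>real_of_int j - real_of_int J\<bar>"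
  proof -
    have "min a g * (real_of_int j - real_of_int J) \<le> a * (real_of_int j - real_of_int J)"
      using False by (intro mult_right_mono) auto
    then show ?thesis using False by (simp add: algebra_simps)
  qed
  then have "2 powr (- (j * a) + J * (a + g)) \<le> 2 powr (J * g + - min a g * \<bar>real_of_int j - real_of_int J\<bar>)"
    by (rule powr_mono) simp
  also have "\<dots> = (2 powr J) powr g * 2 powr (- min a g * \<bar>real_of_int j - real_of_int J\<bar>)"
    unfolding powr_add by (simp add: powr_powr)
  finally show ?thesis .
qed

lemma sum_measure_tiles_le:
  assumes \<Omega>: "fin_borel \<Omega>" and P: "finite P"
  shows "(\<Sum>(m, n)\<in>P. measure lborel (\<Omega> \<inter> tile h1 h2 m n)) \<le> measure lborel \<Omega>"
proof -
  have fm: "\<Omega> \<inter> tile h1 h2 m n \<in> fmeasurable lborel" for m n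
    using fin_borel_Int_tile[OF \<Omega>] by (auto simp: fin_borel_def fmeasurable_def)
  have \<Omega>fm: "\<Omega> \<in> fmeasurable lborel" using \<Omega> by (auto simp: fin_borel_def fmeasurable_def)
  have "(\<Sum>p\<in>P. measure lborel (\<Omega> \<inter> tile h1 h2 (fst p) (snd p)))
     = measure lborel (\<Union>p\<in>P. \<Omega> \<inter> tile h1 h2 (fst p) (snd p))"
    using P fm by (intro measure_finite_Union[symmetric])
      (auto simp: disjoint_family_on_def tile_def fmeasurable_def less_top)
  also have "\<dots> \<le> measure lborel \<Omega>"
    using P fm \<Omega>fm by (intro measure_mono_fmeasurable) (auto intro!: sets.finite_UN simp: fmeasurable_def)
  finally show ?thesis by (simp add: case_prod_beta')
qed

lemma sum_powr_le_max:
  fixes x :: "'a \<Rightarrow> real"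
  assumes "1 \<le> e" "\<And>p. p \<in> P \<Longrightarrow> 0 \<le> x p" "\<And>p. p \<in> P \<Longrightarrow> x p \<le> X" "(\<Sum>p\<in>P. x p) \<le> T"
  shows "(\<Sum>p\<in>P. x p powr e) \<le> X powr (e - 1) * T"
proof -
  have "(\<Sum>p\<in>P. x p powr e) \<le> (\<Sum>p\<in>P. X powr (e - 1) * x p)"
  proof (rule sum_mono)
    fix p assume p: "p \<in> P"
    have "x p powr e = x p powr (e - 1) * x p"
      using assms(2)[OF p] by (cases "x p = 0") (auto simp: powr_mult_base mult.commute[of _ "x p"])
    also have "\<dots> \<le> X powr (e - 1) * x p"
      using assms(1-3) p by (intro mult_right_mono powr_mono2) auto
    finally show "x p powr e \<le> X powr (e - 1) * x p" .
  qed
  also have "\<dots> = X powr (e - 1) * (\<Sum>p\<in>P. x p)" by (simp add: sum_distrib_left)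
  also have "\<dots> \<le> X powr (e - 1) * T" using assms(4) by (intro mult_left_mono) auto
  finally show ?thesis .
qed

context bilinear_extension_estimate
begin

text \<open>
  Positive exactly because \<open>s > 3/2\<close>; it makes the contribution of tiles smaller than the set summable, as
  \<open>\<alpha>\<close> does for tiles larger than the set.
\<close>

definition \<gamma> :: real where "\<gamma> = 2 - 3 / s"

definition \<epsilon> :: real where "\<epsilon> = min \<alpha> \<gamma> / 4"

lemma \<gamma>_pos: "0 < \<gamma>" using s_gt by (simp add: \<gamma>_def field_simps)

lemma \<epsilon>_pos: "0 < \<epsilon>" using \<alpha>_pos \<gamma>_pos by (simp add: \<epsilon>_def)

text \<open>
  One factor of the power is summed over the tiles to the measure of \<open>\<Omega>\<close>, and the rest of it is bounded by the
  fullest tile. The powers of \<open>2 powr j\<close> and \<open>2 powr k\<close> that appear peak at \<open>j = J\<close> and \<open>k = K\<close>.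
\<close>

lemma tile_square_sum_dominated:
  assumes dom: "box_dominated J K \<Omega>" and P: "finite P"
  shows "(2 powr j * 2 powr k) powr (- \<alpha>) *
      (\<Sum>(m, n)\<in>P. measure lborel (\<Omega> \<inter> tile (2 powr of_int j) (2 powr of_int k) m n) powr (2 * s / r)) powr (1 / s)
    \<le> 4 powr (\<alpha> + \<gamma>) * measure lborel \<Omega> powr (2 - 2 / s) *
      2 powr (- 4 * \<epsilon> * (\<bar>real_of_int j - real_of_int J\<bar> + \<bar>real_of_int k - real_of_int K\<bar>))"
proof -
  let ?mj = "min (2 powr j) (2 powr J)" and ?mk = "min (2 powr k) (2 powr K)" and ?M = "measure lborel \<Omega>"
  let ?S = "\<Sum>(m, n)\<in>P. measure lborel (\<Omega> \<inter> tile (2 powr of_int j) (2 powr of_int k) m n) powr (2 * s / r)"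
  have s: "0 < s" using s_gt by simp
  have "s / (s - 1) \<le> 2 * s" using s_gt by (simp add: field_simps)
  then have e: "1 \<le> 2 * s / r" using r_lt r_ge by (simp add: field_simps)
  have \<Omega>: "fin_borel \<Omega>" and low: "2 powr J * 2 powr K \<le> ?M" using dom by (auto simp: box_dominated_def)
  have "?S \<le> (4 * ?mj * ?mk) powr (2 * s / r - 1) * ?M"
    unfolding case_prod_beta'
    using sum_powr_le_max[OF e, of P "\<lambda>p. measure lborel (\<Omega> \<inter> tile (2 powr of_int j) (2 powr of_int k) (fst p) (snd p))"]
      sum_measure_tiles_le[OF \<Omega> P, of "2 powr of_int j" "2 powr of_int k"] dom
    by (auto simp: box_dominated_def case_prod_beta')
  then have "?S powr (1 / s) \<le> ((4 * ?mj * ?mk) powr (2 * s / r - 1) * ?M) powr (1 / s)"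
    using s by (intro powr_mono2) (auto intro!: sum_nonneg)
  also have "\<dots> = (4 * ?mj * ?mk) powr (\<alpha> + \<gamma>) * ?M powr (1 / s)"
  proof -
    have "(2 * s / r - 1) * (1 / s) = \<alpha> + \<gamma>" using s r_ge by (simp add: \<alpha>_def \<gamma>_def field_simps)
    then show ?thesis by (subst powr_mult) (auto simp: powr_powr)
  qed
  finally have "(2 powr j * 2 powr k) powr (- \<alpha>) * ?S powr (1 / s)
      \<le> (2 powr j * 2 powr k) powr (- \<alpha>) * ((4 * ?mj * ?mk) powr (\<alpha> + \<gamma>) * ?M powr (1 / s))"
    by (intro mult_left_mono) auto
  also have "\<dots> = 4 powr (\<alpha> + \<gamma>) * (((2 powr j) powr (- \<alpha>) * ?mj powr (\<alpha> + \<gamma>)) * ((2 powr k) powr (- \<alpha>) * ?mk powr (\<alpha> + \<gamma>))) * ?M powr (1 / s)"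
    by (simp only: powr_mult mult_ac)
  also have "\<dots> \<le> 4 powr (\<alpha> + \<gamma>) * (((2 powr J) powr \<gamma> * 2 powr (- min \<alpha> \<gamma> * \<bar>real_of_int j - real_of_int J\<bar>))
       * ((2 powr K) powr \<gamma> * 2 powr (- min \<alpha> \<gamma> * \<bar>real_of_int k - real_of_int K\<bar>))) * ?M powr (1 / s)"
    by (intro mult_right_mono mult_left_mono mult_mono min_powr_le \<alpha>_pos \<gamma>_pos) auto
  also have "\<dots> = 4 powr (\<alpha> + \<gamma>) * ((2 powr J * 2 powr K) powr \<gamma> * ?M powr (1 / s)) *
       (2 powr (- min \<alpha> \<gamma> * \<bar>real_of_int j - real_of_int J\<bar>) * 2 powr (- min \<alpha> \<gamma> * \<bar>real_of_int k - real_of_int K\<bar>))"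
    by (simp only: powr_mult mult_ac)
  also have "2 powr (- min \<alpha> \<gamma> * \<bar>real_of_int j - real_of_int J\<bar>) * 2 powr (- min \<alpha> \<gamma> * \<bar>real_of_int k - real_of_int K\<bar>)
      = 2 powr (- 4 * \<epsilon> * (\<bar>real_of_int j - real_of_int J\<bar> + \<bar>real_of_int k - real_of_int K\<bar>))"
    unfolding powr_add[symmetric] by (simp add: \<epsilon>_def distrib_left)
  also have "(2 powr J * 2 powr K) powr \<gamma> * ?M powr (1 / s) \<le> ?M powr \<gamma> * ?M powr (1 / s)"
    using low \<gamma>_pos by (intro mult_right_mono powr_mono2) auto
  also have "?M powr \<gamma> * ?M powr (1 / s) = ?M powr (2 - 2 / s)"
  proof -
    have "\<gamma> + 1 / s = 2 - 2 / s" using s by (simp add: \<gamma>_def field_simps)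
    then show ?thesis by (simp flip: powr_add)
  qed
  finally show ?thesis by (simp add: mult_left_mono mult_right_mono)
qed

text \<open>
  The Cauchy-Schwarz inequality over the tiles separates the two sets. The bound is thus a geometric mean of two
  bounds which peak at \<open>(J, K)\<close> and at \<open>(J', K')\<close>. This is the source of the decay in \<open>\<bar>K - K'\<bar>\<close>.
\<close>

lemma tile_sum_dominated:
  assumes \<delta>: "\<delta>1 \<in> whitney_offsets" "\<delta>2 \<in> whitney_offsets" and I: "finite I" and I': "finite I'"
    and dom: "box_dominated J K \<Omega>" "box_dominated J' K' \<Omega>'"
  shows "Lq_le lborel s (\<lambda>z. \<Sum>(m, n)\<in>I \<times> I'. ext_ind (\<Omega> \<inter> tile (2 powr of_int j) (2 powr of_int k) m n) z
        * ext_ind (\<Omega>' \<inter> tile (2 powr of_int j) (2 powr of_int k) (m + \<delta>1) (n + \<delta>2)) z)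
    (tile_const * 4 powr (\<alpha> + \<gamma>) * (measure lborel \<Omega> * measure lborel \<Omega>') powr (1 - 1 / s) *
      (2 powr (- 2 * \<epsilon> * (\<bar>real_of_int j - real_of_int J\<bar> + \<bar>real_of_int j - real_of_int J'\<bar>)) *
       2 powr (- 2 * \<epsilon> * (\<bar>real_of_int k - real_of_int K\<bar> + \<bar>real_of_int k - real_of_int K'\<bar>))))"
proof -
  let ?h = "2 powr of_int j :: real" and ?h' = "2 powr of_int k :: real"
  let ?P = "I \<times> I'"
  have s: "0 < s" using s_gt by simp
  have \<Omega>: "fin_borel \<Omega>" "fin_borel \<Omega>'" using dom by (auto simp: box_dominated_def)
  define x where "x p = measure lborel (\<Omega> \<inter> tile ?h ?h' (fst p) (snd p))" for p
  define y where "y p = measure lborel (\<Omega>' \<inter> tile ?h ?h' (fst p + \<delta>1) (snd p + \<delta>2))" for p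
  define a where "a = (\<Sum>p\<in>?P. x p powr (2 * s / r))"
  define b where "b = (\<Sum>p\<in>?P. y p powr (2 * s / r))"
  define S where "S = (\<Sum>p\<in>?P. (x p * y p) powr (s / r))"
  have nn: "0 \<le> a" "0 \<le> b" "0 \<le> S" unfolding a_def b_def S_def by (auto intro!: sum_nonneg)
  have xy: "0 \<le> x p" "0 \<le> y p" for p by (auto simp: x_def y_def)
  have sq: "(u powr (s / r))\<^sup>2 = u powr (2 * s / r)" for u :: real
    by (simp add: power2_eq_square flip: powr_add)
  have "S\<^sup>2 = (\<Sum>p\<in>?P. x p powr (s / r) * y p powr (s / r))\<^sup>2"
    unfolding S_def using xy by (simp add: powr_mult)
  also have "\<dots> \<le> a * b"
    unfolding a_def b_def sq[symmetric] by (rule Cauchy_Schwarz_ineq_sum)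
  finally have Sab: "S\<^sup>2 \<le> a * b" .
  define H where "H = (?h * ?h') powr (- \<alpha>)"
  have H0: "0 < H" by (simp add: H_def)
  define X where "X = 4 powr (\<alpha> + \<gamma>) * measure lborel \<Omega> powr (2 - 2 / s) *
      2 powr (- 4 * \<epsilon> * (\<bar>real_of_int j - real_of_int J\<bar> + \<bar>real_of_int k - real_of_int K\<bar>))"
  define Y where "Y = 4 powr (\<alpha> + \<gamma>) * measure lborel \<Omega>' powr (2 - 2 / s) *
      2 powr (- 4 * \<epsilon> * (\<bar>real_of_int j - real_of_int J'\<bar> + \<bar>real_of_int k - real_of_int K'\<bar>))"
  have X: "H * a powr (1 / s) \<le> X"
    using tile_square_sum_dominated[OF dom(1), of ?P j k] I I' by (simp add: X_def H_def a_def x_def case_prod_beta')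
  have Y: "H * b powr (1 / s) \<le> Y"
  proof -
    let ?f = "\<lambda>p. (fst p + \<delta>1, snd p + \<delta>2)"
    have "b = (\<Sum>(m, n)\<in>?f ` ?P. measure lborel (\<Omega>' \<inter> tile ?h ?h' m n) powr (2 * s / r))"
      unfolding b_def y_def by (subst sum.reindex) (auto simp: inj_on_def)
    then show ?thesis
      using tile_square_sum_dominated[OF dom(2), of "?f ` ?P" j k] I I' by (simp add: Y_def H_def)
  qed
  have "(H * S powr (1 / s))\<^sup>2 \<le> X * Y"
  proof -
    have "(S powr (1 / s))\<^sup>2 = (S\<^sup>2) powr (1 / s)"
      using nn by (simp add: power2_eq_square powr_mult)
    also have "\<dots> \<le> (a * b) powr (1 / s)" using Sab s by (intro powr_mono2) auto
    also have "\<dots> = a powr (1 / s) * b powr (1 / s)" using nn by (simp add: powr_mult)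
    finally have "(H * S powr (1 / s))\<^sup>2 \<le> (H * a powr (1 / s)) * (H * b powr (1 / s))"
      using H0 by (simp add: power_mult_distrib power2_eq_square mult_ac)
    also have "\<dots> \<le> X * Y"
      using X Y H0 by (intro mult_mono) (auto simp: X_def)
    finally show ?thesis .
  qed
  also have "X * Y = (4 powr (\<alpha> + \<gamma>) * (measure lborel \<Omega> * measure lborel \<Omega>') powr (1 - 1 / s) *
      (2 powr (- 2 * \<epsilon> * (\<bar>real_of_int j - real_of_int J\<bar> + \<bar>real_of_int j - real_of_int J'\<bar>)) *
       2 powr (- 2 * \<epsilon> * (\<bar>real_of_int k - real_of_int K\<bar> + \<bar>real_of_int k - real_of_int K'\<bar>))))\<^sup>2"
  proof -
    have m: "measure lborel \<Omega> powr (2 - 2 / s) * measure lborel \<Omega>' powr (2 - 2 / s)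
        = ((measure lborel \<Omega> * measure lborel \<Omega>') powr (1 - 1 / s))\<^sup>2"
    proof -
      have "u powr (2 - 2 / s) = u powr (1 - 1 / s) * u powr (1 - 1 / s)" for u :: real
        unfolding powr_add[symmetric] by simp
      then show ?thesis by (simp only: power2_eq_square powr_mult mult_ac)
    qed
    have two: "2 powr (- 4 * \<epsilon> * (u1 + v1)) * 2 powr (- 4 * \<epsilon> * (u2 + v2))
        = (2 powr (- 2 * \<epsilon> * (u1 + u2)) * 2 powr (- 2 * \<epsilon> * (v1 + v2)))\<^sup>2" for u1 u2 v1 v2 :: real
      unfolding power2_eq_square powr_add[symmetric] by (rule arg_cong[where f="\<lambda>x. 2 powr x"]) (simp add: algebra_simps)
    have "X * Y = (4 powr (\<alpha> + \<gamma>))\<^sup>2 * (measure lborel \<Omega> powr (2 - 2 / s) * measure lborel \<Omega>' powr (2 - 2 / s)) *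
        (2 powr (- 4 * \<epsilon> * (\<bar>real_of_int j - real_of_int J\<bar> + \<bar>real_of_int k - real_of_int K\<bar>))
        * 2 powr (- 4 * \<epsilon> * (\<bar>real_of_int j - real_of_int J'\<bar> + \<bar>real_of_int k - real_of_int K'\<bar>)))"
      by (simp only: X_def Y_def power2_eq_square mult_ac)
    then show ?thesis unfolding m two by (simp only: power_mult_distrib)
  qed
  finally have main: "H * S powr (1 / s) \<le> 4 powr (\<alpha> + \<gamma>) * (measure lborel \<Omega> * measure lborel \<Omega>') powr (1 - 1 / s) *
      (2 powr (- 2 * \<epsilon> * (\<bar>real_of_int j - real_of_int J\<bar> + \<bar>real_of_int j - real_of_int J'\<bar>)) *
       2 powr (- 2 * \<epsilon> * (\<bar>real_of_int k - real_of_int K\<bar> + \<bar>real_of_int k - real_of_int K'\<bar>)))"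
    by (rule power2_le_imp_le) auto
  show ?thesis
  proof (rule Lq_le_mono_bound[OF tile_sum[OF \<delta> I I' \<Omega>, of ?h ?h'] _ s])
    show "tile_const * (?h * ?h') powr (- \<alpha>) * (\<Sum>(m, n)\<in>I \<times> I'. (measure lborel (\<Omega> \<inter> tile ?h ?h' m n) *
        measure lborel (\<Omega>' \<inter> tile ?h ?h' (m + \<delta>1) (n + \<delta>2))) powr (s / r)) powr (1 / s)
      \<le> tile_const * 4 powr (\<alpha> + \<gamma>) * (measure lborel \<Omega> * measure lborel \<Omega>') powr (1 - 1 / s) *
      (2 powr (- 2 * \<epsilon> * (\<bar>real_of_int j - real_of_int J\<bar> + \<bar>real_of_int j - real_of_int J'\<bar>)) *
       2 powr (- 2 * \<epsilon> * (\<bar>real_of_int k - real_of_int K\<bar> + \<bar>real_of_int k - real_of_int K'\<bar>)))"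
      using mult_left_mono[OF main tile_const_nonneg]
      by (simp add: S_def H_def x_def y_def case_prod_beta' mult.assoc)
  qed auto
qed

end

section \<open>Whitney decomposition in each coordinate\<close>

definition dyadic_index :: "int \<Rightarrow> real \<Rightarrow> int" where
  "dyadic_index j x = \<lfloor>x / 2 powr j\<rfloor>"

lemma borel_measurable_dyadic_index [measurable]: "dyadic_index j \<in> borel \<rightarrow>\<^sub>M count_space UNIV"
  unfolding dyadic_index_def[abs_def] by measurable

lemma dyadic_index_parent: "dyadic_index (j + 1) x = dyadic_index j x div 2"
proof -
  have "x / 2 powr (j + 1) = x / 2 powr j / real_of_int 2" by (simp add: powr_add)
  then show ?thesis unfolding dyadic_index_def by (simp only: floor_divide_real_eq_div of_int_add of_int_1)
qed

text \<open>
  At scale \<open>j\<close> the dyadic intervals containing \<open>x\<close> and \<open>y\<close> are not adjacent, while their parents coincide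
  or are adjacent.
\<close>

definition whitney_scale :: "int \<Rightarrow> real \<Rightarrow> real \<Rightarrow> bool" where
  "whitney_scale j x y \<longleftrightarrow> 2 \<le> \<bar>dyadic_index j x - dyadic_index j y\<bar> \<and>
     \<bar>dyadic_index (j + 1) x - dyadic_index (j + 1) y\<bar> \<le> 1"

lemma dyadic_index_close_mono:
  assumes "\<bar>dyadic_index j x - dyadic_index j y\<bar> \<le> 1" "j \<le> k"
  shows "\<bar>dyadic_index k x - dyadic_index k y\<bar> \<le> 1"
  using assms(2,1)
proof (induction k rule: int_ge_induct)
  case (step k)
  then show ?case unfolding dyadic_index_parent by linarith
qed simp

lemma whitney_scale_unique: "whitney_scale j x y \<Longrightarrow> whitney_scale k x y \<Longrightarrow> j = k"
  using dyadic_index_close_mono[of "j + 1" x y k] dyadic_index_close_mono[of "k + 1" x y j]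
  unfolding whitney_scale_def by (cases j k rule: linorder_cases) auto

lemma dyadic_index_bounds:
  "of_int (dyadic_index j x) * 2 powr j \<le> x" "x < (of_int (dyadic_index j x) + 1) * 2 powr j"
proof -
  have "of_int (dyadic_index j x) \<le> x / 2 powr j" "x / 2 powr j < of_int (dyadic_index j x) + 1"
    unfolding dyadic_index_def by linarith+
  then show "of_int (dyadic_index j x) * 2 powr j \<le> x" "x < (of_int (dyadic_index j x) + 1) * 2 powr j"
    by (simp_all add: field_simps)
qed

text \<open>
  The largest scale with nonadjacent intervals: at very small scales the distance of \<open>x\<close> and \<open>y\<close> exceeds three
  interval lengths, and at scales larger than the distance the intervals coincide or are adjacent.
\<close>

lemma whitney_scale_exists:
  assumes "x \<noteq> y"
  shows "\<exists>j. whitney_scale j x y"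
proof -
  define D where "D j = \<bar>dyadic_index j x - dyadic_index j y\<bar>" for j
  define d where "d = \<bar>x - y\<bar>"
  have d: "0 < d" using assms by (simp add: d_def)
  have diff: "\<bar>d - of_int (D j) * 2 powr j\<bar> < 2 powr j" for j
  proof -
    have "\<bar>(x - y) - of_int (dyadic_index j x - dyadic_index j y) * 2 powr j\<bar> < 2 powr j"
      using dyadic_index_bounds[where j=j and x=x] dyadic_index_bounds[where j=j and x=y] by (auto simp: algebra_simps abs_less_iff)
    moreover have "of_int (D j) * 2 powr j = \<bar>of_int (dyadic_index j x - dyadic_index j y) * 2 powr j\<bar>"
      by (simp add: D_def abs_mult)
    ultimately show ?thesis unfolding d_def by linarith
  qed
  obtain n :: nat where n: "3 / d < 2 ^ n" using real_arch_pow[of 2 "3 / d"] by auto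
  obtain n' :: nat where n': "d < 2 ^ n'" using real_arch_pow[of 2 d] by auto
  define j0 where "j0 = - int n"
  have "3 * 2 powr j0 < d"
    using n d by (simp add: j0_def powr_minus_divide powr_realpow field_simps)
  then have "\<not> D j0 \<le> 1"
  proof -
    assume *: "3 * 2 powr j0 < d"
    show ?thesis
    proof
      assume "D j0 \<le> 1"
      then have "of_int (D j0) * 2 powr j0 \<le> 1 * 2 powr j0" by (intro mult_right_mono) auto
      then show False using diff[of j0] * by (smt (verit) powr_gt_zero)
    qed
  qed
  have "D (int n') \<le> 1"
  proof (rule ccontr)
    assume "\<not> D (int n') \<le> 1"
    then have "2 * 2 powr n' \<le> of_int (D (int n')) * 2 powr n'" by (intro mult_right_mono) auto
    moreover have "d < 2 powr real n'" using n' by (simp add: powr_realpow)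
    ultimately show False using diff[of "int n'"] unfolding of_int_of_nat_eq by linarith
  qed
  have ge: "j0 \<le> int n'" by (simp add: j0_def)
  define P where "P i \<longleftrightarrow> D (j0 + int i) \<le> 1" for i
  have "P (nat (int n' - j0))" using ge \<open>D (int n') \<le> 1\<close> by (simp add: P_def)
  then have L: "P (LEAST i. P i)" "\<And>i. i < (LEAST i. P i) \<Longrightarrow> \<not> P i"
    by (auto intro: LeastI dest: not_less_Least)
  have "\<not> P 0" using \<open>\<not> D j0 \<le> 1\<close> by (simp add: P_def)
  then obtain i where i: "(LEAST i. P i) = Suc i" using L(1) by (metis not0_implies_Suc)
  have "\<not> P i" "P (Suc i)" using L(2)[of i] L(1) i by auto
  then have "whitney_scale (j0 + int i) x y"
    by (auto simp: whitney_scale_def P_def D_def ac_simps)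
  then show ?thesis ..
qed

text \<open>
  The indices of intervals that form a Whitney pair with the interval at offset \<open>\<delta>\<close>. For \<open>\<bar>\<delta>\<bar> = 3\<close> half of
  the indices are excluded, namely those for which the parents are not adjacent.
\<close>

definition whitney_starts :: "nat \<Rightarrow> int \<Rightarrow> int set" where
  "whitney_starts n \<delta> = {m \<in> {- int n..int n}. \<bar>m div 2 - (m + \<delta>) div 2\<bar> \<le> 1}"

definition whitney_weight :: "nat \<Rightarrow> real \<Rightarrow> real \<Rightarrow> real" where
  "whitney_weight n x y = (\<Sum>(j, \<delta>)\<in>{- int n..int n} \<times> whitney_offsets. \<Sum>m\<in>whitney_starts n \<delta>.
     of_bool (dyadic_index j x = m \<and> dyadic_index j y = m + \<delta>))"

lemma finite_whitney [simp]: "finite (whitney_starts n \<delta>)" "finite whitney_offsets"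
  by (rule finite_subset[of _ "{- int n..int n}"]) (auto simp: whitney_starts_def whitney_offsets_def)

text \<open>
  Each pair of points is counted at most once, since a Whitney pair of intervals that contains it determines
  scale, index and offset.
\<close>

lemma whitney_weight_eq:
  "whitney_weight n x y = (if \<exists>j\<in>{- int n..int n}. dyadic_index j x \<in> {- int n..int n} \<and> whitney_scale j x y then 1 else 0)"
proof -
  have inner: "(\<Sum>m\<in>whitney_starts n \<delta>. of_bool (dyadic_index j x = m \<and> dyadic_index j y = m + \<delta>) :: real)
     = of_bool (dyadic_index j x \<in> {- int n..int n} \<and> whitney_scale j x y \<and> \<delta> = dyadic_index j y - dyadic_index j x)"
    if "\<delta> \<in> whitney_offsets" for j \<delta>
  proof -
    have "(\<Sum>m\<in>whitney_starts n \<delta>. of_bool (dyadic_index j x = m \<and> dyadic_index j y = m + \<delta>) :: real)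
      = (\<Sum>m\<in>whitney_starts n \<delta>. if m = dyadic_index j x then of_bool (dyadic_index j y = dyadic_index j x + \<delta>) else 0)"
      by (intro sum.cong) auto
    also have "\<dots> = of_bool (dyadic_index j x \<in> whitney_starts n \<delta> \<and> dyadic_index j y = dyadic_index j x + \<delta>)"
      by (subst sum.delta) auto
    also have "(dyadic_index j x \<in> whitney_starts n \<delta> \<and> dyadic_index j y = dyadic_index j x + \<delta>) \<longleftrightarrow>
      (dyadic_index j x \<in> {- int n..int n} \<and> whitney_scale j x y \<and> \<delta> = dyadic_index j y - dyadic_index j x)"
      using that by (auto simp: whitney_starts_def whitney_scale_def dyadic_index_parent whitney_offsets_def)
    finally show ?thesis .
  qed
  have offset: "(\<Sum>\<delta>\<in>whitney_offsets. of_bool (Q \<and> whitney_scale j x y \<and> \<delta> = dyadic_index j y - dyadic_index j x) :: real)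
     = of_bool (Q \<and> whitney_scale j x y)" for j Q
  proof -
    have "dyadic_index j y - dyadic_index j x \<in> whitney_offsets" if "whitney_scale j x y"
    proof -
      define u v where "u = dyadic_index j x" and "v = dyadic_index j y"
      have *: "2 \<le> \<bar>u - v\<bar>" "\<bar>u div 2 - v div 2\<bar> \<le> 1"
        using that by (auto simp: whitney_scale_def dyadic_index_parent u_def v_def)
      then have "\<bar>v - u\<bar> \<le> 3" by linarith
      then show ?thesis using * unfolding whitney_offsets_def u_def[symmetric] v_def[symmetric] by auto
    qed
    moreover have "(\<Sum>\<delta>\<in>whitney_offsets. of_bool (Q \<and> whitney_scale j x y \<and> \<delta> = dyadic_index j y - dyadic_index j x) :: real)
       = (\<Sum>\<delta>\<in>whitney_offsets. if \<delta> = dyadic_index j y - dyadic_index j x then of_bool (Q \<and> whitney_scale j x y) else 0)"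
      by (intro sum.cong) auto
    ultimately show ?thesis by (subst (asm) sum.delta) (auto split: if_splits)
  qed
  have "whitney_weight n x y = (\<Sum>j\<in>{- int n..int n}. of_bool (dyadic_index j x \<in> {- int n..int n} \<and> whitney_scale j x y))"
    unfolding whitney_weight_def sum.cartesian_product[symmetric]
    by (intro sum.cong refl) (simp only: inner offset cong: sum.cong)
  also have "\<dots> = (if \<exists>j\<in>{- int n..int n}. dyadic_index j x \<in> {- int n..int n} \<and> whitney_scale j x y then 1 else 0)"
  proof (cases "\<exists>j\<in>{- int n..int n}. dyadic_index j x \<in> {- int n..int n} \<and> whitney_scale j x y")
    case True
    then obtain i where i: "i \<in> {- int n..int n}" "dyadic_index i x \<in> {- int n..int n}" "whitney_scale i x y" by blast
    have "of_bool (dyadic_index j x \<in> {- int n..int n} \<and> whitney_scale j x y) = (if j = i then 1 else 0 :: real)" for j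
      using i whitney_scale_unique[of j x y i] by (cases "j = i") auto
    then show ?thesis using True i by (simp add: sum.delta)
  qed (auto intro!: sum.neutral)
  finally show ?thesis .
qed

lemma whitney_weight_le_1: "norm (whitney_weight n x y) \<le> 1"
  by (simp add: whitney_weight_eq)

lemma whitney_weight_tendsto:
  assumes "x \<noteq> y"
  shows "(\<lambda>n. whitney_weight n x y) \<longlonglongrightarrow> 1"
proof -
  obtain j where j: "whitney_scale j x y" using whitney_scale_exists[OF assms] ..
  have "eventually (\<lambda>n. whitney_weight n x y = 1) sequentially"
    using eventually_ge_at_top[of "nat (\<bar>j\<bar> + \<bar>dyadic_index j x\<bar>)"]
  proof eventually_elim
    case (elim n)
    then have "j \<in> {- int n..int n}" "dyadic_index j x \<in> {- int n..int n}" by auto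
    then show ?case using j unfolding whitney_weight_eq by auto
  qed
  then show ?thesis by (rule tendsto_eventually)
qed

lemma AE_distinct_coordinates:
  "AE p in (lborel \<Otimes>\<^sub>M lborel :: ((real \<times> real) \<times> (real \<times> real)) measure).
     fst (fst p) \<noteq> fst (snd p) \<and> snd (fst p) \<noteq> snd (snd p)"
proof -
  have sing: "AE x in (lborel :: real measure). x \<noteq> c" for c by (rule AE_lborel_singleton)
  have 2: "AE \<eta> in (lborel :: (real \<times> real) measure). a \<noteq> fst \<eta> \<and> b \<noteq> snd \<eta>" for a b
  proof -
    have "AE \<eta> in (lborel \<Otimes>\<^sub>M lborel :: (real \<times> real) measure). a \<noteq> fst \<eta> \<and> b \<noteq> snd \<eta>"
    proof (rule lborel_pair.AE_pair_measure)
      show "{\<eta> \<in> space (lborel \<Otimes>\<^sub>M lborel :: (real \<times> real) measure). a \<noteq> fst \<eta> \<and> b \<noteq> snd \<eta>} \<in> sets (lborel \<Otimes>\<^sub>M lborel)"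
        by measurable
      show "AE x in lborel. AE y in lborel. a \<noteq> fst (x, y) \<and> b \<noteq> snd (x, y)"
        using sing[of a] by eventually_elim (use sing[of b] in \<open>auto elim: eventually_mono\<close>)
    qed
    then show ?thesis unfolding lborel_prod .
  qed
  show ?thesis
  proof (rule lborel_pair.AE_pair_measure)
    show "{p \<in> space (lborel \<Otimes>\<^sub>M lborel :: ((real \<times> real) \<times> (real \<times> real)) measure).
        fst (fst p) \<noteq> fst (snd p) \<and> snd (fst p) \<noteq> snd (snd p)} \<in> sets (lborel \<Otimes>\<^sub>M lborel)"
      by measurable
    show "AE x in lborel. AE y in lborel. fst (fst (x, y)) \<noteq> fst (snd (x, y)) \<and> snd (fst (x, y)) \<noteq> snd (snd (x :: real \<times> real, y :: real \<times> real))"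
      using 2 by (auto elim: eventually_mono)
  qed
qed

text \<open>
  The part of the product of two extensions that comes from pairs of tiles which form Whitney pairs in both
  coordinates, at independent scales, restricted to finitely many tiles.
\<close>

definition whitney_sum :: "nat \<Rightarrow> (real \<times> real) set \<Rightarrow> (real \<times> real) set \<Rightarrow> real \<times> real \<times> real \<Rightarrow> complex" where
  "whitney_sum n \<Omega> \<Omega>' z = (\<Sum>((j, \<delta>), (k, \<delta>'))\<in>({- int n..int n} \<times> whitney_offsets) \<times> ({- int n..int n} \<times> whitney_offsets).
     \<Sum>(m, m')\<in>whitney_starts n \<delta> \<times> whitney_starts n \<delta>'.
       ext_ind (\<Omega> \<inter> tile (2 powr of_int j) (2 powr of_int k) m m') z *
       ext_ind (\<Omega>' \<inter> tile (2 powr of_int j) (2 powr of_int k) (m + \<delta>) (m' + \<delta>')) z)"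

lemma whitney_sum_eq_integral:
  assumes \<Omega>: "fin_borel \<Omega>" "fin_borel \<Omega>'"
  shows "whitney_sum n \<Omega> \<Omega>' z = (\<integral>p. (phase z (fst p) * indicator \<Omega> (fst p)) * (phase z (snd p) * indicator \<Omega>' (snd p)) *
     of_real (whitney_weight n (fst (fst p)) (fst (snd p)) * whitney_weight n (snd (fst p)) (snd (snd p))) \<partial>(lborel \<Otimes>\<^sub>M lborel))"
proof -
  let ?Q = "{- int n..int n} \<times> whitney_offsets"
  define G where "G p = (phase z (fst p) * indicator \<Omega> (fst p)) * (phase z (snd p) * indicator \<Omega>' (snd p))" for p
  define U where "U j \<delta> m x y = (of_bool (dyadic_index j x = m \<and> dyadic_index j y = m + \<delta>) :: real)" for j \<delta> m x y
  define T where "T j k \<delta> \<delta>' m m' p = G p * of_real (U j \<delta> m (fst (fst p)) (fst (snd p)) * U k \<delta>' m' (snd (fst p)) (snd (snd p)))"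
    for j k \<delta> \<delta>' m m' p
  have int_G: "integrable (lborel \<Otimes>\<^sub>M lborel) G"
    unfolding G_def by (intro lborel_pair.integral_product_functions(1) integrable_phase_mult integrable_indicator_fin_borel \<Omega>)
  have T_prod: "(phase z (fst p) * indicator (\<Omega> \<inter> tile (2 powr of_int j) (2 powr of_int k) m m') (fst p)) *
      (phase z (snd p) * indicator (\<Omega>' \<inter> tile (2 powr of_int j) (2 powr of_int k) (m + \<delta>) (m' + \<delta>')) (snd p))
      = T j k \<delta> \<delta>' m m' p" for j k \<delta> \<delta>' m m' p
    by (auto simp: T_def G_def U_def tile_def dyadic_index_def indicator_def)
  have ext_T: "ext_ind (\<Omega> \<inter> tile (2 powr of_int j) (2 powr of_int k) m m') z *
       ext_ind (\<Omega>' \<inter> tile (2 powr of_int j) (2 powr of_int k) (m + \<delta>) (m' + \<delta>')) z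
      = (\<integral>p. T j k \<delta> \<delta>' m m' p \<partial>(lborel \<Otimes>\<^sub>M lborel))" for j k \<delta> \<delta>' m m'
    unfolding T_prod[symmetric]
    by (intro extension_op_mult integrable_indicator_fin_borel fin_borel_Int_tile \<Omega>)
  have int_T: "integrable (lborel \<Otimes>\<^sub>M lborel) (T j k \<delta> \<delta>' m m')" for j k \<delta> \<delta>' m m'
    unfolding T_prod[symmetric, abs_def]
    by (intro lborel_pair.integral_product_functions(1) integrable_phase_mult integrable_indicator_fin_borel fin_borel_Int_tile \<Omega>)
  have "whitney_sum n \<Omega> \<Omega>' z = (\<integral>p. (\<Sum>((j, \<delta>), (k, \<delta>'))\<in>?Q \<times> ?Q. \<Sum>(m, m')\<in>whitney_starts n \<delta> \<times> whitney_starts n \<delta>'.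
       T j k \<delta> \<delta>' m m' p) \<partial>(lborel \<Otimes>\<^sub>M lborel))"
    unfolding whitney_sum_def ext_T case_prod_beta'
    by (subst Bochner_Integration.integral_sum; (subst Bochner_Integration.integral_sum)?;
        intro Bochner_Integration.integrable_sum int_T refl)
  also have "\<dots> = (\<integral>p. G p * of_real (whitney_weight n (fst (fst p)) (fst (snd p)) * whitney_weight n (snd (fst p)) (snd (snd p))) \<partial>(lborel \<Otimes>\<^sub>M lborel))"
  proof (rule Bochner_Integration.integral_cong[OF refl])
    fix p
    show "(\<Sum>((j, \<delta>), (k, \<delta>'))\<in>?Q \<times> ?Q. \<Sum>(m, m')\<in>whitney_starts n \<delta> \<times> whitney_starts n \<delta>'. T j k \<delta> \<delta>' m m' p)
      = G p * of_real (whitney_weight n (fst (fst p)) (fst (snd p)) * whitney_weight n (snd (fst p)) (snd (snd p)))"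
    proof -
      define u where "u q m = U (fst q) (snd q) m (fst (fst p)) (fst (snd p))" for q m
      define v where "v q m = U (fst q) (snd q) m (snd (fst p)) (snd (snd p))" for q m
      have "whitney_weight n (fst (fst p)) (fst (snd p)) * whitney_weight n (snd (fst p)) (snd (snd p))
          = (\<Sum>(q, q')\<in>?Q \<times> ?Q. (\<Sum>m\<in>whitney_starts n (snd q). u q m) * (\<Sum>m\<in>whitney_starts n (snd q'). v q' m))"
        unfolding whitney_weight_def U_def[symmetric] u_def v_def
        by (simp only: sum_product sum.cartesian_product case_prod_beta')
      also have "\<dots> = (\<Sum>(q, q')\<in>?Q \<times> ?Q. \<Sum>(m, m')\<in>whitney_starts n (snd q) \<times> whitney_starts n (snd q'). u q m * v q' m')"
        by (simp only: sum_product sum.cartesian_product)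
      finally show ?thesis
        by (simp add: T_def u_def v_def sum_distrib_left case_prod_beta')
    qed
  qed
  finally show ?thesis by (simp add: G_def)
qed

text \<open>
  Almost every pair of points of the plane differs in both coordinates, and such a pair is eventually counted
  with weight \<open>1\<close>; dominated convergence applies on the product of the two frequency planes.
\<close>

lemma whitney_sum_tendsto:
  assumes \<Omega>: "fin_borel \<Omega>" "fin_borel \<Omega>'"
  shows "(\<lambda>n. whitney_sum n \<Omega> \<Omega>' z) \<longlonglongrightarrow> ext_ind \<Omega> z * ext_ind \<Omega>' z"
proof -
  define G where "G p = (phase z (fst p) * indicator \<Omega> (fst p)) * (phase z (snd p) * indicator \<Omega>' (snd p))" for p
  define w where "w n p = whitney_weight n (fst (fst p)) (fst (snd p)) * whitney_weight n (snd (fst p)) (snd (snd p))"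
    for n and p :: "(real \<times> real) \<times> (real \<times> real)"
  have int_G: "integrable (lborel \<Otimes>\<^sub>M lborel) G"
    unfolding G_def by (intro lborel_pair.integral_product_functions(1) integrable_phase_mult integrable_indicator_fin_borel \<Omega>)
  have [measurable]: "(\<lambda>p. whitney_weight n (fst p) (snd p)) \<in> borel_measurable (borel \<Otimes>\<^sub>M borel)" for n
    unfolding whitney_weight_def[abs_def] case_prod_beta' by measurable
  have [measurable]: "w n \<in> borel_measurable (lborel \<Otimes>\<^sub>M lborel)" for n
  proof -
    have "(\<lambda>p. whitney_weight n (fst (f p)) (snd (f p))) \<in> borel_measurable (lborel \<Otimes>\<^sub>M lborel)"
      if [measurable]: "f \<in> lborel \<Otimes>\<^sub>M lborel \<rightarrow>\<^sub>M borel \<Otimes>\<^sub>M borel" for f :: "(real \<times> real) \<times> (real \<times> real) \<Rightarrow> real \<times> real"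
      by measurable
    from this[of "\<lambda>p. (fst (fst p), fst (snd p))"] this[of "\<lambda>p. (snd (fst p), snd (snd p))"]
    show ?thesis unfolding w_def[abs_def] by simp
  qed
  have [measurable]: "G \<in> borel_measurable (lborel \<Otimes>\<^sub>M lborel)" using int_G by simp
  have "(\<lambda>n. \<integral>p. G p * of_real (w n p) \<partial>(lborel \<Otimes>\<^sub>M lborel)) \<longlonglongrightarrow> (\<integral>p. G p \<partial>(lborel \<Otimes>\<^sub>M lborel))"
  proof (rule integral_dominated_convergence[where w="\<lambda>p. norm (G p)"])
    show "AE p in lborel \<Otimes>\<^sub>M lborel. (\<lambda>n. G p * of_real (w n p)) \<longlonglongrightarrow> G p"
      using AE_distinct_coordinates
    proof eventually_elim
      case (elim p)
      have "(\<lambda>n. G p * of_real (w n p)) \<longlonglongrightarrow> G p * of_real (1 * 1)"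
        unfolding w_def using elim by (intro tendsto_intros whitney_weight_tendsto) auto
      then show ?case by simp
    qed
    show "AE p in lborel \<Otimes>\<^sub>M lborel. norm (G p * of_real (w n p)) \<le> norm (G p)" for n
    proof (rule AE_I2)
      fix p
      have "\<bar>w n p\<bar> \<le> 1 * 1"
        unfolding w_def abs_mult using whitney_weight_le_1 by (intro mult_mono) auto
      then show "norm (G p * of_real (w n p)) \<le> norm (G p)"
        by (simp add: norm_mult mult_left_le)
    qed
  qed (use int_G in auto)
  moreover have "(\<integral>p. G p \<partial>(lborel \<Otimes>\<^sub>M lborel)) = ext_ind \<Omega> z * ext_ind \<Omega>' z"
    unfolding G_def by (intro extension_op_mult[symmetric] integrable_indicator_fin_borel \<Omega>)
  ultimately show ?thesis
    by (simp add: whitney_sum_eq_integral[OF \<Omega>] G_def w_def)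
qed

section \<open>Sets of constant fibre length\<close>

text \<open>
  Half of the decay is spent on the distance of the two centres, and the other half makes the sum converge.
\<close>

lemma sum_powr_two_centres_le:
  assumes e: "0 < e" and S: "finite (S :: int set)"
  shows "(\<Sum>k\<in>S. 2 powr (- 2 * e * (\<bar>real_of_int k - real_of_int K\<bar> + \<bar>real_of_int k - real_of_int K'\<bar>)))
    \<le> 2 powr (- e * \<bar>real_of_int K - real_of_int K'\<bar>) * geo_const e"
proof -
  have "2 powr (- 2 * e * (\<bar>real_of_int k - real_of_int K\<bar> + \<bar>real_of_int k - real_of_int K'\<bar>))
      \<le> 2 powr (- e * \<bar>real_of_int K - real_of_int K'\<bar>) * 2 powr (- e * \<bar>of_int k - real_of_int K\<bar>)" for k
  proof -
    have "\<bar>real_of_int K - real_of_int K'\<bar> + \<bar>real_of_int k - real_of_int K\<bar>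
        \<le> 2 * (\<bar>real_of_int k - real_of_int K\<bar> + \<bar>real_of_int k - real_of_int K'\<bar>)"
      by (smt (verit))
    from mult_left_mono[OF this, of e] e
    show ?thesis unfolding powr_add[symmetric] by (intro powr_mono) (simp_all add: algebra_simps)
  qed
  then have "(\<Sum>k\<in>S. 2 powr (- 2 * e * (\<bar>real_of_int k - real_of_int K\<bar> + \<bar>real_of_int k - real_of_int K'\<bar>)))
    \<le> (\<Sum>k\<in>S. 2 powr (- e * \<bar>real_of_int K - real_of_int K'\<bar>) * 2 powr (- e * \<bar>of_int k - real_of_int K\<bar>))"
    by (rule sum_mono)
  also have "\<dots> \<le> 2 powr (- e * \<bar>real_of_int K - real_of_int K'\<bar>) * geo_const e"
    unfolding sum_distrib_left[symmetric] by (intro mult_left_mono sum_powr_dist_le e S) auto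
  finally show ?thesis .
qed

context bilinear_extension_estimate
begin

definition pair_const :: real where
  "pair_const = 16 * tile_const * 4 powr (\<alpha> + \<gamma>) * (geo_const \<epsilon>)\<^sup>2"

lemma pair_const_nonneg: "0 \<le> pair_const"
  unfolding pair_const_def using tile_const_nonneg by simp

text \<open>
  Summing the tile bounds over all shapes gives a finite factor from the horizontal scales and the decay in
  \<open>\<bar>K - K'\<bar>\<close> from the vertical ones; there are \<open>16\<close> pairs of offsets.
\<close>

lemma bilinear_dominated:
  assumes dom: "box_dominated J K \<Omega>" "box_dominated J' K' \<Omega>'"
  shows "Lq_le lborel s (\<lambda>z. ext_ind \<Omega> z * ext_ind \<Omega>' z)
    (pair_const * (measure lborel \<Omega> * measure lborel \<Omega>') powr (1 - 1 / s) * 2 powr (- \<epsilon> * \<bar>real_of_int K - real_of_int K'\<bar>))"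
proof (rule Lq_le_AE_limit)
  have \<Omega>: "fin_borel \<Omega>" "fin_borel \<Omega>'" using dom by (auto simp: box_dominated_def)
  show "AE z in lborel. (\<lambda>n. whitney_sum n \<Omega> \<Omega>' z) \<longlonglongrightarrow> ext_ind \<Omega> z * ext_ind \<Omega>' z"
    by (intro AE_I2 whitney_sum_tendsto \<Omega>)
  show "(\<lambda>z. ext_ind \<Omega> z * ext_ind \<Omega>' z) \<in> borel_measurable lborel"
    using \<Omega> by (auto intro!: borel_measurable_times borel_measurable_ext_ind)
  show "0 < s" using s_gt by simp
  fix n
  let ?N = "{- int n..int n}"
  define T where "T = tile_const * 4 powr (\<alpha> + \<gamma>) * (measure lborel \<Omega> * measure lborel \<Omega>') powr (1 - 1 / s)"
  define a where "a j = 2 powr (- 2 * \<epsilon> * (\<bar>real_of_int j - real_of_int J\<bar> + \<bar>real_of_int j - real_of_int J'\<bar>))" for j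
  define b where "b k = 2 powr (- 2 * \<epsilon> * (\<bar>real_of_int k - real_of_int K\<bar> + \<bar>real_of_int k - real_of_int K'\<bar>))" for k
  have T0: "0 \<le> T" unfolding T_def using tile_const_nonneg by simp
  have g0: "0 < geo_const \<epsilon>" by (rule geo_const_pos[OF \<epsilon>_pos])
  have "Lq_le lborel s (whitney_sum n \<Omega> \<Omega>')
     (\<Sum>q\<in>(?N \<times> whitney_offsets) \<times> (?N \<times> whitney_offsets). T * (a (fst (fst q)) * b (fst (snd q))))"
    unfolding whitney_sum_def[abs_def] case_prod_beta'
    using tile_sum_dominated[OF _ _ finite_whitney(1) finite_whitney(1) dom, unfolded case_prod_beta'] s_gt
    by (intro Lq_le_sum) (auto simp: T_def a_def b_def)
  moreover have "(\<Sum>q\<in>(?N \<times> whitney_offsets) \<times> (?N \<times> whitney_offsets). T * (a (fst (fst q)) * b (fst (snd q))))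
     = 16 * T * ((\<Sum>j\<in>?N. a j) * (\<Sum>k\<in>?N. b k))"
  proof -
    have "(\<Sum>q\<in>(?N \<times> whitney_offsets) \<times> (?N \<times> whitney_offsets). T * (a (fst (fst q)) * b (fst (snd q))))
      = T * ((\<Sum>q\<in>?N \<times> whitney_offsets. a (fst q)) * (\<Sum>q\<in>?N \<times> whitney_offsets. b (fst q)))"
      unfolding sum_product sum.cartesian_product case_prod_beta' by (simp only: sum_distrib_left)
    moreover have "(\<Sum>q\<in>?N \<times> whitney_offsets. c (fst q)) = 4 * (\<Sum>j\<in>?N. c j)" for c :: "int \<Rightarrow> real"
    proof -
      have "(\<Sum>q\<in>?N \<times> whitney_offsets. c (fst q)) = (\<Sum>j\<in>?N. \<Sum>\<delta>\<in>whitney_offsets. c j)"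
        by (simp only: sum.cartesian_product case_prod_beta')
      then show ?thesis by (simp add: whitney_offsets_def sum_distrib_left)
    qed
    ultimately show ?thesis by simp
  qed
  moreover have "(\<Sum>j\<in>?N. a j) * (\<Sum>k\<in>?N. b k) \<le> geo_const \<epsilon> * (2 powr (- \<epsilon> * \<bar>real_of_int K - real_of_int K'\<bar>) * geo_const \<epsilon>)"
  proof (rule mult_mono)
    have "(\<Sum>j\<in>?N. a j) \<le> 2 powr (- \<epsilon> * \<bar>real_of_int J - real_of_int J'\<bar>) * geo_const \<epsilon>"
      unfolding a_def by (rule sum_powr_two_centres_le[OF \<epsilon>_pos]) simp
    also have "2 powr (- \<epsilon> * \<bar>real_of_int J - real_of_int J'\<bar>) \<le> 2 powr 0"
      using \<epsilon>_pos by (intro powr_mono) auto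
    finally show "(\<Sum>j\<in>?N. a j) \<le> geo_const \<epsilon>" using g0 by simp
    show "(\<Sum>k\<in>?N. b k) \<le> 2 powr (- \<epsilon> * \<bar>real_of_int K - real_of_int K'\<bar>) * geo_const \<epsilon>"
      unfolding b_def by (rule sum_powr_two_centres_le[OF \<epsilon>_pos]) simp
  qed (use g0 in \<open>auto simp: b_def intro!: sum_nonneg\<close>)
  ultimately show "Lq_le lborel s (whitney_sum n \<Omega> \<Omega>')
    (pair_const * (measure lborel \<Omega> * measure lborel \<Omega>') powr (1 - 1 / s) * 2 powr (- \<epsilon> * \<bar>real_of_int K - real_of_int K'\<bar>))"
    using s_gt T0
    by (auto elim!: Lq_le_mono_bound dest: mult_left_mono[where c="16 * T"] simp: T_def pair_const_def power2_eq_square mult_ac)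
qed

end

definition fibre_length :: "(real \<times> real) set \<Rightarrow> real \<Rightarrow> ennreal" where
  "fibre_length A x = emeasure lborel {y. (x, y) \<in> A}"

definition fibre_slice :: "(real \<times> real) set \<Rightarrow> int \<Rightarrow> (real \<times> real) set" where
  "fibre_slice \<Omega> K = {\<xi> \<in> \<Omega>. ennreal (2 powr K) \<le> fibre_length \<Omega> (fst \<xi>) \<and> fibre_length \<Omega> (fst \<xi>) < ennreal (2 powr (K + 1))}"

lemma borel_measurable_fibre_length [measurable]:
  assumes "A \<in> sets borel"
  shows "fibre_length A \<in> borel_measurable borel"
proof -
  have "A \<in> sets (lborel \<Otimes>\<^sub>M lborel)" using assms unfolding lborel_prod by simp
  from lborel.measurable_emeasure_Pair[OF this] show ?thesis
    by (simp add: fibre_length_def[abs_def] vimage_def)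
qed

lemma emeasure_eq_fibre_length:
  assumes "A \<in> sets borel"
  shows "emeasure lborel A = (\<integral>\<^sup>+x. fibre_length A x \<partial>lborel)"
proof -
  have "A \<in> sets (lborel \<Otimes>\<^sub>M lborel)" using assms unfolding lborel_prod by simp
  from lborel.emeasure_pair_measure_alt[OF this] show ?thesis
    unfolding lborel_prod by (simp add: fibre_length_def vimage_def)
qed

lemma fin_borel_fibre_slice:
  assumes \<Omega>: "fin_borel \<Omega>"
  shows "fin_borel (fibre_slice \<Omega> K)"
proof -
  note [measurable] = fin_borelD[OF \<Omega>]
  have "fibre_slice \<Omega> K = \<Omega> \<inter> {\<xi>. ennreal (2 powr K) \<le> fibre_length \<Omega> (fst \<xi>) \<and> fibre_length \<Omega> (fst \<xi>) < ennreal (2 powr (K + 1))}"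
    by (auto simp: fibre_slice_def)
  moreover have "{\<xi> :: real \<times> real. ennreal (2 powr K) \<le> fibre_length \<Omega> (fst \<xi>) \<and> fibre_length \<Omega> (fst \<xi>) < ennreal (2 powr (K + 1))} \<in> sets borel"
    by measurable
  ultimately show ?thesis using fin_borel_Int[OF \<Omega>] by simp
qed

lemma emeasure_floor_cell:
  assumes "0 < h"
  shows "emeasure lborel {y :: real. \<lfloor>y / h\<rfloor> = n} = ennreal h"
proof -
  have "{y :: real. \<lfloor>y / h\<rfloor> = n} = {of_int n * h..<(of_int n + 1) * h}"
    using assms by (auto simp: floor_eq_iff field_simps)
  then show ?thesis using assms by (simp add: algebra_simps)
qed

lemma min_double_le: "0 \<le> (a::real) \<Longrightarrow> 0 \<le> b \<Longrightarrow> c \<le> 2 * b \<Longrightarrow> min a c \<le> 2 * min a b"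
  by (auto simp: min_def)

text \<open>
  If the base of the slice has length \<open>p\<close> then the slice has measure at least \<open>p\<close> times \<open>2 powr K\<close>, and a
  tile contains at most the shorter of its height and \<open>2 powr (K + 1)\<close> over the shorter of its width and
  \<open>p\<close>. Rounding \<open>p\<close> down to \<open>2 powr J\<close> costs another factor \<open>2\<close>.
\<close>

lemma fibre_slice_box_dominated:
  assumes \<Omega>: "fin_borel \<Omega>" and pos: "0 < measure lborel (fibre_slice \<Omega> K)"
  obtains J where "box_dominated J K (fibre_slice \<Omega> K)"
proof -
  let ?S = "fibre_slice \<Omega> K"
  note [measurable] = fin_borelD[OF \<Omega>]
  have S: "fin_borel ?S" by (rule fin_borel_fibre_slice[OF \<Omega>])
  note [measurable] = fin_borelD[OF S]
  define V where "V = {x. ennreal (2 powr K) \<le> fibre_length \<Omega> x \<and> fibre_length \<Omega> x < ennreal (2 powr (K + 1))}"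
  have V[measurable]: "V \<in> sets borel" unfolding V_def by measurable
  have fib: "fibre_length ?S x = indicator V x * fibre_length \<Omega> x" for x
    by (auto simp: fibre_length_def fibre_slice_def V_def indicator_def)
  have "ennreal (2 powr K) * emeasure lborel V = (\<integral>\<^sup>+x. ennreal (2 powr K) * indicator V x \<partial>lborel)"
    by (simp add: nn_integral_cmult)
  also have "\<dots> \<le> emeasure lborel ?S"
    unfolding emeasure_eq_fibre_length[OF fin_borelD[OF S]] fib
    by (intro nn_integral_mono) (auto simp: V_def split: split_indicator)
  finally have low: "ennreal (2 powr K) * emeasure lborel V \<le> emeasure lborel ?S" .
  have fin: "emeasure lborel V < \<infinity>"
  proof (rule ccontr)
    assume "\<not> emeasure lborel V < \<infinity>"
    then have "emeasure lborel V = \<infinity>" by (simp add: less_top[symmetric])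
    then show False using low S by (simp add: ennreal_mult_top top_unique fin_borel_def)
  qed
  define p where "p = measure lborel V"
  have ep: "emeasure lborel V = ennreal p"
    unfolding p_def using fin by (intro emeasure_eq_ennreal_measure) auto
  have eS: "emeasure lborel ?S = ennreal (measure lborel ?S)"
    using S by (intro emeasure_eq_ennreal_measure) (auto simp: fin_borel_def)
  have p_pos: "0 < p"
  proof (rule ccontr)
    assume "\<not> 0 < p"
    then have "p = 0" using measure_nonneg[of lborel V] by (simp add: p_def)
    then have "emeasure lborel V = 0" using ep by simp
    then have "AE x in lborel. x \<notin> V" by (intro AE_not_in) (auto simp: null_sets_def)
    then have "AE x in lborel. fibre_length ?S x = 0" by eventually_elim (simp add: fib)
    then have "emeasure lborel ?S = 0"
      unfolding emeasure_eq_fibre_length[OF fin_borelD[OF S]]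
      by (subst nn_integral_0_iff_AE) auto
    then show False using pos by (simp add: measure_def)
  qed
  define J where "J = \<lfloor>log 2 p\<rfloor>"
  have J: "2 powr J \<le> p" "p < 2 powr (J + 1)"
    using p_pos by (simp_all add: le_log_iff[symmetric] log_less_iff[symmetric] J_def)
  have "2 powr J * 2 powr K \<le> measure lborel ?S"
  proof -
    have "2 powr K * p \<le> measure lborel ?S"
      using low p_pos unfolding ep eS by (simp add: ennreal_mult'[symmetric])
    moreover have "2 powr J * 2 powr K \<le> 2 powr K * p"
      using J by (simp add: mult.commute)
    ultimately show ?thesis by linarith
  qed
  moreover have "measure lborel (?S \<inter> tile (2 powr j) (2 powr k) m n) \<le> 4 * min (2 powr j) (2 powr J) * min (2 powr k) (2 powr K)"
    for j k m n :: int
  proof -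
    let ?h = "2 powr j :: real" and ?h' = "2 powr k :: real"
    let ?X = "{x :: real. \<lfloor>x / ?h\<rfloor> = m}"
    have [measurable]: "?X \<in> sets borel" by measurable
    have fib_le: "fibre_length (?S \<inter> tile ?h ?h' m n) x \<le> ennreal (min ?h' (2 powr (K + 1))) * indicator (?X \<inter> V) x" for x
    proof (cases "x \<in> ?X \<inter> V")
      case True
      have "fibre_length (?S \<inter> tile ?h ?h' m n) x \<le> emeasure lborel {y :: real. \<lfloor>y / ?h'\<rfloor> = n}"
        unfolding fibre_length_def by (intro emeasure_mono) (auto simp: tile_def)
      moreover have "fibre_length (?S \<inter> tile ?h ?h' m n) x \<le> fibre_length \<Omega> x"
        unfolding fibre_length_def using fin_borelD[OF \<Omega>]
        by (intro emeasure_mono) (auto simp: fibre_slice_def intro: measurable_sets_borel[of "Pair x" borel, unfolded vimage_def])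
      moreover have "fibre_length \<Omega> x \<le> ennreal (2 powr (K + 1))" using True by (auto simp: V_def)
      ultimately show ?thesis using True
        by (auto simp: emeasure_floor_cell min_def intro: order_trans)
    next
      case False
      then have "{y. (x, y) \<in> ?S \<inter> tile ?h ?h' m n} = {}" by (auto simp: fibre_slice_def tile_def V_def)
      then show ?thesis unfolding fibre_length_def by (simp only: emeasure_empty) simp
    qed
    have "emeasure lborel (?S \<inter> tile ?h ?h' m n) \<le> (\<integral>\<^sup>+x. ennreal (min ?h' (2 powr (K + 1))) * indicator (?X \<inter> V) x \<partial>lborel)"
      by (subst emeasure_eq_fibre_length, measurable) (intro nn_integral_mono fib_le)
    also have "\<dots> = ennreal (min ?h' (2 powr (K + 1))) * emeasure lborel (?X \<inter> V)"
      by (subst nn_integral_cmult_indicator) auto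
    also have "\<dots> \<le> ennreal (min ?h' (2 powr (K + 1))) * ennreal (min ?h p)"
    proof (rule mult_left_mono)
      have "emeasure lborel (?X \<inter> V) \<le> ennreal ?h" "emeasure lborel (?X \<inter> V) \<le> ennreal p"
        using emeasure_mono[of "?X \<inter> V" ?X lborel] emeasure_mono[of "?X \<inter> V" V lborel]
        by (auto simp: emeasure_floor_cell ep)
      then show "emeasure lborel (?X \<inter> V) \<le> ennreal (min ?h p)" by (auto simp: min_def)
    qed simp
    also have "\<dots> \<le> ennreal ((2 * min ?h' (2 powr K)) * (2 * min ?h (2 powr J)))"
    proof -
      have "min ?h' (2 powr (K + 1)) \<le> 2 * min ?h' (2 powr K)"
        by (intro min_double_le) (auto simp: powr_add)
      moreover have "min ?h p \<le> 2 * min ?h (2 powr J)"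
        using J by (intro min_double_le) (auto simp: powr_add)
      ultimately have "min ?h' (2 powr (K + 1)) * min ?h p \<le> (2 * min ?h' (2 powr K)) * (2 * min ?h (2 powr J))"
        using p_pos by (intro mult_mono) auto
      then show ?thesis
        using p_pos by (subst ennreal_mult'[symmetric]) (auto intro: ennreal_leI)
    qed
    finally have "measure lborel (?S \<inter> tile ?h ?h' m n) \<le> (2 * min ?h' (2 powr K)) * (2 * min ?h (2 powr J))"
      unfolding measure_def by (rule enn2real_leI[rotated]) auto
    then show ?thesis by (simp add: mult_ac)
  qed
  ultimately have "box_dominated J K ?S" using S by (auto simp: box_dominated_def)
  then show thesis by (rule that)
qed

section \<open>Recombining the fibre lengths\<close>

lemma powr_add_le_subadditive:
  fixes x y \<theta> :: real
  assumes "0 \<le> x" "0 \<le> y" "0 < \<theta>" "\<theta> \<le> 1"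
  shows "(x + y) powr \<theta> \<le> x powr \<theta> + y powr \<theta>"
proof (cases "x + y = 0")
  case False
  then have xy: "0 < x + y" using assms by auto
  have part: "z / (x + y) \<le> (z / (x + y)) powr \<theta>" if "0 \<le> z" "z \<le> x + y" for z
  proof (cases "z = 0")
    case False
    then have "(z / (x + y)) powr 1 \<le> (z / (x + y)) powr \<theta>"
      using that xy assms by (intro powr_mono') (auto simp: divide_le_eq_1)
    then show ?thesis using that xy by simp
  qed simp
  have "1 = x / (x + y) + y / (x + y)" using xy by (simp flip: add_divide_distrib)
  also have "\<dots> \<le> (x / (x + y)) powr \<theta> + (y / (x + y)) powr \<theta>"
    using assms by (intro add_mono part) auto
  also have "\<dots> = (x powr \<theta> + y powr \<theta>) / (x + y) powr \<theta>"
    using assms xy by (simp add: powr_divide add_divide_distrib)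
  finally show ?thesis using xy by (simp add: le_divide_eq)
qed (use assms in auto)

lemma powr_sum_le_sum_powr:
  fixes x :: "'a \<Rightarrow> real"
  assumes "finite I" "\<And>i. i \<in> I \<Longrightarrow> 0 \<le> x i" "0 < \<theta>" "\<theta> \<le> 1"
  shows "(\<Sum>i\<in>I. x i) powr \<theta> \<le> (\<Sum>i\<in>I. x i powr \<theta>)"
  using assms(1,2)
proof (induction I rule: finite_induct)
  case (insert i I)
  have "(x i + (\<Sum>i\<in>I. x i)) powr \<theta> \<le> x i powr \<theta> + (\<Sum>i\<in>I. x i) powr \<theta>"
    using insert assms by (intro powr_add_le_subadditive) (auto intro!: sum_nonneg)
  then show ?case using insert by force
qed simp

text \<open>
  After the inequality of the arithmetic and geometric means, a single index carries the fourth power and the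
  other three are summed along the tree formed by the weights.
\<close>

lemma quadruple_sum_le:
  fixes w :: "'a \<Rightarrow> 'a \<Rightarrow> real" and y :: "'a \<Rightarrow> real"
  assumes w0: "\<And>a b. 0 \<le> w a b" and sym: "\<And>a b. w a b = w b a"
    and W: "\<And>a. (\<Sum>b\<in>S. w a b) \<le> W" and y0: "\<And>a. 0 \<le> y a"
  shows "(\<Sum>a\<in>S. \<Sum>b\<in>S. \<Sum>c\<in>S. \<Sum>d\<in>S. y a * y b * y c * y d * (w a b * w a c * w b d)) \<le> W ^ 3 * (\<Sum>a\<in>S. y a ^ 4)"
proof -
  have W0: "0 \<le> W" using W[of undefined] sum_nonneg[of S "w undefined"] w0 by fastforce
  have inner: "(\<Sum>b\<in>S. g * w a b) \<le> g * W" if "0 \<le> g" for g a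
    unfolding sum_distrib_left[symmetric] using W[of a] that by (rule mult_left_mono)
  have amgm: "y a * y b * y c * y d \<le> (y a ^ 4 + y b ^ 4 + y c ^ 4 + y d ^ 4) / 4" for a b c d
  proof -
    have "y a * y b \<le> ((y a)\<^sup>2 + (y b)\<^sup>2) / 2" "y c * y d \<le> ((y c)\<^sup>2 + (y d)\<^sup>2) / 2"
      using sum_squares_bound[of "y a" "y b"] sum_squares_bound[of "y c" "y d"] by auto
    then have "(y a * y b) * (y c * y d) \<le> (((y a)\<^sup>2 + (y b)\<^sup>2) / 2) * (((y c)\<^sup>2 + (y d)\<^sup>2) / 2)"
      using y0 by (intro mult_mono) auto
    also have "\<dots> \<le> (y a ^ 4 + y b ^ 4 + y c ^ 4 + y d ^ 4) / 4"
    proof -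
      define p q where "p = (y a)\<^sup>2 + (y b)\<^sup>2" and "q = (y c)\<^sup>2 + (y d)\<^sup>2"
      have "p * q \<le> (p\<^sup>2 + q\<^sup>2) / 2" using sum_squares_bound[of p q] by auto
      moreover have "p\<^sup>2 \<le> 2 * (y a ^ 4 + y b ^ 4)" "q\<^sup>2 \<le> 2 * (y c ^ 4 + y d ^ 4)"
        using sum_squares_bound[of "(y a)\<^sup>2" "(y b)\<^sup>2"] sum_squares_bound[of "(y c)\<^sup>2" "(y d)\<^sup>2"]
        by (simp_all add: p_def q_def power2_sum)
      ultimately show ?thesis by (simp add: p_def q_def)
    qed
    finally show ?thesis by (simp add: mult.assoc)
  qed
  let ?w = "\<lambda>a b c d. w a b * w a c * w b d"
  have A: "(\<Sum>a\<in>S. \<Sum>b\<in>S. \<Sum>c\<in>S. \<Sum>d\<in>S. y a ^ 4 * ?w a b c d) \<le> W ^ 3 * (\<Sum>a\<in>S. y a ^ 4)"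
  proof -
    have "(\<Sum>a\<in>S. \<Sum>b\<in>S. \<Sum>c\<in>S. \<Sum>d\<in>S. y a ^ 4 * ?w a b c d)
      = (\<Sum>a\<in>S. \<Sum>b\<in>S. \<Sum>c\<in>S. \<Sum>d\<in>S. (y a ^ 4 * w a b * w a c) * w b d)" by (simp add: mult_ac)
    also have "\<dots> \<le> (\<Sum>a\<in>S. \<Sum>b\<in>S. \<Sum>c\<in>S. (y a ^ 4 * w a b * w a c) * W)"
      using w0 y0 by (intro sum_mono inner) auto
    also have "\<dots> = (\<Sum>a\<in>S. \<Sum>b\<in>S. \<Sum>c\<in>S. (y a ^ 4 * w a b * W) * w a c)" by (simp add: mult_ac)
    also have "\<dots> \<le> (\<Sum>a\<in>S. \<Sum>b\<in>S. (y a ^ 4 * w a b * W) * W)"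
      using w0 y0 W0 by (intro sum_mono inner) auto
    also have "\<dots> = (\<Sum>a\<in>S. \<Sum>b\<in>S. (y a ^ 4 * W * W) * w a b)" by (simp add: mult_ac)
    also have "\<dots> \<le> (\<Sum>a\<in>S. (y a ^ 4 * W * W) * W)"
      using y0 W0 by (intro sum_mono inner) auto
    finally show ?thesis by (simp add: sum_distrib_left power3_eq_cube mult_ac)
  qed
  have C: "(\<Sum>a\<in>S. \<Sum>b\<in>S. \<Sum>c\<in>S. \<Sum>d\<in>S. y c ^ 4 * ?w a b c d) \<le> W ^ 3 * (\<Sum>a\<in>S. y a ^ 4)"
  proof -
    have "y c ^ 4 * ?w a b c d = (y c ^ 4 * w c a * w a b) * w b d" for a b c d
      by (simp add: sym[of c a] mult_ac)
    then have "(\<Sum>a\<in>S. \<Sum>b\<in>S. \<Sum>c\<in>S. \<Sum>d\<in>S. y c ^ 4 * ?w a b c d)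
      = (\<Sum>a\<in>S. \<Sum>b\<in>S. \<Sum>c\<in>S. \<Sum>d\<in>S. (y c ^ 4 * w c a * w a b) * w b d)" by (simp only:)
    also have "\<dots> = (\<Sum>a\<in>S. \<Sum>c\<in>S. \<Sum>b\<in>S. \<Sum>d\<in>S. (y c ^ 4 * w c a * w a b) * w b d)"
      by (rule sum.cong[OF refl]) (rule sum.swap)
    also have "\<dots> = (\<Sum>c\<in>S. \<Sum>a\<in>S. \<Sum>b\<in>S. \<Sum>d\<in>S. (y c ^ 4 * w c a * w a b) * w b d)"
      by (rule sum.swap)
    also have "\<dots> \<le> (\<Sum>c\<in>S. \<Sum>a\<in>S. \<Sum>b\<in>S. (y c ^ 4 * w c a * w a b) * W)"
      using w0 y0 by (intro sum_mono inner) auto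
    also have "\<dots> = (\<Sum>c\<in>S. \<Sum>a\<in>S. \<Sum>b\<in>S. (y c ^ 4 * w c a * W) * w a b)" by (simp add: mult_ac)
    also have "\<dots> \<le> (\<Sum>c\<in>S. \<Sum>a\<in>S. (y c ^ 4 * w c a * W) * W)"
      using w0 y0 W0 by (intro sum_mono inner) auto
    also have "\<dots> = (\<Sum>c\<in>S. \<Sum>a\<in>S. (y c ^ 4 * W * W) * w c a)" by (simp add: mult_ac)
    also have "\<dots> \<le> (\<Sum>c\<in>S. (y c ^ 4 * W * W) * W)"
      using y0 W0 by (intro sum_mono inner) auto
    finally show ?thesis by (simp add: sum_distrib_left power3_eq_cube mult_ac)
  qed
  \<comment> \<open>The path \<open>d - b - a - c\<close> of the weights is symmetric under reversal.\<close>
  have flip: "(\<Sum>a\<in>S. \<Sum>b\<in>S. \<Sum>c\<in>S. \<Sum>d\<in>S. F a b c d) = (\<Sum>a\<in>S. \<Sum>b\<in>S. \<Sum>c\<in>S. \<Sum>d\<in>S. F b a d c)"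
    for F :: "'a \<Rightarrow> 'a \<Rightarrow> 'a \<Rightarrow> 'a \<Rightarrow> real"
  proof -
    have "(\<Sum>a\<in>S. \<Sum>b\<in>S. \<Sum>c\<in>S. \<Sum>d\<in>S. F a b c d) = (\<Sum>a\<in>S. \<Sum>b\<in>S. \<Sum>c\<in>S. \<Sum>d\<in>S. F a b d c)"
      by (rule sum.cong[OF refl], rule sum.cong[OF refl], rule sum.swap)
    also have "\<dots> = (\<Sum>a\<in>S. \<Sum>b\<in>S. \<Sum>c\<in>S. \<Sum>d\<in>S. F b a d c)" by (rule sum.swap)
    finally show ?thesis .
  qed
  have w_flip: "?w b a d c = ?w a b c d" for a b c d by (simp add: sym[of b a] mult_ac)
  have B: "(\<Sum>a\<in>S. \<Sum>b\<in>S. \<Sum>c\<in>S. \<Sum>d\<in>S. y b ^ 4 * ?w a b c d) \<le> W ^ 3 * (\<Sum>a\<in>S. y a ^ 4)"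
    by (subst flip) (use A in \<open>simp only: w_flip\<close>)
  have D: "(\<Sum>a\<in>S. \<Sum>b\<in>S. \<Sum>c\<in>S. \<Sum>d\<in>S. y d ^ 4 * ?w a b c d) \<le> W ^ 3 * (\<Sum>a\<in>S. y a ^ 4)"
    by (subst flip) (use C in \<open>simp only: w_flip\<close>)
  have "(\<Sum>a\<in>S. \<Sum>b\<in>S. \<Sum>c\<in>S. \<Sum>d\<in>S. y a * y b * y c * y d * ?w a b c d)
    \<le> (\<Sum>a\<in>S. \<Sum>b\<in>S. \<Sum>c\<in>S. \<Sum>d\<in>S. (y a ^ 4 + y b ^ 4 + y c ^ 4 + y d ^ 4) / 4 * ?w a b c d)"
    using w0 by (intro sum_mono mult_right_mono amgm) auto
  also have "\<dots> = ((\<Sum>a\<in>S. \<Sum>b\<in>S. \<Sum>c\<in>S. \<Sum>d\<in>S. y a ^ 4 * ?w a b c d)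
     + (\<Sum>a\<in>S. \<Sum>b\<in>S. \<Sum>c\<in>S. \<Sum>d\<in>S. y b ^ 4 * ?w a b c d)
     + (\<Sum>a\<in>S. \<Sum>b\<in>S. \<Sum>c\<in>S. \<Sum>d\<in>S. y c ^ 4 * ?w a b c d)
     + (\<Sum>a\<in>S. \<Sum>b\<in>S. \<Sum>c\<in>S. \<Sum>d\<in>S. y d ^ 4 * ?w a b c d)) / 4"
    by (simp add: distrib_right add_divide_distrib sum.distrib sum_divide_distrib)
  also have "\<dots> \<le> W ^ 3 * (\<Sum>a\<in>S. y a ^ 4)" using A B C D by simp
  finally show ?thesis .
qed

lemma ennreal_le_of_square_le:
  assumes "I\<^sup>2 \<le> ennreal (X\<^sup>2)" "0 \<le> X"
  shows "I \<le> ennreal X"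
proof (cases I)
  case (real i)
  then have "i\<^sup>2 \<le> X\<^sup>2" using assms by (simp add: ennreal_power)
  then have "i \<le> X" using assms(2) by (rule power2_le_imp_le)
  then show ?thesis using real by (simp add: ennreal_leI)
next
  case top
  then show ?thesis using assms by (simp add: top_unique)
qed

text \<open>
  Functions whose pairwise products decay behave like orthogonal ones in \<open>L\<close> with exponent \<open>2 * s\<close>. Since
  \<open>s / 2 \<le> 1\<close>, the power \<open>2 * s\<close> of the sum is at most the fourth power of the sum of the powers \<open>s / 2\<close>. In a
  term with indices \<open>a, b, c, d\<close> the Cauchy-Schwarz inequality can be used for the pairing \<open>ab, cd\<close> and for
  \<open>ac, bd\<close>; the geometric mean of the two bounds decays in all differences.
\<close>

lemma Lq_le_sum_of_bilinear_decay:
  fixes f :: "int \<Rightarrow> 'a \<Rightarrow> complex"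
  assumes s: "0 < s" "s \<le> 2" and S: "finite S" and P: "0 \<le> P" and \<eta>: "0 < \<eta>" and b: "\<And>k. 0 \<le> b k"
    and [measurable]: "\<And>k. f k \<in> borel_measurable M"
    and pair: "\<And>k l. k \<in> S \<Longrightarrow> l \<in> S \<Longrightarrow> Lq_le M s (\<lambda>x. f k x * f l x)
        (P * (b k * b l) * 2 powr (- \<eta> * \<bar>real_of_int k - real_of_int l\<bar>))"
  shows "Lq_le M (2 * s) (\<lambda>x. \<Sum>k\<in>S. f k x)
     ((P powr s * geo_const (\<eta> * s / 4) ^ 3) powr (1 / (2 * s)) * (\<Sum>k\<in>S. b k powr (2 * s)) powr (1 / (2 * s)))"
proof -
  define u where "u k x = norm (f k x) powr (s / 2)" for k x
  define y where "y k = b k powr (s / 2)" for k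
  define w where "w k l = 2 powr (- (\<eta> * s / 4) * \<bar>real_of_int l - real_of_int k\<bar>)" for k l
  define Z where "Z k l = P powr (s / 2) * (y k * y l) * (w k l)\<^sup>2" for k l
  have u0: "0 \<le> u k x" and y0: "0 \<le> y k" and w0: "0 \<le> w k l" and Z0: "0 \<le> Z k l" for k l x
    by (auto simp: u_def y_def w_def Z_def)
  have w_sym: "w k l = w l k" for k l by (simp add: w_def abs_minus_commute)
  have w1: "w k l \<le> 1" for k l
  proof -
    have "w k l \<le> 2 powr 0" unfolding w_def using \<eta> s by (intro powr_mono) (auto simp: mult_nonneg_nonneg)
    then show ?thesis by simp
  qed
  have [measurable]: "u k \<in> borel_measurable M" for k unfolding u_def[abs_def] by measurable
  have pairZ: "(\<integral>\<^sup>+x. (ennreal (u k x * u l x))\<^sup>2 \<partial>M) \<le> ennreal ((Z k l)\<^sup>2)" if "k \<in> S" "l \<in> S" for k l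
  proof -
    have half: "v powr s = v powr (s / 2) * v powr (s / 2)" for v :: real by (simp flip: powr_add)
    have "(u k x * u l x)\<^sup>2 = norm (f k x * f l x) powr s" for x
      by (simp only: u_def power2_eq_square norm_mult powr_mult half mult_ac)
    then have "(\<integral>\<^sup>+x. (ennreal (u k x * u l x))\<^sup>2 \<partial>M) = (\<integral>\<^sup>+x. ennreal (norm (f k x * f l x) powr s) \<partial>M)"
      using u0 by (simp add: ennreal_power)
    also have "\<dots> \<le> ennreal ((P * (b k * b l) * 2 powr (- \<eta> * \<bar>real_of_int k - real_of_int l\<bar>)) powr s)"
      by (rule Lq_leD(3)[OF pair[OF that]])
    also have "(P * (b k * b l) * 2 powr (- \<eta> * \<bar>real_of_int k - real_of_int l\<bar>)) powr s = (Z k l)\<^sup>2"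
    proof -
      have "(2 powr (- \<eta> * \<bar>real_of_int k - real_of_int l\<bar>)) powr (s / 2) = (w k l)\<^sup>2"
        unfolding w_def power2_eq_square powr_add[symmetric] powr_powr
        by (rule arg_cong[where f="\<lambda>x. 2 powr x"]) (simp add: abs_minus_commute)
      then show ?thesis
        unfolding half Z_def y_def using P b by (simp add: powr_mult power2_eq_square)
    qed
    finally show ?thesis .
  qed
  have quad_pair: "(\<integral>\<^sup>+x. ennreal (u a x * u b x * u c x * u d x) \<partial>M) \<le> ennreal (Z a b * Z c d)"
    if "a \<in> S" "b \<in> S" "c \<in> S" "d \<in> S" for a b c d
  proof (rule ennreal_le_of_square_le)
    have "(\<integral>\<^sup>+x. ennreal (u a x * u b x * u c x * u d x) \<partial>M)\<^sup>2
       = (\<integral>\<^sup>+x. ennreal (u a x * u b x) * ennreal (u c x * u d x) \<partial>M)\<^sup>2"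
      using u0 by (simp add: ennreal_mult'[symmetric] mult.assoc)
    also have "\<dots> \<le> (\<integral>\<^sup>+x. (ennreal (u a x * u b x))\<^sup>2 \<partial>M) * (\<integral>\<^sup>+x. (ennreal (u c x * u d x))\<^sup>2 \<partial>M)"
      by (rule Cauchy_Schwarz_nn_integral) measurable
    also have "\<dots> \<le> ennreal ((Z a b)\<^sup>2) * ennreal ((Z c d)\<^sup>2)"
      using that by (intro mult_mono pairZ) auto
    also have "\<dots> = ennreal ((Z a b * Z c d)\<^sup>2)"
      by (simp add: ennreal_mult'[symmetric] power_mult_distrib)
    finally show "(\<integral>\<^sup>+x. ennreal (u a x * u b x * u c x * u d x) \<partial>M)\<^sup>2 \<le> ennreal ((Z a b * Z c d)\<^sup>2)" .
  qed (use Z0 in auto)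
  have quad: "(\<integral>\<^sup>+x. ennreal (u a x * u b x * u c x * u d x) \<partial>M)
      \<le> ennreal (P powr s * (y a * y b * y c * y d * (w a b * w a c * w b d)))"
    if S4: "a \<in> S" "b \<in> S" "c \<in> S" "d \<in> S" for a b c d
  proof (rule ennreal_le_of_square_le)
    have "(\<integral>\<^sup>+x. ennreal (u a x * u b x * u c x * u d x) \<partial>M)\<^sup>2
       = (\<integral>\<^sup>+x. ennreal (u a x * u b x * u c x * u d x) \<partial>M) * (\<integral>\<^sup>+x. ennreal (u a x * u c x * u b x * u d x) \<partial>M)"
      by (simp add: power2_eq_square mult_ac)
    also have "\<dots> \<le> ennreal (Z a b * Z c d) * ennreal (Z a c * Z b d)"
      using S4 by (intro mult_mono quad_pair) auto
    also have "\<dots> = ennreal ((Z a b * Z c d) * (Z a c * Z b d))"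
      using Z0 by (simp add: ennreal_mult'[symmetric])
    also have "(Z a b * Z c d) * (Z a c * Z b d)
        \<le> (P powr s * (y a * y b * y c * y d * (w a b * w a c * w b d)))\<^sup>2"
    proof -
      have Ps: "P powr s = P powr (s / 2) * P powr (s / 2)" by (simp flip: powr_add)
      have "(Z a b * Z c d) * (Z a c * Z b d)
          = (P powr s * (y a * y b * y c * y d * (w a b * w a c * w b d)))\<^sup>2 * (w c d)\<^sup>2"
        unfolding Z_def Ps by (simp add: power2_eq_square mult_ac)
      \<comment> \<open>Three of the four weights form a spanning tree, which suffices for summation.\<close>
      also have "\<dots> \<le> (P powr s * (y a * y b * y c * y d * (w a b * w a c * w b d)))\<^sup>2 * 1"
        using w1[of c d] w0[of c d] by (intro mult_left_mono power_le_one) auto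
      finally show ?thesis by simp
    qed
    finally show "(\<integral>\<^sup>+x. ennreal (u a x * u b x * u c x * u d x) \<partial>M)\<^sup>2
        \<le> ennreal ((P powr s * (y a * y b * y c * y d * (w a b * w a c * w b d)))\<^sup>2)"
      by (simp add: ennreal_leI)
  qed (use y0 w0 in auto)
  have fourth: "(v powr (s / 2)) ^ 4 = v powr (2 * s)" for v :: real
  proof -
    have "v powr (2 * s) = v powr (s / 2 + s / 2 + s / 2 + s / 2)" by simp
    then show ?thesis by (simp only: powr_add power4_eq_xxxx)
  qed
  have expand: "norm (\<Sum>k\<in>S. f k x) powr (2 * s) \<le> (\<Sum>a\<in>S. \<Sum>b\<in>S. \<Sum>c\<in>S. \<Sum>d\<in>S. u a x * u b x * u c x * u d x)" for x
  proof -
    have "norm (\<Sum>k\<in>S. f k x) powr (2 * s) \<le> (\<Sum>k\<in>S. norm (f k x)) powr (2 * s)"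
      using s by (intro powr_mono2 norm_sum) auto
    also have "\<dots> = ((\<Sum>k\<in>S. norm (f k x)) powr (s / 2)) ^ 4"
      by (simp only: fourth)
    also have "\<dots> \<le> (\<Sum>k\<in>S. u k x) ^ 4"
      unfolding u_def using s S by (intro power_mono powr_sum_le_sum_powr) auto
    also have "\<dots> = (\<Sum>a\<in>S. \<Sum>b\<in>S. \<Sum>c\<in>S. \<Sum>d\<in>S. u a x * u b x * u c x * u d x)"
      by (simp add: eval_nat_numeral sum_distrib_left sum_distrib_right mult_ac)
    finally show ?thesis .
  qed
  have e: "0 < \<eta> * s / 4" using \<eta> s by simp
  have "(\<integral>\<^sup>+x. ennreal (norm (\<Sum>k\<in>S. f k x) powr (2 * s)) \<partial>M)
     \<le> (\<integral>\<^sup>+x. (\<Sum>a\<in>S. \<Sum>b\<in>S. \<Sum>c\<in>S. \<Sum>d\<in>S. ennreal (u a x * u b x * u c x * u d x)) \<partial>M)"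
    using expand u0 by (intro nn_integral_mono) (simp add: sum_ennreal sum_nonneg ennreal_leI)
  also have "\<dots> = (\<Sum>a\<in>S. \<Sum>b\<in>S. \<Sum>c\<in>S. \<Sum>d\<in>S. \<integral>\<^sup>+x. ennreal (u a x * u b x * u c x * u d x) \<partial>M)"
    by (simp add: nn_integral_sum)
  also have "\<dots> \<le> (\<Sum>a\<in>S. \<Sum>b\<in>S. \<Sum>c\<in>S. \<Sum>d\<in>S. ennreal (P powr s * (y a * y b * y c * y d * (w a b * w a c * w b d))))"
    by (intro sum_mono quad)
  also have "\<dots> = ennreal (P powr s * (\<Sum>a\<in>S. \<Sum>b\<in>S. \<Sum>c\<in>S. \<Sum>d\<in>S. y a * y b * y c * y d * (w a b * w a c * w b d)))"
    using y0 w0 by (simp add: sum_ennreal sum_nonneg sum_distrib_left)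
  also have "\<dots> \<le> ennreal (P powr s * (geo_const (\<eta> * s / 4) ^ 3 * (\<Sum>k\<in>S. y k ^ 4)))"
  proof (intro ennreal_leI mult_left_mono quadruple_sum_le w0 y0 w_sym)
    show "(\<Sum>l\<in>S. w k l) \<le> geo_const (\<eta> * s / 4)" for k
      unfolding w_def by (rule sum_powr_dist_le[OF e S])
  qed simp
  also have "P powr s * (geo_const (\<eta> * s / 4) ^ 3 * (\<Sum>k\<in>S. y k ^ 4))
     = ((P powr s * geo_const (\<eta> * s / 4) ^ 3) powr (1 / (2 * s)) * (\<Sum>k\<in>S. b k powr (2 * s)) powr (1 / (2 * s))) powr (2 * s)"
  proof -
    have "y k ^ 4 = b k powr (2 * s)" for k by (simp only: y_def fourth)
    moreover have "0 \<le> (\<Sum>k\<in>S. b k powr (2 * s))" by (intro sum_nonneg) auto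
    moreover have "\<bar>geo_const (\<eta> * s / 4)\<bar> = geo_const (\<eta> * s / 4)" using geo_const_pos[OF e] by simp
    ultimately show ?thesis using s by (simp add: powr_mult powr_powr power_abs)
  qed
  finally show ?thesis by (auto simp: Lq_le_def)
qed

lemma fibre_slices_disjoint:
  assumes "K \<noteq> L"
  shows "fibre_slice \<Omega> K \<inter> fibre_slice \<Omega> L = {}"
proof -
  have "False" if "\<xi> \<in> fibre_slice \<Omega> K" "\<xi> \<in> fibre_slice \<Omega> L" "K < L" for \<xi> K L
  proof -
    have "ennreal (2 powr L) < ennreal (2 powr (K + 1))"
      using that by (auto simp: fibre_slice_def)
    then have "2 powr L < 2 powr (real_of_int K + 1)" by (simp add: ennreal_less_iff)
    then show False using that(3) by simp
  qed
  then show ?thesis using assms by (metis disjoint_iff linorder_neqE)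
qed

text \<open>
  The exceptional points lie on fibres of length \<open>0\<close>, which contribute nothing, or on fibres of infinite
  length, whose base is a null set because \<open>\<Omega>\<close> has finite measure.
\<close>

lemma fibre_slices_cover:
  assumes \<Omega>: "fin_borel \<Omega>"
  shows "AE \<xi> in lborel. \<xi> \<in> \<Omega> \<longrightarrow> (\<exists>K. \<xi> \<in> fibre_slice \<Omega> K)"
proof -
  note [measurable] = fin_borelD[OF \<Omega>]
  define N where "N = {\<xi> \<in> \<Omega>. fibre_length \<Omega> (fst \<xi>) = 0 \<or> fibre_length \<Omega> (fst \<xi>) = \<infinity>}"
  have "N = \<Omega> \<inter> {\<xi>. fibre_length \<Omega> (fst \<xi>) = 0 \<or> fibre_length \<Omega> (fst \<xi>) = \<infinity>}" by (auto simp: N_def)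
  moreover have "{\<xi> :: real \<times> real. fibre_length \<Omega> (fst \<xi>) = 0 \<or> fibre_length \<Omega> (fst \<xi>) = \<infinity>} \<in> sets borel"
    by measurable
  ultimately have N[measurable]: "N \<in> sets borel" by simp
  have "(\<integral>\<^sup>+x. fibre_length \<Omega> x \<partial>lborel) \<noteq> \<infinity>"
    using \<Omega> emeasure_eq_fibre_length[of \<Omega>] by (auto simp: fin_borel_def)
  then have "AE x in lborel. fibre_length \<Omega> x \<noteq> \<infinity>"
    by (intro nn_integral_PInf_AE) auto
  then have "AE x in lborel. fibre_length N x = 0"
  proof eventually_elim
    case (elim x)
    show ?case
    proof (cases "fibre_length \<Omega> x = 0")
      case True
      then have "{y. (x, y) \<in> N} = {y. (x, y) \<in> \<Omega>}" by (auto simp: N_def)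
      then show ?thesis using True by (simp add: fibre_length_def)
    next
      case False
      then have "{y. (x, y) \<in> N} = {}" using elim by (auto simp: N_def)
      then show ?thesis unfolding fibre_length_def by (simp only: emeasure_empty)
    qed
  qed
  then have "emeasure lborel N = 0"
    unfolding emeasure_eq_fibre_length[OF N] by (subst nn_integral_0_iff_AE) auto
  then have "AE \<xi> in lborel. \<xi> \<notin> N" by (intro AE_not_in) (auto simp: null_sets_def)
  then show ?thesis
  proof eventually_elim
    case (elim \<xi>)
    show ?case
    proof
      assume \<xi>: "\<xi> \<in> \<Omega>"
      then have "fibre_length \<Omega> (fst \<xi>) \<noteq> 0" "fibre_length \<Omega> (fst \<xi>) \<noteq> \<infinity>" using elim by (auto simp: N_def)
      then obtain l where l: "fibre_length \<Omega> (fst \<xi>) = ennreal l" "0 < l"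
        by (cases "fibre_length \<Omega> (fst \<xi>)") (auto simp: less_le)
      define K where "K = \<lfloor>log 2 l\<rfloor>"
      have "2 powr K \<le> l" "l < 2 powr (K + 1)"
        using l by (simp_all add: le_log_iff[symmetric] log_less_iff[symmetric] K_def)
      then have "\<xi> \<in> fibre_slice \<Omega> K"
        using \<xi> l by (auto simp: fibre_slice_def ennreal_less_iff intro: ennreal_leI)
      then show "\<exists>K. \<xi> \<in> fibre_slice \<Omega> K" ..
    qed
  qed
qed

lemma extension_op_tendsto:
  assumes w: "integrable lborel w" and [measurable]: "f \<in> borel_measurable borel" "\<And>n. F n \<in> borel_measurable borel"
    and lim: "AE \<xi> in lborel. (\<lambda>n. F n \<xi>) \<longlonglongrightarrow> f \<xi>"
    and le: "\<And>n \<xi>. norm (F n \<xi>) \<le> w \<xi>"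
  shows "(\<lambda>n. extension_op (F n) z) \<longlonglongrightarrow> extension_op f z"
proof -
  have "(\<lambda>n. \<integral>\<xi>. phase z \<xi> * F n \<xi> \<partial>lborel) \<longlonglongrightarrow> (\<integral>\<xi>. phase z \<xi> * f \<xi> \<partial>lborel)"
  proof (rule integral_dominated_convergence[OF _ _ w])
    show "AE \<xi> in lborel. (\<lambda>n. phase z \<xi> * F n \<xi>) \<longlonglongrightarrow> phase z \<xi> * f \<xi>"
      using lim by eventually_elim (intro tendsto_intros)
    show "AE \<xi> in lborel. norm (phase z \<xi> * F n \<xi>) \<le> w \<xi>" for n
      using le by (intro AE_I2) (simp add: norm_mult)
  qed measurable
  then show ?thesis by (simp add: extension_op_eq)
qed

lemma ext_ind_tendsto:
  assumes \<Omega>: "fin_borel \<Omega>" and A: "\<And>n. fin_borel (A n)" "\<And>n. A n \<subseteq> \<Omega>"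
    and lim: "AE \<xi> in lborel. \<xi> \<in> \<Omega> \<longrightarrow> (\<forall>\<^sub>F n in sequentially. \<xi> \<in> A n)"
  shows "(\<lambda>n. ext_ind (A n) z) \<longlonglongrightarrow> ext_ind \<Omega> z"
proof -
  have [measurable]: "\<Omega> \<in> sets borel" "A n \<in> sets borel" for n using \<Omega> A by (auto simp: fin_borel_def)
  show ?thesis
  proof (rule extension_op_tendsto[where w="\<lambda>\<xi>. norm (indicator \<Omega> \<xi> :: complex)"])
    show "integrable lborel (\<lambda>\<xi>. norm (indicator \<Omega> \<xi> :: complex))"
      by (intro integrable_norm integrable_indicator_fin_borel \<Omega>)
    show "AE \<xi> in lborel. (\<lambda>n. indicator (A n) \<xi> :: complex) \<longlonglongrightarrow> indicator \<Omega> \<xi>"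
      using lim
    proof eventually_elim
      case (elim \<xi>)
      show ?case
      proof (cases "\<xi> \<in> \<Omega>")
        case True
        then have "\<forall>\<^sub>F n in sequentially. (indicator (A n) \<xi> :: complex) = indicator \<Omega> \<xi>"
          using elim by (auto elim!: eventually_mono simp: indicator_def)
        then show ?thesis by (rule tendsto_eventually)
      next
        case False
        then have "\<xi> \<notin> A n" for n using A(2) by blast
        then show ?thesis using False by simp
      qed
    qed
    show "norm (indicator (A n) \<xi> :: complex) \<le> norm (indicator \<Omega> \<xi> :: complex)" for n \<xi>
      using A(2)[of n] by (auto simp: indicator_def)
  qed measurable
qed

context bilinear_extension_estimate
begin

definition restricted_const :: real where
  "restricted_const = (pair_const powr s * geo_const (\<epsilon> * s / 4) ^ 3) powr (1 / (2 * s))"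

lemma bilinear_fibre_slices:
  assumes \<Omega>: "fin_borel \<Omega>"
  shows "Lq_le lborel s (\<lambda>z. ext_ind (fibre_slice \<Omega> K) z * ext_ind (fibre_slice \<Omega> L) z)
    (pair_const * (measure lborel (fibre_slice \<Omega> K) powr (1 - 1 / s) * measure lborel (fibre_slice \<Omega> L) powr (1 - 1 / s))
      * 2 powr (- \<epsilon> * \<bar>real_of_int K - real_of_int L\<bar>))"
proof (cases "measure lborel (fibre_slice \<Omega> K) = 0 \<or> measure lborel (fibre_slice \<Omega> L) = 0")
  case True
  have "ext_ind (fibre_slice \<Omega> M) z = 0" if "measure lborel (fibre_slice \<Omega> M) = 0" for M z
    using norm_ext_ind_le[OF fin_borel_fibre_slice[OF \<Omega>], of M z] that by simp
  then have "(\<lambda>z. ext_ind (fibre_slice \<Omega> K) z * ext_ind (fibre_slice \<Omega> L) z) = (\<lambda>z. 0)"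
    using True by auto
  then show ?thesis using pair_const_nonneg s_gt by (simp add: Lq_le_def)
next
  case False
  then have pos: "0 < measure lborel (fibre_slice \<Omega> K)" "0 < measure lborel (fibre_slice \<Omega> L)"
    by (auto simp: less_le)
  obtain J where J: "box_dominated J K (fibre_slice \<Omega> K)"
    using fibre_slice_box_dominated[OF \<Omega> pos(1)] by blast
  obtain J' where J': "box_dominated J' L (fibre_slice \<Omega> L)"
    using fibre_slice_box_dominated[OF \<Omega> pos(2)] by blast
  show ?thesis
    using bilinear_dominated[OF J J'] by (simp add: powr_mult)
qed

text \<open>
  The slices have pairwise decaying products. With \<open>\<mu>\<^sub>K\<close> the measure of a slice, the norm to the power \<open>2 * s\<close> is
  therefore bounded by \<open>\<Sum>K. \<mu>\<^sub>K powr (2 * s - 2)\<close>, and since this exponent is at least \<open>1\<close> the sum is at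
  most the same power of the measure of \<open>\<Omega>\<close>.
\<close>

lemma restricted_estimate:
  assumes \<Omega>: "fin_borel \<Omega>"
  shows "Lq_le lborel (2 * s) (ext_ind \<Omega>) (restricted_const * measure lborel \<Omega> powr (1 - 1 / s))"
proof -
  define A where "A n = (\<Union>K\<in>{- int n..int n}. fibre_slice \<Omega> K)" for n
  have s: "0 < s" "s \<le> 2" using s_gt s_lt by auto
  have slice: "fin_borel (fibre_slice \<Omega> K)" "fibre_slice \<Omega> K \<subseteq> \<Omega>" for K
    using fin_borel_fibre_slice[OF \<Omega>] by (auto simp: fibre_slice_def)
  have A_sub: "A n \<subseteq> \<Omega>" for n using slice by (auto simp: A_def)
  have "A n \<in> sets borel" for n
    unfolding A_def using slice by (intro sets.finite_UN) (auto simp: fin_borel_def)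
  then have A: "fin_borel (A n)" for n
    using fin_borel_Int[OF \<Omega>, of "A n"] A_sub[of n] by (simp add: Int_absorb1)
  have ext_A: "ext_ind (A n) z = (\<Sum>K\<in>{- int n..int n}. ext_ind (fibre_slice \<Omega> K) z)" for n z
  proof -
    have "(indicator (A n) :: _ \<Rightarrow> complex) = (\<lambda>\<xi>. \<Sum>K\<in>{- int n..int n}. indicator (fibre_slice \<Omega> K) \<xi>)"
      unfolding A_def using fibre_slices_disjoint
      by (intro ext) (subst indicator_UN_disjoint, auto simp: disjoint_family_on_def)
    then show ?thesis
      by (simp add: extension_op_sum integrable_indicator_fin_borel slice)
  qed
  have bound: "Lq_le lborel (2 * s) (ext_ind (A n)) (restricted_const * measure lborel \<Omega> powr (1 - 1 / s))" for n
  proof -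
    let ?S = "{- int n..int n}"
    let ?\<mu> = "\<lambda>K. measure lborel (fibre_slice \<Omega> K)"
    have "Lq_le lborel (2 * s) (\<lambda>z. \<Sum>K\<in>?S. ext_ind (fibre_slice \<Omega> K) z)
      ((pair_const powr s * geo_const (\<epsilon> * s / 4) ^ 3) powr (1 / (2 * s)) * (\<Sum>K\<in>?S. (?\<mu> K powr (1 - 1 / s)) powr (2 * s)) powr (1 / (2 * s)))"
      by (intro Lq_le_sum_of_bilinear_decay[OF s _ pair_const_nonneg \<epsilon>_pos] bilinear_fibre_slices \<Omega>)
        (auto intro!: borel_measurable_ext_ind slice)
    moreover have "(\<Sum>K\<in>?S. (?\<mu> K powr (1 - 1 / s)) powr (2 * s)) powr (1 / (2 * s)) \<le> measure lborel \<Omega> powr (1 - 1 / s)"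
    proof -
      have e: "(1 - 1 / s) * (2 * s) = 2 * s - 2" using s by (simp add: field_simps)
      have fm: "fibre_slice \<Omega> K \<in> fmeasurable lborel" "\<Omega> \<in> fmeasurable lborel" "A n \<in> fmeasurable lborel" for K
        using slice \<Omega> A by (auto simp: fin_borel_def fmeasurable_def)
      have "(\<Sum>K\<in>?S. ?\<mu> K) = measure lborel (A n)"
        unfolding A_def using fm fibre_slices_disjoint
        by (intro measure_finite_Union[symmetric]) (auto simp: disjoint_family_on_def fmeasurable_def less_top)
      also have "\<dots> \<le> measure lborel \<Omega>"
        using A_sub fm by (intro measure_mono_fmeasurable) auto
      finally have total: "(\<Sum>K\<in>?S. ?\<mu> K) \<le> measure lborel \<Omega>" .
      have "(\<Sum>K\<in>?S. ?\<mu> K powr (2 * s - 2)) \<le> measure lborel \<Omega> powr (2 * s - 2 - 1) * measure lborel \<Omega>"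
        using s_gt fm slice total by (intro sum_powr_le_max measure_mono_fmeasurable) auto
      also have "\<dots> = measure lborel \<Omega> powr (2 * s - 2)"
        by (cases "measure lborel \<Omega> = 0") (auto simp: powr_mult_base mult.commute[of _ "measure lborel \<Omega>"] less_le)
      finally have "(\<Sum>K\<in>?S. ?\<mu> K powr (2 * s - 2)) powr (1 / (2 * s)) \<le> (measure lborel \<Omega> powr (2 * s - 2)) powr (1 / (2 * s))"
        using s by (intro powr_mono2) (auto intro!: sum_nonneg)
      also have "\<dots> = measure lborel \<Omega> powr (1 - 1 / s)"
      proof -
        have "(2 * s - 2) * (1 / (2 * s)) = 1 - 1 / s" using s by (simp add: field_simps)
        then show ?thesis unfolding powr_powr by simp
      qed
      finally show ?thesis unfolding powr_powr e .
    qed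
    ultimately show ?thesis
      unfolding ext_A[abs_def] restricted_const_def using s
      by (elim Lq_le_mono_bound) (auto intro: mult_left_mono)
  qed
  show ?thesis
  proof (rule Lq_le_AE_limit[OF bound])
    show "AE z in lborel. (\<lambda>n. ext_ind (A n) z) \<longlonglongrightarrow> ext_ind \<Omega> z"
    proof (rule AE_I2, rule ext_ind_tendsto[OF \<Omega> A A_sub])
      show "AE \<xi> in lborel. \<xi> \<in> \<Omega> \<longrightarrow> (\<forall>\<^sub>F n in sequentially. \<xi> \<in> A n)"
        using fibre_slices_cover[OF \<Omega>]
      proof eventually_elim
        case (elim \<xi>)
        show ?case
        proof
          assume "\<xi> \<in> \<Omega>"
          then obtain K where K: "\<xi> \<in> fibre_slice \<Omega> K" using elim by blast
          show "\<forall>\<^sub>F n in sequentially. \<xi> \<in> A n"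
            using eventually_ge_at_top[of "nat \<bar>K\<bar>"]
          proof eventually_elim
            case (elim n)
            then have "K \<in> {- int n..int n}" by auto
            then show ?case unfolding A_def using K by blast
          qed
        qed
      qed
    qed
  qed (use s borel_measurable_ext_ind[OF \<Omega>] in auto)
qed

end

section \<open>Interpolation with the trivial estimate\<close>

text \<open>
  Jensen's inequality for the cube. The moments \<open>x, y, z\<close> of order \<open>1, 2, 3\<close> satisfy \<open>x\<^sup>2 \<le> W y\<close> and
  \<open>y\<^sup>2 \<le> x z\<close> by the Cauchy-Schwarz inequality.
\<close>

lemma weighted_cube_le:
  fixes w v :: "'a \<Rightarrow> real"
  assumes w: "\<And>n. n \<in> S \<Longrightarrow> 0 \<le> w n" and v: "\<And>n. n \<in> S \<Longrightarrow> 0 \<le> v n" and W: "(\<Sum>n\<in>S. w n) \<le> W"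
  shows "(\<Sum>n\<in>S. w n * v n) ^ 3 \<le> W\<^sup>2 * (\<Sum>n\<in>S. w n * v n ^ 3)"
proof -
  define x y z where "x = (\<Sum>n\<in>S. w n * v n)" and "y = (\<Sum>n\<in>S. w n * (v n)\<^sup>2)" and "z = (\<Sum>n\<in>S. w n * v n ^ 3)"
  have W0: "0 \<le> W" using sum_nonneg[of S w] w W by fastforce
  have nn: "0 \<le> x" "0 \<le> y" "0 \<le> z" using w v by (auto simp: x_def y_def z_def intro!: sum_nonneg)
  have "x\<^sup>2 = (\<Sum>n\<in>S. sqrt (w n) * (sqrt (w n) * v n))\<^sup>2"
    unfolding x_def using w by (intro arg_cong[where f="\<lambda>t. t\<^sup>2"] sum.cong) (auto simp: mult.assoc[symmetric])
  also have "\<dots> \<le> (\<Sum>n\<in>S. (sqrt (w n))\<^sup>2) * (\<Sum>n\<in>S. (sqrt (w n) * v n)\<^sup>2)"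
    by (rule Cauchy_Schwarz_ineq_sum)
  also have "\<dots> = (\<Sum>n\<in>S. w n) * y"
    unfolding y_def using w by (intro arg_cong2[where f="(*)"] sum.cong) (auto simp: power_mult_distrib)
  also have "\<dots> \<le> W * y" using W nn by (intro mult_right_mono)
  finally have xy: "x\<^sup>2 \<le> W * y" .
  have "y\<^sup>2 = (\<Sum>n\<in>S. sqrt (w n * v n) * (sqrt (w n * v n) * v n))\<^sup>2"
    unfolding y_def using w v
    by (intro arg_cong[where f="\<lambda>t. t\<^sup>2"] sum.cong) (auto simp: mult.assoc[symmetric] power2_eq_square)
  also have "\<dots> \<le> (\<Sum>n\<in>S. (sqrt (w n * v n))\<^sup>2) * (\<Sum>n\<in>S. (sqrt (w n * v n) * v n)\<^sup>2)"
    by (rule Cauchy_Schwarz_ineq_sum)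
  also have "\<dots> = x * z"
    unfolding x_def z_def using w v
    by (intro arg_cong2[where f="(*)"] sum.cong) (auto simp: power_mult_distrib power2_eq_square power3_eq_cube)
  finally have yz: "y\<^sup>2 \<le> x * z" .
  show ?thesis
  proof (cases "x = 0")
    case True
    then show ?thesis using nn by (simp add: x_def[symmetric] z_def[symmetric])
  next
    case False
    have "x * x ^ 3 = (x\<^sup>2)\<^sup>2" by (simp add: power2_eq_square power3_eq_cube)
    also have "\<dots> \<le> (W * y)\<^sup>2" using xy nn by (intro power_mono) auto
    also have "\<dots> \<le> W\<^sup>2 * (x * z)" using yz by (simp add: power_mult_distrib mult_left_mono)
    finally have "x * x ^ 3 \<le> x * (W\<^sup>2 * z)" by (simp add: mult_ac)
    then show ?thesis using False nn by (simp add: x_def[symmetric] z_def[symmetric])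
  qed
qed

text \<open>
  Each convolution value is at most \<open>geo_const \<kappa>\<close>, which absorbs the powers beyond the third; the cube is then
  treated by Jensen's inequality and the sum over \<open>N\<close> is carried out first.
\<close>

lemma sum_geometric_convolution_le:
  fixes v :: "int \<Rightarrow> real"
  assumes \<kappa>: "0 < \<kappa>" and e: "3 \<le> e" and S: "finite S" and T: "finite T" and v: "\<And>n. n \<in> S \<Longrightarrow> 0 \<le> v n" "\<And>n. n \<in> S \<Longrightarrow> v n \<le> 1"
  shows "(\<Sum>N\<in>T. (\<Sum>n\<in>S. 2 powr (- \<kappa> * \<bar>real_of_int n - real_of_int N\<bar>) * v n) powr e)
     \<le> geo_const \<kappa> powr e * (\<Sum>n\<in>S. v n ^ 3)"
proof -
  let ?W = "geo_const \<kappa>" and ?w = "\<lambda>N n :: int. 2 powr (- \<kappa> * \<bar>real_of_int n - real_of_int N\<bar>)"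
  have W: "0 < ?W" by (rule geo_const_pos[OF \<kappa>])
  have wS: "(\<Sum>n\<in>S. ?w N n) \<le> ?W" for N by (rule sum_powr_dist_le[OF \<kappa> S])
  have wT: "(\<Sum>N\<in>T. ?w N n) \<le> ?W" for n
    using sum_powr_dist_le[OF \<kappa> T, of "real_of_int n"] by (simp add: abs_minus_commute)
  have "(\<Sum>n\<in>S. ?w N n * v n) powr e \<le> ?W powr (e - 1) * (\<Sum>n\<in>S. ?w N n * v n ^ 3)" for N
  proof -
    define x where "x = (\<Sum>n\<in>S. ?w N n * v n)"
    have x0: "0 \<le> x" unfolding x_def using v by (intro sum_nonneg) auto
    have "x \<le> (\<Sum>n\<in>S. ?w N n)" unfolding x_def using v by (intro sum_mono) (auto intro!: mult_left_le)
    then have xW: "x \<le> ?W" using wS[of N] by simp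
    have "x powr e = x powr (e - 3) * x ^ 3"
      using x0 by (cases "x = 0") (auto simp: powr_diff powr_numeral)
    also have "\<dots> \<le> ?W powr (e - 3) * (?W\<^sup>2 * (\<Sum>n\<in>S. ?w N n * v n ^ 3))"
      unfolding x_def using xW x0 e v wS[of N] unfolding x_def
      by (intro mult_mono powr_mono2 weighted_cube_le) auto
    also have "\<dots> = ?W powr (e - 1) * (\<Sum>n\<in>S. ?w N n * v n ^ 3)"
    proof -
      have "?W powr (e - 1) = ?W powr (e - 3) * ?W\<^sup>2"
        using W by (simp flip: powr_numeral powr_add)
      then show ?thesis by (simp add: mult.assoc)
    qed
    finally show ?thesis by (simp add: x_def)
  qed
  then have "(\<Sum>N\<in>T. (\<Sum>n\<in>S. ?w N n * v n) powr e) \<le> (\<Sum>N\<in>T. ?W powr (e - 1) * (\<Sum>n\<in>S. ?w N n * v n ^ 3))"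
    by (rule sum_mono)
  also have "\<dots> = ?W powr (e - 1) * (\<Sum>n\<in>S. v n ^ 3 * (\<Sum>N\<in>T. ?w N n))"
    unfolding sum_distrib_left by (subst sum.swap) (simp add: mult_ac)
  also have "\<dots> \<le> ?W powr (e - 1) * (\<Sum>n\<in>S. v n ^ 3 * ?W)"
    using v by (intro mult_left_mono sum_mono wT) auto
  also have "\<dots> = ?W powr e * (\<Sum>n\<in>S. v n ^ 3)"
  proof -
    have "?W powr e = ?W powr (e - 1) * ?W" using W by (simp add: powr_diff)
    then show ?thesis unfolding sum_distrib_right[symmetric] by (simp only: mult_ac)
  qed
  finally show ?thesis .
qed

text \<open>
  A complex number as a combination of four nonnegative numbers.
\<close>

lemma sum_units_max_Re: "(\<Sum>c\<in>{1, -1, \<i>, -\<i>}. c * of_real (max 0 (Re (cnj c * w)))) = w"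
proof -
  have "(1 :: complex) \<noteq> -1" "(1 :: complex) \<noteq> \<i>" "(1 :: complex) \<noteq> -\<i>" "(-1 :: complex) \<noteq> \<i>"
    "(-1 :: complex) \<noteq> -\<i>" "\<i> \<noteq> -\<i>" by (auto simp: complex_eq_iff)
  then show ?thesis by (auto simp: complex_eq_iff max_def)
qed

lemma sum_levels_eq_floor:
  assumes "0 \<le> x" "x \<le> real m"
  shows "(\<Sum>k\<in>{1..m}. of_bool (real k \<le> x)) = real_of_int \<lfloor>x\<rfloor>"
proof -
  have "{k \<in> {1..m}. real k \<le> x} = {1..nat \<lfloor>x\<rfloor>}"
    using assms by (auto simp: le_nat_iff le_floor_iff)
  then have "(\<Sum>k\<in>{1..m}. of_bool (real k \<le> x)) = real (nat \<lfloor>x\<rfloor>)"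
    by (simp add: of_bool_def sum.If_cases Int_def)
  then show ?thesis using assms by simp
qed

context bilinear_extension_estimate
begin

lemma restricted_const_nonneg: "0 \<le> restricted_const"
  by (simp add: restricted_const_def)

text \<open>
  A function with values in \<open>[0, 1]\<close> is the uniform limit of averages of the characteristic functions of its
  superlevel sets, which are subsets of \<open>A\<close>.
\<close>

lemma restricted_estimate_level:
  assumes A: "fin_borel A" and [measurable]: "g \<in> borel_measurable borel"
    and g: "\<And>\<xi>. 0 \<le> g \<xi>" "\<And>\<xi>. g \<xi> \<le> 1" "\<And>\<xi>. \<xi> \<notin> A \<Longrightarrow> g \<xi> = 0"
  shows "Lq_le lborel (2 * s) (extension_op (\<lambda>\<xi>. of_real (g \<xi>))) (restricted_const * measure lborel A powr (1 - 1 / s))"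
proof -
  note [measurable] = fin_borelD[OF A]
  define L where "L m k = {\<xi>. real k \<le> real (Suc m) * g \<xi>}" for m k
  have L: "fin_borel (L m k)" "L m k \<subseteq> A" if "k \<in> {1..Suc m}" for m k
  proof -
    show sub: "L m k \<subseteq> A" using g(3) that by (force simp: L_def)
    have "L m k \<in> sets borel" unfolding L_def by measurable
    then show "fin_borel (L m k)" using fin_borel_Int[OF A, of "L m k"] sub by (simp add: Int_absorb1)
  qed
  define F where "F m \<xi> = of_real (1 / Suc m) * (\<Sum>k\<in>{1..Suc m}. indicator (L m k) \<xi> :: complex)" for m \<xi>
  have F_floor: "F m \<xi> = of_real (real_of_int \<lfloor>real (Suc m) * g \<xi>\<rfloor> / Suc m)" for m \<xi>
  proof -
    have "(\<Sum>k\<in>{1..Suc m}. indicator (L m k) \<xi> :: complex) = of_real (\<Sum>k\<in>{1..Suc m}. of_bool (real k \<le> real (Suc m) * g \<xi>))"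
      unfolding of_real_sum by (intro sum.cong refl) (auto simp: L_def indicator_def)
    also have "\<dots> = of_real (real_of_int \<lfloor>real (Suc m) * g \<xi>\<rfloor>)"
      using g(1,2)[of \<xi>] by (subst sum_levels_eq_floor) (auto intro: mult_left_le)
    finally show ?thesis by (simp add: F_def)
  qed
  have F_diff: "norm (F m \<xi> - of_real (g \<xi>)) \<le> 1 / Suc m" for m \<xi>
  proof -
    have "\<bar>real_of_int \<lfloor>real (Suc m) * g \<xi>\<rfloor> - real (Suc m) * g \<xi>\<bar> \<le> 1" by linarith
    then have "\<bar>real_of_int \<lfloor>real (Suc m) * g \<xi>\<rfloor> / Suc m - g \<xi>\<bar> \<le> 1 / Suc m"
    proof -
      have n: "0 < real (Suc m)" by simp
      then have "real_of_int \<lfloor>real (Suc m) * g \<xi>\<rfloor> / Suc m - g \<xi>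
          = (real_of_int \<lfloor>real (Suc m) * g \<xi>\<rfloor> - real (Suc m) * g \<xi>) / Suc m"
        by (simp add: diff_divide_distrib del: of_nat_Suc)
      moreover assume "\<bar>real_of_int \<lfloor>real (Suc m) * g \<xi>\<rfloor> - real (Suc m) * g \<xi>\<bar> \<le> 1"
      ultimately show ?thesis using n by (simp add: divide_right_mono del: of_nat_Suc)
    qed
    then show ?thesis unfolding F_floor of_real_diff[symmetric] norm_of_real .
  qed
  have bound: "Lq_le lborel (2 * s) (extension_op (F m)) (restricted_const * measure lborel A powr (1 - 1 / s))" for m
  proof -
    have ext_F: "extension_op (F m) = (\<lambda>z. of_real (1 / Suc m) * (\<Sum>k\<in>{1..Suc m}. ext_ind (L m k) z))"
    proof
      fix z
      have "extension_op (F m) z = of_real (1 / Suc m) * extension_op (\<lambda>\<xi>. \<Sum>k\<in>{1..Suc m}. indicator (L m k) \<xi>) z"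
        unfolding F_def[abs_def] using L
        by (intro extension_op_cmult Bochner_Integration.integrable_sum integrable_indicator_fin_borel) auto
      also have "extension_op (\<lambda>\<xi>. \<Sum>k\<in>{1..Suc m}. indicator (L m k) \<xi>) z = (\<Sum>k\<in>{1..Suc m}. ext_ind (L m k) z)"
        using L by (intro extension_op_sum integrable_indicator_fin_borel) auto
      finally show "extension_op (F m) z = of_real (1 / Suc m) * (\<Sum>k\<in>{1..Suc m}. ext_ind (L m k) z)" .
    qed
    have "Lq_le lborel (2 * s) (\<lambda>z. \<Sum>k\<in>{1..Suc m}. ext_ind (L m k) z)
       (\<Sum>k\<in>{1..Suc m}. restricted_const * measure lborel (L m k) powr (1 - 1 / s))"
      using L s_gt by (intro Lq_le_sum restricted_estimate) auto
    then have "Lq_le lborel (2 * s) (\<lambda>z. \<Sum>k\<in>{1..Suc m}. ext_ind (L m k) z)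
       (\<Sum>k\<in>{1..Suc m}. restricted_const * measure lborel A powr (1 - 1 / s))"
    proof (rule Lq_le_mono_bound)
      show "(\<Sum>k\<in>{1..Suc m}. restricted_const * measure lborel (L m k) powr (1 - 1 / s))
        \<le> (\<Sum>k\<in>{1..Suc m}. restricted_const * measure lborel A powr (1 - 1 / s))"
      proof (intro sum_mono mult_left_mono powr_mono2 restricted_const_nonneg)
        fix k assume "k \<in> {1..Suc m}"
        then show "measure lborel (L m k) \<le> measure lborel A"
          using L[of k m] A by (intro measure_mono_fmeasurable) (auto simp: fin_borel_def fmeasurable_def)
      qed (use s_gt in auto)
    qed (use s_gt in auto)
    from Lq_le_cmult[OF this, of "of_real (1 / Suc m)"] show ?thesis
      unfolding ext_F by (simp add: norm_divide del: of_nat_Suc)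
  qed
  show ?thesis
  proof (rule Lq_le_AE_limit[OF bound])
    show "AE z in lborel. (\<lambda>m. extension_op (F m) z) \<longlonglongrightarrow> extension_op (\<lambda>\<xi>. of_real (g \<xi>)) z"
    proof (rule AE_I2, rule extension_op_tendsto[where w="\<lambda>\<xi>. norm (indicator A \<xi> :: complex)"])
      show "integrable lborel (\<lambda>\<xi>. norm (indicator A \<xi> :: complex))"
        by (intro integrable_norm integrable_indicator_fin_borel A)
      show "F m \<in> borel_measurable borel" for m
        unfolding F_floor[abs_def] by measurable
      show "AE \<xi> in lborel. (\<lambda>m. F m \<xi>) \<longlonglongrightarrow> of_real (g \<xi>)"
      proof (rule AE_I2)
        fix \<xi>
        show "(\<lambda>m. F m \<xi>) \<longlonglongrightarrow> of_real (g \<xi>)"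
          by (rule LIM_zero_cancel, rule Lim_null_comparison[OF _ LIMSEQ_inverse_real_of_nat])
            (use F_diff in \<open>auto simp: inverse_eq_divide\<close>)
      qed
      show "norm (F m \<xi>) \<le> norm (indicator A \<xi> :: complex)" for m \<xi>
      proof (cases "\<xi> \<in> A")
        case True
        have "real (Suc m) * g \<xi> \<le> real (Suc m) * 1" using g(2)[of \<xi>] by (intro mult_left_mono) auto
        then have "real_of_int \<lfloor>real (Suc m) * g \<xi>\<rfloor> \<le> real (Suc m)"
          by (metis mult_1_right of_int_floor_le order_trans)
        moreover have "0 \<le> \<lfloor>real (Suc m) * g \<xi>\<rfloor>" using g(1)[of \<xi>] by simp
        ultimately show ?thesis using True unfolding F_floor norm_of_real by (simp del: of_nat_Suc)
      next
        case False
        then show ?thesis unfolding F_floor using g(3) by simp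
      qed
    qed simp
    show "extension_op (\<lambda>\<xi>. of_real (g \<xi>)) \<in> borel_measurable lborel"
      using borel_measurable_extension_op[of "\<lambda>\<xi>. of_real (g \<xi>)"] by simp
  qed (use s_gt in auto)
qed

lemma restricted_estimate_bounded:
  assumes A: "fin_borel A" and f[measurable]: "f \<in> borel_measurable borel"
    and H: "0 < H" "\<And>\<xi>. norm (f \<xi>) \<le> H" and supp: "\<And>\<xi>. \<xi> \<notin> A \<Longrightarrow> f \<xi> = 0"
  shows "Lq_le lborel (2 * s) (extension_op f) (4 * H * restricted_const * measure lborel A powr (1 - 1 / s))"
proof -
  let ?U = "{1, -1, \<i>, -\<i>} :: complex set"
  define g where "g c \<xi> = max 0 (Re (cnj c * f \<xi>)) / H" for c \<xi>
  have [measurable]: "g c \<in> borel_measurable borel" for c unfolding g_def[abs_def] by measurable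
  have unit: "norm c = 1" if "c \<in> ?U" for c using that by auto
  have g01: "0 \<le> g c \<xi>" "g c \<xi> \<le> 1" if "c \<in> ?U" for c \<xi>
  proof -
    have "Re (cnj c * f \<xi>) \<le> norm (cnj c * f \<xi>)" by (rule complex_Re_le_cmod)
    also have "\<dots> \<le> H" using unit[OF that] H(2)[of \<xi>] by (simp add: norm_mult)
    finally show "0 \<le> g c \<xi>" "g c \<xi> \<le> 1" using H(1) by (auto simp: g_def)
  qed
  have int_g: "integrable lborel (\<lambda>\<xi>. complex_of_real (g c \<xi>))" if "c \<in> ?U" for c
  proof (rule Bochner_Integration.integrable_bound[OF integrable_indicator_fin_borel[OF A]])
    show "AE \<xi> in lborel. norm (complex_of_real (g c \<xi>)) \<le> norm (indicator A \<xi> :: complex)"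
    proof (rule AE_I2)
      fix \<xi>
      show "norm (complex_of_real (g c \<xi>)) \<le> norm (indicator A \<xi> :: complex)"
      proof (cases "\<xi> \<in> A")
        case True
        then show ?thesis using g01[OF that, of \<xi>] by simp
      next
        case False
        then show ?thesis using supp by (simp add: g_def)
      qed
    qed
  qed measurable
  have f_eq: "f = (\<lambda>\<xi>. \<Sum>c\<in>?U. (of_real H * c) * of_real (g c \<xi>))"
  proof
    fix \<xi>
    have "(\<Sum>c\<in>?U. (of_real H * c) * of_real (g c \<xi>)) = (\<Sum>c\<in>?U. c * of_real (max 0 (Re (cnj c * f \<xi>))))"
      using H(1) by (intro sum.cong refl) (simp add: g_def)
    then show "f \<xi> = (\<Sum>c\<in>?U. (of_real H * c) * of_real (g c \<xi>))" by (simp only: sum_units_max_Re)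
  qed
  have ext_f: "extension_op f z = (\<Sum>c\<in>?U. (of_real H * c) * extension_op (\<lambda>\<xi>. of_real (g c \<xi>)) z)" for z
  proof -
    have "extension_op f z = (\<Sum>c\<in>?U. extension_op (\<lambda>\<xi>. (of_real H * c) * of_real (g c \<xi>)) z)"
      unfolding f_eq by (rule extension_op_sum) (intro integrable_mult_right int_g)
    also have "\<dots> = (\<Sum>c\<in>?U. (of_real H * c) * extension_op (\<lambda>\<xi>. of_real (g c \<xi>)) z)"
      by (intro sum.cong refl extension_op_cmult int_g)
    finally show ?thesis .
  qed
  have "Lq_le lborel (2 * s) (\<lambda>z. \<Sum>c\<in>?U. (of_real H * c) * extension_op (\<lambda>\<xi>. of_real (g c \<xi>)) z)
    (\<Sum>c\<in>?U. norm (of_real H * c) * (restricted_const * measure lborel A powr (1 - 1 / s)))"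
  proof (rule Lq_le_sum)
    fix c assume c: "c \<in> ?U"
    show "Lq_le lborel (2 * s) (\<lambda>z. (of_real H * c) * extension_op (\<lambda>\<xi>. of_real (g c \<xi>)) z)
      (norm (of_real H * c) * (restricted_const * measure lborel A powr (1 - 1 / s)))"
      using g01[OF c] supp by (intro Lq_le_cmult restricted_estimate_level A) (auto simp: g_def)
  qed (use s_gt in auto)
  moreover have "(\<Sum>c\<in>?U. norm (of_real H * c) * (restricted_const * measure lborel A powr (1 - 1 / s)))
     \<le> 4 * H * restricted_const * measure lborel A powr (1 - 1 / s)"
  proof -
    have "(\<Sum>c\<in>?U. norm (of_real H * c) * (restricted_const * measure lborel A powr (1 - 1 / s)))
       = of_nat (card ?U) * (H * (restricted_const * measure lborel A powr (1 - 1 / s)))"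
      using H(1) unit by (subst sum_constant[symmetric]) (intro sum.cong refl, simp add: norm_mult)
    also have "\<dots> \<le> of_nat 4 * (H * (restricted_const * measure lborel A powr (1 - 1 / s)))"
      using H(1) restricted_const_nonneg by (intro mult_right_mono of_nat_mono) (auto simp: card_insert_if)
    finally show ?thesis by simp
  qed
  ultimately show ?thesis
    unfolding ext_f[abs_def] using s_gt by (elim Lq_le_mono_bound) auto
qed

end

lemma floor_log_eq_iff:
  assumes "0 < (x :: real)"
  shows "\<lfloor>log 2 x\<rfloor> = n \<longleftrightarrow> 2 powr n \<le> x \<and> x < 2 powr (real_of_int n + 1)"
  using assms by (simp add: floor_eq_iff le_log_iff log_less_iff)

context bilinear_extension_estimate
begin

text \<open>
  For a function normalised in \<open>L\<close> with exponent \<open>\<sigma> / (\<sigma> - 1)\<close>, the restricted estimate for its part of size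
  about \<open>2 powr n\<close> carries the factor \<open>2 powr (n * gain \<sigma>)\<close>.
\<close>

definition gain :: "real \<Rightarrow> real" where
  "gain \<sigma> = 1 - \<sigma> / (\<sigma> - 1) * (1 - 1 / s)"

lemma gain_pos: "s < \<sigma> \<Longrightarrow> 0 < gain \<sigma>"
  using s_gt by (simp add: gain_def field_simps)

text \<open>
  This relation says that \<open>(\<sigma>', 2\<sigma>)\<close> is obtained by interpolation between \<open>(s', 2s)\<close> and \<open>(1, \<infinity>)\<close>; it makes
  the powers of \<open>2 powr N\<close> cancel in the proof of the strong estimate.
\<close>

lemma gain_scaling:
  assumes "s < \<sigma>"
  shows "(\<sigma> / (\<sigma> - 1) - 1) * (2 * \<sigma> - 2 * s) = 2 * s * gain \<sigma>"
proof -
  have nz: "\<sigma> - 1 \<noteq> 0" "s \<noteq> 0" using assms s_gt by auto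
  have "(\<sigma> / (\<sigma> - 1) - 1) = 1 / (\<sigma> - 1)" using nz by (simp add: field_simps)
  moreover have "2 * s * gain \<sigma> = (2 * s * (\<sigma> - 1) - 2 * \<sigma> * (s - 1)) / (\<sigma> - 1)"
    using nz by (simp add: gain_def field_simps)
  moreover have "2 * s * (\<sigma> - 1) - 2 * \<sigma> * (s - 1) = 2 * \<sigma> - 2 * s" by (simp add: algebra_simps)
  ultimately show ?thesis by (simp only: times_divide_eq_left mult_1_left)
qed

definition strong_const :: "real \<Rightarrow> real" where
  "strong_const \<sigma> = ((2 * 2 powr (\<sigma> / (\<sigma> - 1) - 1)) powr (2 * \<sigma> - 2 * s) * 2 powr (2 * s) *
     (8 * restricted_const) powr (2 * s) * geo_const (gain \<sigma>) powr (2 * s)) powr (1 / (2 * \<sigma>))"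

lemma strong_const_nonneg: "0 \<le> strong_const \<sigma>"
  by (simp add: strong_const_def)

text \<open>
  Real interpolation with the trivial bound from \<open>L\<^sup>1\<close> to \<open>L\<^sup>\<infinity>\<close>. At a point where the extension of \<open>f\<close> has
  absolute value \<open>y\<close>, the part of \<open>f\<close> above a suitable height \<open>2 powr N\<close> contributes at most \<open>y / 2\<close>, so the lower
  part \<open>low N\<close> has absolute value at least \<open>y / 2\<close> and is estimated with exponent \<open>2 * s\<close>. Summed over \<open>N\<close>, the
  dyadic pieces of \<open>f\<close> enter through a convolution with a geometric sequence. The factor \<open>v n\<close> of the piece of
  height \<open>2 powr n\<close> satisfies \<open>v n ^ 3 \<le> u n\<close> because \<open>3 * (1 - 1 / s) \<ge> 1\<close>, and the \<open>u n\<close> sum to at most \<open>1\<close>.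
\<close>

lemma strong_estimate_levels:
  assumes \<sigma>: "s < \<sigma>" and f: "integrable lborel f"
    and norm_f: "(\<integral>\<^sup>+\<xi>. ennreal (norm (f \<xi>) powr (\<sigma> / (\<sigma> - 1))) \<partial>lborel) \<le> 1"
    and levels: "\<And>\<xi>. f \<xi> \<noteq> 0 \<Longrightarrow> \<lfloor>log 2 (norm (f \<xi>))\<rfloor> \<in> S" and S: "finite S"
  shows "Lq_le lborel (2 * \<sigma>) (extension_op f) (strong_const \<sigma>)"
proof -
  define p where "p = \<sigma> / (\<sigma> - 1)"
  define c where "c = p - 1"
  define \<kappa> where "\<kappa> = gain \<sigma>"
  define R where "R = 8 * restricted_const"
  define q where "q = 2 * \<sigma>"
  have s: "0 < s" "1 < s" using s_gt by auto
  have \<kappa>: "0 < \<kappa>" unfolding \<kappa>_def by (rule gain_pos[OF \<sigma>])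
  have scaling: "c * (q - 2 * s) = 2 * s * \<kappa>"
    unfolding c_def p_def \<kappa>_def q_def by (rule gain_scaling[OF \<sigma>])
  have c: "0 < c" using \<sigma> s by (simp add: c_def p_def field_simps)
  then have p: "1 < p" by (simp add: c_def)
  have q: "0 < q - 2 * s" "0 < q" using \<sigma> s by (auto simp: q_def)
  have R0: "0 \<le> R" using restricted_const_nonneg by (simp add: R_def)
  have [measurable]: "f \<in> borel_measurable borel" using f by simp
  have norm_p: "(\<integral>\<^sup>+\<xi>. ennreal (norm (f \<xi>) powr p) \<partial>lborel) \<le> 1" using norm_f by (simp add: p_def)
  define lv where "lv n = {\<xi>. f \<xi> \<noteq> 0 \<and> \<lfloor>log 2 (norm (f \<xi>))\<rfloor> = n}" for n
  define piece where "piece n \<xi> = (if \<xi> \<in> lv n then f \<xi> else 0)" for n \<xi>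
  have lv_iff: "\<xi> \<in> lv n \<longleftrightarrow> 2 powr n \<le> norm (f \<xi>) \<and> norm (f \<xi>) < 2 powr (real_of_int n + 1)" for \<xi> n
  proof (cases "f \<xi> = 0")
    case False
    then show ?thesis using floor_log_eq_iff[of "norm (f \<xi>)" n] by (simp add: lv_def)
  next
    case True
    then show ?thesis using powr_gt_zero[of 2 "real_of_int n"] by (auto simp: lv_def not_le)
  qed
  have [measurable]: "lv n \<in> sets borel" for n unfolding lv_def by measurable
  have [measurable]: "piece n \<in> borel_measurable borel" for n unfolding piece_def[abs_def] by measurable
  have int_piece: "integrable lborel (piece n)" for n
    by (rule Bochner_Integration.integrable_bound[OF f]) (auto simp: piece_def)
  have lv_fin: "fin_borel (lv n)" for n
  proof -
    have "ennreal (2 powr n) * emeasure lborel (lv n) = (\<integral>\<^sup>+\<xi>. ennreal (2 powr n) * indicator (lv n) \<xi> \<partial>lborel)"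
      by (simp add: nn_integral_cmult)
    also have "\<dots> \<le> (\<integral>\<^sup>+\<xi>. ennreal (norm (f \<xi>)) \<partial>lborel)"
      by (intro nn_integral_mono) (auto simp: lv_iff ennreal_leI split: split_indicator)
    also have "\<dots> < \<infinity>" using f by (simp add: integrable_iff_bounded)
    finally have "emeasure lborel (lv n) < \<infinity>" by (auto simp: ennreal_mult_less_top)
    then show ?thesis by (simp add: fin_borel_def)
  qed
  define u where "u n = 2 powr (of_int n * p) * measure lborel (lv n)" for n
  define v where "v n = u n powr (1 - 1 / s)" for n
  have u0: "0 \<le> u n" and v0: "0 \<le> v n" for n by (auto simp: u_def v_def)
  have sum_u: "(\<Sum>n\<in>S. u n) \<le> 1"
  proof -
    have "ennreal (\<Sum>n\<in>S. u n) = (\<Sum>n\<in>S. ennreal (2 powr (of_int n * p)) * emeasure lborel (lv n))"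
    proof -
      have "emeasure lborel (lv n) = ennreal (measure lborel (lv n))" for n
        using lv_fin[of n] by (intro emeasure_eq_ennreal_measure) (auto simp: fin_borel_def)
      then show ?thesis by (simp add: u_def sum_ennreal[symmetric] ennreal_mult)
    qed
    also have "\<dots> = (\<integral>\<^sup>+\<xi>. (\<Sum>n\<in>S. ennreal (2 powr (of_int n * p)) * indicator (lv n) \<xi>) \<partial>lborel)"
      by (simp add: nn_integral_sum nn_integral_cmult)
    also have "\<dots> \<le> (\<integral>\<^sup>+\<xi>. ennreal (norm (f \<xi>) powr p) \<partial>lborel)"
    proof (rule nn_integral_mono)
      fix \<xi>
      show "(\<Sum>n\<in>S. ennreal (2 powr (of_int n * p)) * indicator (lv n) \<xi>) \<le> ennreal (norm (f \<xi>) powr p)"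
      proof (cases "f \<xi> = 0")
        case False
        let ?n = "\<lfloor>log 2 (norm (f \<xi>))\<rfloor>"
        have "(\<Sum>n\<in>S. ennreal (2 powr (of_int n * p)) * indicator (lv n) \<xi>)
          = (\<Sum>n\<in>S. if n = ?n then ennreal (2 powr (of_int n * p)) else 0)"
          using False by (intro sum.cong) (auto simp: lv_def indicator_def)
        also have "\<dots> = ennreal ((2 powr ?n) powr p)" using S levels[OF False] by (simp add: powr_powr)
        also have "\<dots> \<le> ennreal (norm (f \<xi>) powr p)"
          using False lv_iff[of \<xi> ?n] p by (intro ennreal_leI powr_mono2) (auto simp: lv_def)
        finally show ?thesis .
      qed (simp add: lv_def)
    qed
    also have "\<dots> \<le> 1" by (rule norm_p)
    finally show ?thesis by (simp add: ennreal_le_1)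
  qed
  have u1: "u n \<le> 1" if "n \<in> S" for n
    using member_le_sum[OF that, of u] u0 S sum_u by auto
  have v1: "v n \<le> 1" if "n \<in> S" for n
    unfolding v_def using u0 u1[OF that] s by (intro powr_le1) auto
  have v3: "v n ^ 3 \<le> u n" if "n \<in> S" for n
  proof (cases "u n = 0")
    case False
    have "v n ^ 3 = u n powr (3 * (1 - 1 / s))"
      unfolding v_def using False u0[of n] by (simp add: powr_power mult.commute)
    also have "\<dots> \<le> u n powr 1"
      using False u0[of n] u1[OF that] s_gt by (intro powr_mono') (auto simp: field_simps)
    finally show ?thesis using u0[of n] by simp
  qed (use s in \<open>simp add: v_def\<close>)
  define low where "low N z = (\<Sum>n\<in>{n \<in> S. n < N}. extension_op (piece n) z)" for N z
  define X where "X N = (\<Sum>n\<in>S. 2 powr (- \<kappa> * \<bar>real_of_int n - real_of_int N\<bar>) * v n)" for N :: int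
  have X0: "0 \<le> X N" for N unfolding X_def using v0 by (intro sum_nonneg) auto
  have low_bound: "Lq_le lborel (2 * s) (low N) (R * 2 powr (of_int N * \<kappa>) * X N)" for N
  proof -
    have piece_bound: "Lq_le lborel (2 * s) (extension_op (piece n)) (R * 2 powr (of_int n * \<kappa>) * v n)" for n
    proof -
      have "Lq_le lborel (2 * s) (extension_op (piece n))
         (4 * 2 powr (real_of_int n + 1) * restricted_const * measure lborel (lv n) powr (1 - 1 / s))"
      proof (rule restricted_estimate_bounded[OF lv_fin])
        show "norm (piece n \<xi>) \<le> 2 powr (real_of_int n + 1)" for \<xi>
          by (auto simp: piece_def lv_iff)
      qed (auto simp: piece_def)
      also have "4 * 2 powr (real_of_int n + 1) * restricted_const * measure lborel (lv n) powr (1 - 1 / s)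
        = R * 2 powr (of_int n * \<kappa>) * v n"
      proof -
        have "2 powr (of_int n * \<kappa>) * v n
          = (2 powr (of_int n * \<kappa>) * (2 powr (of_int n * p)) powr (1 - 1 / s)) * measure lborel (lv n) powr (1 - 1 / s)"
          unfolding v_def u_def by (simp add: powr_mult)
        also have "2 powr (of_int n * \<kappa>) * (2 powr (of_int n * p)) powr (1 - 1 / s) = 2 powr (of_int n)"
          unfolding powr_powr powr_add[symmetric]
          by (rule arg_cong[where f="\<lambda>x. 2 powr x"]) (simp add: \<kappa>_def gain_def p_def algebra_simps)
        finally show ?thesis by (simp add: R_def powr_add)
      qed
      finally show ?thesis .
    qed
    have "Lq_le lborel (2 * s) (low N) (\<Sum>n\<in>{n \<in> S. n < N}. R * 2 powr (of_int n * \<kappa>) * v n)"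
      unfolding low_def[abs_def] using S s by (intro Lq_le_sum piece_bound) auto
    then show ?thesis
    proof (rule Lq_le_mono_bound)
      have "(\<Sum>n\<in>{n \<in> S. n < N}. R * 2 powr (of_int n * \<kappa>) * v n)
        \<le> (\<Sum>n\<in>{n \<in> S. n < N}. R * 2 powr (of_int N * \<kappa>) * (2 powr (- \<kappa> * \<bar>real_of_int n - real_of_int N\<bar>) * v n))"
      proof (rule sum_mono)
        fix n assume "n \<in> {n \<in> S. n < N}"
        then have "2 powr (of_int n * \<kappa>) = 2 powr (of_int N * \<kappa>) * 2 powr (- \<kappa> * \<bar>real_of_int n - real_of_int N\<bar>)"
          unfolding powr_add[symmetric] by (simp add: algebra_simps)
        then show "R * 2 powr (of_int n * \<kappa>) * v n
          \<le> R * 2 powr (of_int N * \<kappa>) * (2 powr (- \<kappa> * \<bar>real_of_int n - real_of_int N\<bar>) * v n)" by simp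
      qed
      also have "\<dots> \<le> R * 2 powr (of_int N * \<kappa>) * X N"
        unfolding X_def sum_distrib_left[symmetric] using R0 v0 S
        by (intro mult_left_mono sum_mono2) auto
      finally show "(\<Sum>n\<in>{n \<in> S. n < N}. R * 2 powr (of_int n * \<kappa>) * v n) \<le> R * 2 powr (of_int N * \<kappa>) * X N" .
    qed (use s in auto)
  qed
  have high_bound: "norm (extension_op f z - low N z) \<le> 2 powr (- of_int N * c)" for N z
  proof -
    let ?H = "\<lambda>\<xi>. \<Sum>n\<in>{n \<in> S. \<not> n < N}. piece n \<xi>"
    have piece_sum: "(\<Sum>n\<in>T. piece n \<xi>) = (if f \<xi> \<noteq> 0 \<and> \<lfloor>log 2 (norm (f \<xi>))\<rfloor> \<in> T then f \<xi> else 0)"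
      if "finite T" for T \<xi>
    proof (cases "f \<xi> = 0")
      case False
      then have "(\<Sum>n\<in>T. piece n \<xi>) = (\<Sum>n\<in>T. if n = \<lfloor>log 2 (norm (f \<xi>))\<rfloor> then f \<xi> else 0)"
        by (intro sum.cong) (auto simp: piece_def lv_def)
      then show ?thesis using that False by simp
    qed (auto simp: piece_def intro!: sum.neutral)
    have "f = (\<lambda>\<xi>. \<Sum>n\<in>S. piece n \<xi>)"
    proof
      fix \<xi>
      show "f \<xi> = (\<Sum>n\<in>S. piece n \<xi>)" using levels[of \<xi>] by (auto simp: piece_sum[OF S])
    qed
    then have "extension_op f z = (\<Sum>n\<in>S. extension_op (piece n) z)"
      using extension_op_sum[of S piece z] int_piece by simp
    also have "\<dots> = low N z + (\<Sum>n\<in>{n \<in> S. \<not> n < N}. extension_op (piece n) z)"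
      unfolding low_def using S by (subst sum.union_disjoint[symmetric]) (auto intro!: sum.cong)
    also have "(\<Sum>n\<in>{n \<in> S. \<not> n < N}. extension_op (piece n) z) = extension_op ?H z"
      using int_piece by (subst extension_op_sum) auto
    finally have diff: "extension_op f z - low N z = extension_op ?H z" by simp
    have int_H: "integrable lborel ?H" using int_piece by auto
    have "ennreal (norm (extension_op ?H z)) \<le> ennreal (\<integral>\<xi>. norm (?H \<xi>) \<partial>lborel)"
      by (intro ennreal_leI norm_extension_op_le int_H)
    also have "\<dots> = (\<integral>\<^sup>+\<xi>. ennreal (norm (?H \<xi>)) \<partial>lborel)"
      using int_H by (intro nn_integral_eq_integral[symmetric]) auto
    also have "\<dots> \<le> (\<integral>\<^sup>+\<xi>. ennreal (2 powr (- of_int N * c)) * ennreal (norm (f \<xi>) powr p) \<partial>lborel)"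
    proof (rule nn_integral_mono)
      fix \<xi>
      have "norm (?H \<xi>) \<le> 2 powr (- of_int N * c) * norm (f \<xi>) powr p"
      proof (cases "f \<xi> \<noteq> 0 \<and> \<not> \<lfloor>log 2 (norm (f \<xi>))\<rfloor> < N")
        case True
        then have "of_int N \<le> log 2 (norm (f \<xi>))" by linarith
        then have N: "2 powr N \<le> norm (f \<xi>)" using True by (simp add: le_log_iff)
        have "norm (f \<xi>) = norm (f \<xi>) powr (- c) * norm (f \<xi>) powr p"
          using True by (simp add: c_def flip: powr_add)
        also have "\<dots> \<le> (2 powr N) powr (- c) * norm (f \<xi>) powr p"
          using N c by (intro mult_right_mono powr_mono2') auto
        finally have "norm (f \<xi>) \<le> 2 powr (- of_int N * c) * norm (f \<xi>) powr p" by (simp add: powr_powr)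
        then show ?thesis using S by (subst piece_sum) auto
      next
        case False
        then show ?thesis using S by (subst piece_sum) auto
      qed
      then show "ennreal (norm (?H \<xi>)) \<le> ennreal (2 powr (- of_int N * c)) * ennreal (norm (f \<xi>) powr p)"
        by (simp add: ennreal_mult'[symmetric] ennreal_leI)
    qed
    also have "\<dots> \<le> ennreal (2 powr (- of_int N * c)) * 1"
      using mult_left_mono[OF norm_p, of "ennreal (2 powr (- of_int N * c))"] by (simp add: nn_integral_cmult)
    finally show ?thesis unfolding diff by simp
  qed
  define E where "E = extension_op f"
  have [measurable]: "E \<in> borel_measurable borel" unfolding E_def by (rule borel_measurable_extension_op) measurable
  have [measurable]: "low N \<in> borel_measurable borel" for N
    using Lq_leD(1)[OF low_bound] by simp
  \<comment> \<open>The least \<open>N\<close> for which the bound \<open>2 powr (- N * c)\<close> for the upper part is at most \<open>y / 2\<close>.\<close>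
  define ht where "ht z = \<lceil>- log 2 (norm (E z) / 2) / c\<rceil>" for z
  define D where "D k z = (if ht z \<in> {- int k..int k} then ennreal (norm (E z) powr q) else 0)" for k z
  have [measurable]: "D k \<in> borel_measurable borel" for k
  proof -
    have "ht \<in> borel \<rightarrow>\<^sub>M count_space UNIV" unfolding ht_def[abs_def] by measurable
    from measurable_sets[OF this, of "{- int k..int k}"]
    have [measurable]: "{z. ht z \<in> {- int k..int k}} \<in> sets borel" by (simp add: vimage_def)
    have "D k = (\<lambda>z. if z \<in> {z. ht z \<in> {- int k..int k}} then ennreal (norm (E z) powr q) else 0)"
      by (auto simp: D_def)
    also have "\<dots> \<in> borel_measurable borel" by measurable
    finally show ?thesis .
  qed
  define coef where "coef N = (2 * 2 powr c * 2 powr (- of_int N * c)) powr (q - 2 * s) * 2 powr (2 * s)" for N :: int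
  have coef0: "0 \<le> coef N" for N by (simp add: coef_def)
  have pw: "D k z \<le> (\<Sum>N\<in>{- int k..int k}. ennreal (coef N) * ennreal (norm (low N z) powr (2 * s)))" for k z
  proof (cases "E z \<noteq> 0 \<and> ht z \<in> {- int k..int k}")
    case True
    define y where "y = norm (E z)"
    define N where "N = ht z"
    have y: "0 < y" using True by (simp add: y_def)
    have "- log 2 (y / 2) / c \<le> of_int N" "of_int N - 1 < - log 2 (y / 2) / c"
      unfolding N_def ht_def y_def by linarith+
    then have "- of_int N * c \<le> log 2 (y / 2)" "log 2 (y / 2) < c + - of_int N * c"
      using c by (simp_all add: field_simps)
    then have N: "2 powr (- of_int N * c) \<le> y / 2" "y / 2 < 2 powr c * 2 powr (- of_int N * c)"
      using y unfolding powr_add[symmetric] by (simp_all add: le_log_iff log_less_iff)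
    have "y \<le> norm (low N z) + norm (E z - low N z)"
      unfolding y_def using norm_triangle_ineq[of "low N z" "E z - low N z"] by simp
    then have y_low: "y \<le> 2 * norm (low N z)"
      using high_bound[of z N] N(1) by (simp add: E_def)
    have "y powr q = y powr (q - 2 * s) * y powr (2 * s)" by (simp flip: powr_add)
    also have "\<dots> \<le> (2 * 2 powr c * 2 powr (- of_int N * c)) powr (q - 2 * s) * (2 * norm (low N z)) powr (2 * s)"
      using N(2) y y_low q s by (intro mult_mono powr_mono2) auto
    also have "\<dots> = coef N * norm (low N z) powr (2 * s)"
      by (simp add: coef_def powr_mult)
    finally have "ennreal (y powr q) \<le> ennreal (coef N) * ennreal (norm (low N z) powr (2 * s))"
      using coef0 by (simp add: ennreal_mult'[symmetric] ennreal_leI)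
    also have "\<dots> \<le> (\<Sum>N\<in>{- int k..int k}. ennreal (coef N) * ennreal (norm (low N z) powr (2 * s)))"
      using True by (intro member_le_sum[where f="\<lambda>N. ennreal (coef N) * ennreal (norm (low N z) powr (2 * s))"]) (auto simp: N_def)
    finally show ?thesis using True by (simp add: D_def y_def)
  next
    case False
    then show ?thesis using q by (auto simp: D_def)
  qed
  have intD: "(\<integral>\<^sup>+z. D k z \<partial>lborel) \<le> ennreal (strong_const \<sigma> powr q)" for k
  proof -
    let ?T = "{- int k..int k}"
    let ?K = "(2 * 2 powr c) powr (q - 2 * s) * 2 powr (2 * s) * R powr (2 * s)"
    have "(\<integral>\<^sup>+z. D k z \<partial>lborel) \<le> (\<integral>\<^sup>+z. (\<Sum>N\<in>?T. ennreal (coef N) * ennreal (norm (low N z) powr (2 * s))) \<partial>lborel)"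
      by (intro nn_integral_mono pw)
    also have "\<dots> = (\<Sum>N\<in>?T. ennreal (coef N) * (\<integral>\<^sup>+z. ennreal (norm (low N z) powr (2 * s)) \<partial>lborel))"
      by (simp add: nn_integral_sum nn_integral_cmult)
    also have "\<dots> \<le> (\<Sum>N\<in>?T. ennreal (coef N) * ennreal ((R * 2 powr (of_int N * \<kappa>) * X N) powr (2 * s)))"
      by (intro sum_mono mult_left_mono Lq_leD(3)[OF low_bound]) auto
    also have "\<dots> = (\<Sum>N\<in>?T. ennreal (?K * X N powr (2 * s)))"
    proof (rule sum.cong[OF refl])
      fix N
      have "(2 powr (- of_int N * c)) powr (q - 2 * s) * (2 powr (of_int N * \<kappa>)) powr (2 * s) = 1"
      proof -
        have "- of_int N * c * (q - 2 * s) + of_int N * \<kappa> * (2 * s) = of_int N * (2 * s * \<kappa> - c * (q - 2 * s))"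
          by (simp add: algebra_simps)
        then show ?thesis unfolding powr_powr powr_add[symmetric] scaling by simp
      qed
      then have "coef N * (R * 2 powr (of_int N * \<kappa>) * X N) powr (2 * s) = ?K * X N powr (2 * s)"
        unfolding coef_def powr_mult by (simp add: mult_ac) 
      then show "ennreal (coef N) * ennreal ((R * 2 powr (of_int N * \<kappa>) * X N) powr (2 * s)) = ennreal (?K * X N powr (2 * s))"
        using coef0[of N] by (simp add: ennreal_mult'[symmetric])
    qed
    also have "\<dots> = ennreal (?K * (\<Sum>N\<in>?T. X N powr (2 * s)))"
      by (simp add: sum_ennreal sum_distrib_left)
    also have "\<dots> \<le> ennreal (?K * (geo_const \<kappa> powr (2 * s) * (\<Sum>n\<in>S. v n ^ 3)))"
      unfolding X_def using s_gt v0 v1 S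
      by (intro ennreal_leI mult_left_mono sum_geometric_convolution_le \<kappa>) auto
    also have "\<dots> \<le> ennreal (?K * (geo_const \<kappa> powr (2 * s) * 1))"
    proof (intro ennreal_leI mult_left_mono)
      have "(\<Sum>n\<in>S. v n ^ 3) \<le> (\<Sum>n\<in>S. u n)" by (intro sum_mono v3)
      then show "(\<Sum>n\<in>S. v n ^ 3) \<le> 1" using sum_u by simp
    qed auto
    also have "?K * (geo_const \<kappa> powr (2 * s) * 1) = strong_const \<sigma> powr q"
      using q unfolding strong_const_def by (simp add: powr_powr c_def p_def R_def \<kappa>_def q_def mult.assoc)
    finally show ?thesis .
  qed
  have "(\<integral>\<^sup>+z. ennreal (norm (E z) powr q) \<partial>lborel) \<le> ennreal (strong_const \<sigma> powr q)"
  proof (rule nn_integral_le_of_pointwise_limit[of D, OF _ _ intD])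
    show "AE z in lborel. (\<lambda>k. D k z) \<longlonglongrightarrow> ennreal (norm (E z) powr q)"
    proof (rule AE_I2)
      fix z
      have "eventually (\<lambda>k. D k z = ennreal (norm (E z) powr q)) sequentially"
        using eventually_ge_at_top[of "nat \<bar>ht z\<bar>"] by eventually_elim (auto simp: D_def)
      then show "(\<lambda>k. D k z) \<longlonglongrightarrow> ennreal (norm (E z) powr q)" by (rule tendsto_eventually)
    qed
  qed measurable
  then show ?thesis
    using strong_const_nonneg[of \<sigma>] by (simp add: Lq_le_def E_def[symmetric] q_def)
qed

text \<open>
  The general case follows by normalising \<open>f\<close> and letting finitely many dyadic levels exhaust it.
\<close>

lemma strong_estimate:
  assumes \<sigma>: "s < \<sigma>" and f: "integrable lborel f" and C: "0 \<le> C"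
    and norm_f: "(\<integral>\<^sup>+\<xi>. ennreal (norm (f \<xi>) powr (\<sigma> / (\<sigma> - 1))) \<partial>lborel) \<le> ennreal (C powr (\<sigma> / (\<sigma> - 1)))"
  shows "Lq_le lborel (2 * \<sigma>) (extension_op f) (strong_const \<sigma> * C)"
proof -
  define p where "p = \<sigma> / (\<sigma> - 1)"
  have \<sigma>0: "1 < \<sigma>" using \<sigma> s_gt by simp
  then have p: "0 < p" by (simp add: p_def)
  have [measurable]: "f \<in> borel_measurable borel" using f by simp
  have pos: "Lq_le lborel (2 * \<sigma>) (extension_op f) (strong_const \<sigma> * C)"
    if C: "0 < C" and norm_f: "(\<integral>\<^sup>+\<xi>. ennreal (norm (f \<xi>) powr p) \<partial>lborel) \<le> ennreal (C powr p)" for C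
  proof -
    define g where "g \<xi> = of_real (1 / C) * f \<xi>" for \<xi>
    have int_g: "integrable lborel g" unfolding g_def using f by simp
    then have [measurable]: "g \<in> borel_measurable borel" by simp
    have norm_g: "(\<integral>\<^sup>+\<xi>. ennreal (norm (g \<xi>) powr p) \<partial>lborel) \<le> 1"
    proof -
      have "(\<integral>\<^sup>+\<xi>. ennreal (norm (g \<xi>) powr p) \<partial>lborel) = (\<integral>\<^sup>+\<xi>. ennreal ((1 / C) powr p) * ennreal (norm (f \<xi>) powr p) \<partial>lborel)"
        using C by (intro nn_integral_cong) (simp add: g_def norm_mult norm_divide powr_divide ennreal_mult'[symmetric])
      also have "\<dots> \<le> ennreal ((1 / C) powr p) * ennreal (C powr p)"
        using norm_f by (simp add: nn_integral_cmult mult_left_mono)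
      also have "\<dots> = 1" using C by (simp add: powr_divide ennreal_mult'[symmetric])
      finally show ?thesis .
    qed
    define G where "G M \<xi> = (if \<lfloor>log 2 (norm (g \<xi>))\<rfloor> \<in> {- int M..int M} then g \<xi> else 0)" for M \<xi>
    have [measurable]: "G M \<in> borel_measurable borel" for M
    proof -
      have "(\<lambda>\<xi>. \<lfloor>log 2 (norm (g \<xi>))\<rfloor>) \<in> borel \<rightarrow>\<^sub>M count_space UNIV" by measurable
      from measurable_sets[OF this, of "{- int M..int M}"]
      have [measurable]: "{\<xi>. \<lfloor>log 2 (norm (g \<xi>))\<rfloor> \<in> {- int M..int M}} \<in> sets borel" by (simp add: vimage_def)
      have "G M = (\<lambda>\<xi>. if \<xi> \<in> {\<xi>. \<lfloor>log 2 (norm (g \<xi>))\<rfloor> \<in> {- int M..int M}} then g \<xi> else 0)"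
        by (auto simp: G_def)
      also have "\<dots> \<in> borel_measurable borel" by measurable
      finally show ?thesis .
    qed
    have G_le: "norm (G M \<xi>) \<le> norm (g \<xi>)" for M \<xi> by (simp add: G_def)
    have G_bound: "Lq_le lborel (2 * \<sigma>) (extension_op (G M)) (strong_const \<sigma>)" for M
    proof (rule strong_estimate_levels[OF \<sigma>, where S="{- int M..int M}"])
      show "integrable lborel (G M)"
        by (rule Bochner_Integration.integrable_bound[OF int_g]) (use G_le in auto)
      have "(\<integral>\<^sup>+\<xi>. ennreal (norm (G M \<xi>) powr p) \<partial>lborel) \<le> (\<integral>\<^sup>+\<xi>. ennreal (norm (g \<xi>) powr p) \<partial>lborel)"
        using p G_le by (intro nn_integral_mono ennreal_leI powr_mono2) auto
      then show "(\<integral>\<^sup>+\<xi>. ennreal (norm (G M \<xi>) powr (\<sigma> / (\<sigma> - 1))) \<partial>lborel) \<le> 1"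
        using norm_g unfolding p_def by (rule order_trans)
    qed (auto simp: G_def split: if_splits)
    have g_bound: "Lq_le lborel (2 * \<sigma>) (extension_op g) (strong_const \<sigma>)"
    proof (rule Lq_le_AE_limit[OF G_bound])
      show "AE z in lborel. (\<lambda>M. extension_op (G M) z) \<longlonglongrightarrow> extension_op g z"
      proof (rule AE_I2, rule extension_op_tendsto[where w="\<lambda>\<xi>. norm (g \<xi>)"])
        show "integrable lborel (\<lambda>\<xi>. norm (g \<xi>))" using int_g by simp
        show "AE \<xi> in lborel. (\<lambda>M. G M \<xi>) \<longlonglongrightarrow> g \<xi>"
        proof (rule AE_I2)
          fix \<xi>
          have "eventually (\<lambda>M. G M \<xi> = g \<xi>) sequentially"
            using eventually_ge_at_top[of "nat \<bar>\<lfloor>log 2 (norm (g \<xi>))\<rfloor>\<bar>"]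
            by eventually_elim (auto simp: G_def)
          then show "(\<lambda>M. G M \<xi>) \<longlonglongrightarrow> g \<xi>" by (rule tendsto_eventually)
        qed
      qed (use G_le in auto)
    qed (use \<sigma>0 borel_measurable_extension_op[of g] in auto)
    have "extension_op f = (\<lambda>z. of_real C * extension_op g z)"
      unfolding g_def using f C by (intro ext, subst extension_op_cmult) auto
    then show ?thesis
      using Lq_le_cmult[OF g_bound, of "of_real C"] C by (simp add: mult.commute)
  qed
  show ?thesis
  proof (rule Lq_le_epsilon)
    fix e :: real assume e: "0 < e"
    define d where "d = e / (strong_const \<sigma> + 1)"
    have d: "0 < d" using e strong_const_nonneg[of \<sigma>] by (simp add: d_def)
    have "(\<integral>\<^sup>+\<xi>. ennreal (norm (f \<xi>) powr p) \<partial>lborel) \<le> ennreal (C powr p)"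
      using norm_f by (simp add: p_def)
    also have "\<dots> \<le> ennreal ((C + d) powr p)" using C d p by (intro ennreal_leI powr_mono2) auto
    finally have "Lq_le lborel (2 * \<sigma>) (extension_op f) (strong_const \<sigma> * (C + d))"
      using C d by (intro pos) auto
    moreover have "strong_const \<sigma> * (C + d) \<le> strong_const \<sigma> * C + e"
    proof -
      have "strong_const \<sigma> * d \<le> (strong_const \<sigma> + 1) * d" using d by (intro mult_right_mono) auto
      also have "\<dots> = e" using strong_const_nonneg[of \<sigma>] by (simp add: d_def)
      finally show ?thesis by (simp add: distrib_left)
    qed
    ultimately show "Lq_le lborel (2 * \<sigma>) (extension_op f) (strong_const \<sigma> * C + e)"
      using \<sigma>0 by (elim Lq_le_mono_bound) auto
  qed (use C strong_const_nonneg[of \<sigma>] \<sigma>0 in auto)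
qed

end

section \<open>Extension by density\<close>

lemma Lq_le_zero_iff:
  assumes "0 < q"
  shows "Lq_le M q f 0 \<longleftrightarrow> f \<in> borel_measurable M \<and> (AE x in M. f x = 0)"
  using assms by (auto simp: Lq_le_def nn_integral_0_iff_AE)

lemma Lq_le_minus_commute:
  "Lq_le M q (\<lambda>x. f x - g x) C \<longleftrightarrow> Lq_le M q (\<lambda>x. g x - f x) C"
proof -
  have "Lq_le M q (\<lambda>x. g x - f x) C" if "Lq_le M q (\<lambda>x. f x - g x) C" for f g :: "'a \<Rightarrow> complex"
    using Lq_le_cmult[OF that, of "-1"] by simp
  then show ?thesis by blast
qed

lemma Lq_le_cong_AE:
  assumes "Lq_le M q f C" "g \<in> borel_measurable M" "AE x in M. f x = g x"
  shows "Lq_le M q g C"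
proof -
  have "(\<integral>\<^sup>+x. ennreal (norm (g x) powr q) \<partial>M) = (\<integral>\<^sup>+x. ennreal (norm (f x) powr q) \<partial>M)"
    by (rule nn_integral_cong_AE) (use assms(3) in \<open>auto elim: eventually_mono\<close>)
  then show ?thesis using assms by (simp add: Lq_le_def)
qed

definition Lq_tendsto :: "'a measure \<Rightarrow> real \<Rightarrow> (nat \<Rightarrow> 'a \<Rightarrow> complex) \<Rightarrow> ('a \<Rightarrow> complex) \<Rightarrow> bool" where
  "Lq_tendsto M q F f \<longleftrightarrow> f \<in> borel_measurable M \<and>
     (\<forall>e>0. \<exists>N. \<forall>n\<ge>N. Lq_le M q (\<lambda>x. F n x - f x) e)"

lemma Lq_tendsto_add:
  assumes "Lq_tendsto M q F f" "Lq_tendsto M q G g" "1 \<le> q"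
  shows "Lq_tendsto M q (\<lambda>n x. F n x + G n x) (\<lambda>x. f x + g x)"
  unfolding Lq_tendsto_def
proof (intro conjI allI impI)
  show "(\<lambda>x. f x + g x) \<in> borel_measurable M" using assms by (auto simp: Lq_tendsto_def)
  fix e :: real assume e: "0 < e"
  obtain N where N: "\<And>n. n \<ge> N \<Longrightarrow> Lq_le M q (\<lambda>x. F n x - f x) (e / 2)"
    using assms(1) e unfolding Lq_tendsto_def by (meson half_gt_zero)
  obtain N' where N': "\<And>n. n \<ge> N' \<Longrightarrow> Lq_le M q (\<lambda>x. G n x - g x) (e / 2)"
    using assms(2) e unfolding Lq_tendsto_def by (meson half_gt_zero)
  show "\<exists>N. \<forall>n\<ge>N. Lq_le M q (\<lambda>x. F n x + G n x - (f x + g x)) e"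
  proof (intro exI allI impI)
    fix n assume "max N N' \<le> n"
    then have "Lq_le M q (\<lambda>x. (F n x - f x) + (G n x - g x)) (e / 2 + e / 2)"
      using assms(3) by (intro Lq_le_add N N') auto
    then show "Lq_le M q (\<lambda>x. F n x + G n x - (f x + g x)) e" by (simp add: algebra_simps)
  qed
qed

lemma Lq_tendsto_cmult:
  assumes "Lq_tendsto M q F f" "0 < q"
  shows "Lq_tendsto M q (\<lambda>n x. c * F n x) (\<lambda>x. c * f x)"
  unfolding Lq_tendsto_def
proof (intro conjI allI impI)
  show "(\<lambda>x. c * f x) \<in> borel_measurable M" using assms by (auto simp: Lq_tendsto_def)
  fix e :: real assume e: "0 < e"
  then have "0 < e / (norm c + 1)" by (simp add: add_nonneg_pos)
  then obtain N where N: "\<And>n. n \<ge> N \<Longrightarrow> Lq_le M q (\<lambda>x. F n x - f x) (e / (norm c + 1))"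
    using assms(1) unfolding Lq_tendsto_def by meson
  have "0 < norm c + 1" by (simp add: add_nonneg_pos)
  then have "norm c * (e / (norm c + 1)) \<le> e" using e by (simp add: divide_le_eq algebra_simps)
  then show "\<exists>N. \<forall>n\<ge>N. Lq_le M q (\<lambda>x. c * F n x - c * f x) e"
    using Lq_le_mono_bound[OF Lq_le_cmult[OF N, of _ c] _ assms(2)]
    by (intro exI[of _ N]) (simp add: right_diff_distrib)
qed

lemma Lq_tendsto_unique:
  assumes F: "Lq_tendsto M q F f" and G: "Lq_tendsto M q F g" and q: "1 \<le> q"
  shows "AE x in M. f x = g x"
proof -
  have "Lq_le M q (\<lambda>x. f x - g x) 0"
  proof (rule Lq_le_epsilon)
    fix e :: real assume e: "0 < e"
    obtain N where N: "\<And>n. n \<ge> N \<Longrightarrow> Lq_le M q (\<lambda>x. F n x - f x) (e / 2)"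
      using F e unfolding Lq_tendsto_def by (meson half_gt_zero)
    obtain N' where N': "\<And>n. n \<ge> N' \<Longrightarrow> Lq_le M q (\<lambda>x. F n x - g x) (e / 2)"
      using G e unfolding Lq_tendsto_def by (meson half_gt_zero)
    let ?n = "max N N'"
    have "Lq_le M q (\<lambda>x. (f x - F ?n x) + (F ?n x - g x)) (e / 2 + e / 2)"
      using q by (intro Lq_le_add N' Lq_le_minus_commute[THEN iffD1, OF N]) auto
    then show "Lq_le M q (\<lambda>x. f x - g x) (0 + e)" by simp
  qed (use q in auto)
  then show ?thesis using q by (auto simp: Lq_le_zero_iff)
qed

lemma Lq_le_of_Lq_tendsto:
  assumes F: "Lq_tendsto M q F f" and le: "\<And>n. Lq_le M q (F n) (C n)" and C: "C \<longlonglongrightarrow> D" and q: "1 \<le> q"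
  shows "Lq_le M q f D"
proof (rule Lq_le_epsilon)
  show "0 \<le> D" using C Lq_leD(2)[OF le] by (intro LIMSEQ_le_const[OF C]) auto
  fix e :: real assume e: "0 < e"
  obtain N where N: "\<And>n. n \<ge> N \<Longrightarrow> Lq_le M q (\<lambda>x. F n x - f x) (e / 2)"
    using F e unfolding Lq_tendsto_def by (meson half_gt_zero)
  have "eventually (\<lambda>n. C n < D + e / 2) sequentially"
    using C e by (intro order_tendstoD(2)[OF C]) auto
  then obtain N' where N': "\<And>n. n \<ge> N' \<Longrightarrow> C n < D + e / 2" by (auto simp: eventually_sequentially)
  let ?n = "max N N'"
  have "Lq_le M q (\<lambda>x. (f x - F ?n x) + F ?n x) (e / 2 + C ?n)"
    using q by (intro Lq_le_add le Lq_le_minus_commute[THEN iffD1, OF N]) auto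
  then have "Lq_le M q f (e / 2 + C ?n)" by simp
  then show "Lq_le M q f (D + e)"
    using N'[of ?n] q by (elim Lq_le_mono_bound) (auto simp: less_imp_le)
qed (use q in auto)

text \<open>
  The Riesz-Fischer argument: along a rapidly converging subsequence the increments are absolutely summable
  almost everywhere, and Fatou's lemma turns the pointwise limit into a limit in norm.
\<close>

lemma Lq_complete:
  fixes F :: "nat \<Rightarrow> 'a \<Rightarrow> complex"
  assumes q: "1 \<le> q" and [measurable]: "\<And>n. F n \<in> borel_measurable M"
    and cauchy: "\<And>e. 0 < e \<Longrightarrow> \<exists>N. \<forall>m\<ge>N. \<forall>n\<ge>N. Lq_le M q (\<lambda>x. F m x - F n x) e"
  shows "\<exists>f. Lq_tendsto M q F f"
proof -
  have q0: "0 < q" using q by simp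
  have "\<forall>k. \<exists>N. \<forall>m\<ge>N. \<forall>n\<ge>N. Lq_le M q (\<lambda>x. F m x - F n x) ((1 / 2) ^ k)"
    using cauchy by simp
  then obtain N0 where N0: "\<And>k m n. m \<ge> N0 k \<Longrightarrow> n \<ge> N0 k \<Longrightarrow> Lq_le M q (\<lambda>x. F m x - F n x) ((1 / 2) ^ k)"
    by metis
  define N where "N k = k + (\<Sum>i\<le>k. N0 i)" for k
  have N_ge: "N0 k \<le> N k" "k \<le> N k" for k
    unfolding N_def using member_le_sum[of k "{..k}" N0] by auto
  have N_mono: "N k \<le> N (Suc k)" for k by (simp add: N_def)
  define g where "g k x = F (N (Suc k)) x - F (N k) x" for k x
  have [measurable]: "g k \<in> borel_measurable M" for k unfolding g_def[abs_def] by measurable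
  have g_le: "Lq_le M q (g k) ((1 / 2) ^ k)" for k
    unfolding g_def using N_ge(1)[of k] N_mono[of k] by (intro N0) auto
  define G where "G K x = (\<Sum>k<K. complex_of_real (norm (g k x)))" for K x
  have [measurable]: "G K \<in> borel_measurable M" for K unfolding G_def[abs_def] by measurable
  have norm_G: "norm (G K x) = (\<Sum>k<K. norm (g k x))" for K x
    unfolding G_def of_real_sum[symmetric] norm_of_real by (simp add: sum_nonneg)
  have G_le: "Lq_le M q (G K) 2" for K
  proof -
    have "Lq_le M q (G K) (\<Sum>k<K. (1 / 2) ^ k)"
      unfolding G_def
      by (intro Lq_le_sum q Lq_le_mono[OF g_le]) (use q in auto)
    moreover have "(\<Sum>k<K. (1 / 2) ^ k) \<le> (2 :: real)"
      by (simp add: sum_gp_strict)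
    ultimately show ?thesis using q0 by (rule Lq_le_mono_bound)
  qed
  have "(\<integral>\<^sup>+x. (SUP K. ennreal (norm (G K x) powr q)) \<partial>M) \<le> ennreal (2 powr q)"
  proof -
    have "incseq (\<lambda>K x. ennreal (norm (G K x) powr q))"
      unfolding incseq_def le_fun_def norm_G using q0
      by (intro allI impI ennreal_leI powr_mono2 sum_mono2) (auto intro!: sum_nonneg)
    then have "(\<integral>\<^sup>+x. (SUP K. ennreal (norm (G K x) powr q)) \<partial>M) = (SUP K. \<integral>\<^sup>+x. ennreal (norm (G K x) powr q) \<partial>M)"
      by (intro nn_integral_monotone_convergence_SUP) auto
    also have "\<dots> \<le> ennreal (2 powr q)" using Lq_leD(3)[OF G_le] by (intro SUP_least) auto
    finally show ?thesis .
  qed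
  then have "(\<integral>\<^sup>+x. (SUP K. ennreal (norm (G K x) powr q)) \<partial>M) \<noteq> \<infinity>"
    by (auto simp: top_unique)
  then have fin: "AE x in M. (SUP K. ennreal (norm (G K x) powr q)) \<noteq> \<infinity>"
    by (intro nn_integral_PInf_AE) auto
  have conv: "AE x in M. convergent (\<lambda>k. F (N k) x)"
    using fin
  proof eventually_elim
    case (elim x)
    then obtain B where B: "(SUP K. ennreal (norm (G K x) powr q)) = ennreal B" "0 \<le> B"
      by (cases "SUP K. ennreal (norm (G K x) powr q)") auto
    have "norm (G K x) \<le> B powr (1 / q)" for K
    proof -
      have "ennreal (norm (G K x) powr q) \<le> ennreal B" unfolding B(1)[symmetric] by (rule SUP_upper) simp
      then have "norm (G K x) powr q \<le> B" using B(2) by simp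
      then have "(norm (G K x) powr q) powr (1 / q) \<le> B powr (1 / q)" using q0 by (intro powr_mono2) auto
      then show ?thesis using q0 by (simp add: powr_powr)
    qed
    then have "summable (\<lambda>k. norm (g k x))"
      unfolding norm_G by (intro summableI_nonneg_bounded[where x="B powr (1 / q)"]) auto
    then have "summable (\<lambda>k. g k x)" by (rule summable_norm_cancel)
    then have "convergent (\<lambda>n. \<Sum>k<n. g k x)" by (simp add: summable_iff_convergent)
    moreover have "(\<Sum>k<n. g k x) = F (N n) x - F (N 0) x" for n
      unfolding g_def by (rule sum_lessThan_telescope)
    ultimately have "convergent (\<lambda>n. F (N n) x - F (N 0) x)" by simp
    then show ?case using convergent_add[OF _ convergent_const, of _ "F (N 0) x"] by fastforce
  qed
  define f where "f x = lim (\<lambda>k. F (N k) x)" for x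
  have f[measurable]: "f \<in> borel_measurable M" unfolding f_def[abs_def] by measurable
  have "Lq_tendsto M q F f"
    unfolding Lq_tendsto_def
  proof (intro conjI allI impI f)
    fix e :: real assume "0 < e"
    then obtain L where L: "\<And>m n. m \<ge> L \<Longrightarrow> n \<ge> L \<Longrightarrow> Lq_le M q (\<lambda>x. F m x - F n x) e"
      using cauchy by meson
    show "\<exists>L. \<forall>n\<ge>L. Lq_le M q (\<lambda>x. F n x - f x) e"
    proof (intro exI allI impI)
      fix n assume n: "L \<le> n"
      show "Lq_le M q (\<lambda>x. F n x - f x) e"
      proof (rule Lq_le_AE_limit)
        show "Lq_le M q (\<lambda>x. F n x - F (N (L + k)) x) e" for k
          using N_ge(2)[of "L + k"] n by (intro L) auto
        show "AE x in M. (\<lambda>k. F n x - F (N (L + k)) x) \<longlonglongrightarrow> F n x - f x"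
          using conv
        proof eventually_elim
          case (elim x)
          then have "(\<lambda>k. F (N k) x) \<longlonglongrightarrow> f x" by (simp add: f_def convergent_LIMSEQ_iff)
          then have "(\<lambda>k. F (N (k + L)) x) \<longlonglongrightarrow> f x" by (rule LIMSEQ_ignore_initial_segment)
          then show ?case by (intro tendsto_intros) (simp add: add.commute)
        qed
      qed (use q0 in auto)
    qed
  qed
  then show ?thesis by blast
qed

lemma bounded_compact_support_iff:
  "f \<in> bounded_compact_support \<longleftrightarrow> f \<in> borel_measurable lebesgue \<and> bounded (range f) \<and> bounded {x. f x \<noteq> 0}"
  by (simp add: bounded_compact_support_def compact_closure)

lemma bounded_compact_support_add:
  assumes f: "f \<in> bounded_compact_support" and g: "g \<in> bounded_compact_support"
  shows "(\<lambda>x. f x + g x) \<in> bounded_compact_support"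
proof -
  obtain a b where ab: "\<And>x. norm (f x) \<le> a" "\<And>x. norm (g x) \<le> b"
    using f g by (auto simp: bounded_compact_support_iff bounded_iff)
  have "bounded (range (\<lambda>x. f x + g x))"
    unfolding bounded_iff using ab by (intro exI[of _ "a + b"]) (auto intro!: order_trans[OF norm_triangle_ineq] add_mono)
  moreover have "bounded {x. f x + g x \<noteq> 0}"
    by (rule bounded_subset[of "{x. f x \<noteq> 0} \<union> {x. g x \<noteq> 0}"])
      (use f g in \<open>auto simp: bounded_compact_support_iff\<close>)
  ultimately show ?thesis using f g by (auto simp: bounded_compact_support_iff)
qed

lemma bounded_compact_support_cmult:
  assumes f: "f \<in> bounded_compact_support"
  shows "(\<lambda>x. c * f x) \<in> bounded_compact_support"
proof -
  obtain a where a: "\<And>x. norm (f x) \<le> a" using f by (auto simp: bounded_compact_support_iff bounded_iff)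
  have "bounded (range (\<lambda>x. c * f x))"
    unfolding bounded_iff using a by (intro exI[of _ "norm c * a"]) (auto simp: norm_mult mult_left_mono)
  moreover have "bounded {x. c * f x \<noteq> 0}"
    by (rule bounded_subset[of "{x. f x \<noteq> 0}"]) (use f in \<open>auto simp: bounded_compact_support_iff\<close>)
  ultimately show ?thesis using f by (auto simp: bounded_compact_support_iff)
qed

lemma bounded_compact_support_Lq_le:
  fixes f :: "'a::euclidean_space \<Rightarrow> complex"
  assumes f: "f \<in> bounded_compact_support" and p: "0 < p"
  shows "\<exists>C. Lq_le lebesgue p f C"
proof -
  obtain a where a: "\<And>x. norm (f x) \<le> a" using f by (auto simp: bounded_compact_support_iff bounded_iff)
  have a0: "0 \<le> a" using a[of undefined] norm_ge_zero order_trans by blast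
  obtain R where R: "\<And>x. f x \<noteq> 0 \<Longrightarrow> norm x \<le> R" using f by (auto simp: bounded_compact_support_iff bounded_iff)
  have cb: "cball (0::'a) R \<in> sets lebesgue" "emeasure lebesgue (cball (0::'a) R) < \<infinity>"
    using lmeasurable_cball[of "0::'a" R] by (auto simp: fmeasurable_def)
  have "(\<integral>\<^sup>+x. ennreal (norm (f x) powr p) \<partial>lebesgue) \<le> (\<integral>\<^sup>+x. ennreal (a powr p) * indicator (cball (0::'a) R) x \<partial>lebesgue)"
    using a a0 R p by (intro nn_integral_mono) (auto simp: indicator_def intro!: ennreal_leI powr_mono2)
  also have "\<dots> = ennreal (a powr p) * emeasure lebesgue (cball (0::'a) R)"
    by (rule nn_integral_cmult_indicator) (rule cb)
  also have "\<dots> < \<infinity>" using cb by (simp add: ennreal_mult_less_top)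
  finally obtain I where I: "(\<integral>\<^sup>+x. ennreal (norm (f x) powr p) \<partial>lebesgue) = ennreal I" "0 \<le> I"
    by (cases "\<integral>\<^sup>+x. ennreal (norm (f x) powr p) \<partial>lebesgue") auto
  then have "Lq_le lebesgue p f (I powr (1 / p))"
    using p f by (simp add: Lq_le_def powr_powr bounded_compact_support_iff)
  then show ?thesis ..
qed

lemma bounded_compact_support_dense:
  fixes f :: "'a::euclidean_space \<Rightarrow> complex"
  assumes p: "0 < p" and f: "Lq_le lebesgue p f C"
  obtains F where "\<And>n. F n \<in> bounded_compact_support" "\<And>n x. norm (F n x) \<le> norm (f x)" "Lq_tendsto lebesgue p F f"
proof -
  have [measurable]: "f \<in> borel_measurable lebesgue" using Lq_leD(1)[OF f] .
  define F where "F n x = (if norm (f x) \<le> real n \<and> norm x \<le> real n then f x else 0)" for n :: nat and x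
  have [measurable]: "(\<lambda>x::'a. norm x) \<in> borel_measurable lebesgue" by (intro measurable_completion) simp
  have F_meas[measurable]: "F n \<in> borel_measurable lebesgue" for n unfolding F_def[abs_def] by measurable
  have bcs: "F n \<in> bounded_compact_support" for n
  proof -
    have "bounded (range (F n))" unfolding bounded_iff by (intro exI[of _ "real n"]) (auto simp: F_def)
    moreover have "bounded {x. F n x \<noteq> 0}" unfolding bounded_iff by (intro exI[of _ "real n"]) (auto simp: F_def split: if_splits)
    ultimately show ?thesis by (simp add: bounded_compact_support_iff)
  qed
  have F_le: "norm (F n x) \<le> norm (f x)" for n x by (simp add: F_def)
  have diff_le: "norm (F n x - f x) \<le> norm (f x)" for n x by (simp add: F_def)
  have "(\<lambda>n. \<integral>\<^sup>+x. ennreal (norm (F n x - f x) powr p) \<partial>lebesgue) \<longlonglongrightarrow> (\<integral>\<^sup>+(x::'a). 0 \<partial>lebesgue)"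
  proof (rule nn_integral_dominated_convergence[where w="\<lambda>x. ennreal (norm (f x) powr p)"])
    show "(\<integral>\<^sup>+x. ennreal (norm (f x) powr p) \<partial>lebesgue) < \<infinity>"
      using Lq_leD(3)[OF f] by (rule le_less_trans) simp
    show "AE x in lebesgue. ennreal (norm (F n x - f x) powr p) \<le> ennreal (norm (f x) powr p)" for n
      using p by (intro AE_I2 ennreal_leI powr_mono2 diff_le) auto
    show "AE x in lebesgue. (\<lambda>n. ennreal (norm (F n x - f x) powr p)) \<longlonglongrightarrow> 0"
    proof (rule AE_I2)
      fix x
      obtain k :: nat where k: "max (norm (f x)) (norm x) \<le> real k" using real_arch_simple by blast
      have "eventually (\<lambda>n. ennreal (norm (F n x - f x) powr p) = 0) sequentially"
        using eventually_ge_at_top[of k]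
      proof eventually_elim
        case (elim n)
        then have "real k \<le> real n" by simp
        then show ?case using k by (simp add: F_def)
      qed
      then show "(\<lambda>n. ennreal (norm (F n x - f x) powr p)) \<longlonglongrightarrow> 0" by (rule tendsto_eventually)
    qed
  qed measurable
  then have lim: "(\<lambda>n. \<integral>\<^sup>+x. ennreal (norm (F n x - f x) powr p) \<partial>lebesgue) \<longlonglongrightarrow> 0" by simp
  have "Lq_tendsto lebesgue p F f"
    unfolding Lq_tendsto_def
  proof (intro conjI allI impI)
    fix e :: real assume e: "0 < e"
    then have "eventually (\<lambda>n. (\<integral>\<^sup>+x. ennreal (norm (F n x - f x) powr p) \<partial>lebesgue) < ennreal (e powr p)) sequentially"
      by (intro order_tendstoD(2)[OF lim]) simp
    then show "\<exists>N. \<forall>n\<ge>N. Lq_le lebesgue p (\<lambda>x. F n x - f x) e"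
      using e unfolding eventually_sequentially Lq_le_def by (auto intro: less_imp_le)
  qed measurable
  then show thesis using that[of F] bcs F_le by blast
qed

lemma Lp_imp_Lq_le:
  assumes "f \<in> Lp (ennreal p)" "0 < p"
  obtains C where "Lq_le lebesgue p f C" "Lp_norm (ennreal p) f = ennreal C"
proof -
  have "Lp_norm (ennreal p) f < \<infinity>" and f: "f \<in> borel_measurable lebesgue" using assms by (auto simp: Lp_def)
  then obtain C where C: "Lp_norm (ennreal p) f = ennreal C" "0 \<le> C"
    by (cases "Lp_norm (ennreal p) f") auto
  then show thesis using Lp_norm_le_iff[OF assms(2) C(2) f] that[of C] by simp
qed

lemma Lq_le_imp_Lp:
  fixes f :: "'a::euclidean_space \<Rightarrow> complex"
  assumes "Lq_le lebesgue p f C" "0 < p"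
  shows "f \<in> Lp (ennreal p)" "Lp_norm (ennreal p) f \<le> ennreal C"
proof -
  show le: "Lp_norm (ennreal p) f \<le> ennreal C"
    using Lp_norm_le_iff[OF assms(2) Lq_leD(2,1)[OF assms(1)]] assms(1) by simp
  then show "f \<in> Lp (ennreal p)"
    using Lq_leD(1)[OF assms(1)] by (auto simp: Lp_def intro: le_less_trans)
qed

text \<open>
  The extension maps \<open>f\<close> to the common limit of \<open>T (F n)\<close> over all sequences \<open>F\<close> of bounded functions of compact
  support that tend to \<open>f\<close>. Since the limit does not depend on the sequence, linearity and agreement with \<open>T\<close>
  follow by comparing particular sequences.
\<close>

lemma extension_by_density:
  fixes T :: "('a::euclidean_space \<Rightarrow> complex) \<Rightarrow> 'b::euclidean_space \<Rightarrow> complex"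
  assumes p: "1 \<le> p" and q: "1 \<le> q" and K: "0 \<le> K"
    and add: "\<And>f g y. f \<in> bounded_compact_support \<Longrightarrow> g \<in> bounded_compact_support \<Longrightarrow> T (\<lambda>x. f x + g x) y = T f y + T g y"
    and cmult: "\<And>c f y. f \<in> bounded_compact_support \<Longrightarrow> T (\<lambda>x. c * f x) y = c * T f y"
    and bound: "\<And>f C. f \<in> bounded_compact_support \<Longrightarrow> Lq_le lebesgue p f C \<Longrightarrow> Lq_le lebesgue q (T f) (K * C)"
    and meas: "\<And>f. f \<in> bounded_compact_support \<Longrightarrow> T f \<in> borel_measurable lebesgue"
  shows "extends_to_bounded_operator T (ennreal p) (ennreal q)"
proof -
  have p0: "0 < p" and q0: "0 < q" using p q by auto
  let ?bcs = "bounded_compact_support :: ('a \<Rightarrow> complex) set"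
  have T_diff: "T (\<lambda>x. f x - g x) y = T f y - T g y" if "f \<in> ?bcs" "g \<in> ?bcs" for f g y
    using add[OF that(1) bounded_compact_support_cmult[OF that(2), of "-1"], of y] cmult[OF that(2), of "-1" y] by simp
  have bcs_diff: "(\<lambda>x. f x - g x) \<in> ?bcs" if "f \<in> ?bcs" "g \<in> ?bcs" for f g
    using bounded_compact_support_add[OF that(1) bounded_compact_support_cmult[OF that(2), of "-1"]] by simp
  have small: "\<exists>e'>0. K * e' \<le> e" if "0 < e" for e :: real
    using that K by (intro exI[of _ "e / (K + 1)"]) (auto simp: field_simps)
  have T_diff_bound: "Lq_le lebesgue q (\<lambda>y. T f y - T g y) e"
    if "f \<in> ?bcs" "g \<in> ?bcs" "Lq_le lebesgue p (\<lambda>x. f x - g x) e'" "K * e' \<le> e" for f g e e'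
    using Lq_le_mono_bound[OF bound[OF bcs_diff[OF that(1,2)] that(3)] that(4) q0]
    by (simp add: T_diff[OF that(1,2), abs_def])
  have limit_exists: "\<exists>h. Lq_tendsto lebesgue q (\<lambda>n. T (F n)) h" if F: "\<And>n. F n \<in> ?bcs" "Lq_tendsto lebesgue p F f" for F f
  proof (rule Lq_complete[OF q meas[OF F(1)]])
    fix e :: real assume "0 < e"
    then obtain e' where e': "0 < e'" "K * e' \<le> e" using small by blast
    obtain N where N: "\<And>n. n \<ge> N \<Longrightarrow> Lq_le lebesgue p (\<lambda>x. F n x - f x) (e' / 2)"
      using F(2) e'(1) unfolding Lq_tendsto_def by (meson half_gt_zero)
    show "\<exists>N. \<forall>m\<ge>N. \<forall>n\<ge>N. Lq_le lebesgue q (\<lambda>y. T (F m) y - T (F n) y) e"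
    proof (intro exI allI impI)
      fix m n assume mn: "N \<le> m" "N \<le> n"
      have "Lq_le lebesgue p (\<lambda>x. (F m x - f x) + (f x - F n x)) (e' / 2 + e' / 2)"
        using mn p by (intro Lq_le_add N Lq_le_minus_commute[THEN iffD1, OF N])
      then show "Lq_le lebesgue q (\<lambda>y. T (F m) y - T (F n) y) e"
        using e'(2) by (intro T_diff_bound F(1)) auto
    qed
  qed
  have limit_indep: "Lq_tendsto lebesgue q (\<lambda>n. T (G n)) h"
    if F: "\<And>n. F n \<in> ?bcs" "Lq_tendsto lebesgue p F f" and h: "Lq_tendsto lebesgue q (\<lambda>n. T (F n)) h"
      and G: "\<And>n. G n \<in> ?bcs" "Lq_tendsto lebesgue p G f" for F G f h
    unfolding Lq_tendsto_def
  proof (intro conjI allI impI)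
    show "h \<in> borel_measurable lebesgue" using h by (simp add: Lq_tendsto_def)
    fix e :: real assume e: "0 < e"
    then obtain e' where e': "0 < e'" "K * e' \<le> e / 2" using small[of "e / 2"] by auto
    obtain N1 where N1: "\<And>n. n \<ge> N1 \<Longrightarrow> Lq_le lebesgue p (\<lambda>x. F n x - f x) (e' / 2)"
      using F(2) e'(1) unfolding Lq_tendsto_def by (meson half_gt_zero)
    obtain N2 where N2: "\<And>n. n \<ge> N2 \<Longrightarrow> Lq_le lebesgue p (\<lambda>x. G n x - f x) (e' / 2)"
      using G(2) e'(1) unfolding Lq_tendsto_def by (meson half_gt_zero)
    obtain N3 where N3: "\<And>n. n \<ge> N3 \<Longrightarrow> Lq_le lebesgue q (\<lambda>y. T (F n) y - h y) (e / 2)"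
      using h e unfolding Lq_tendsto_def by (meson half_gt_zero)
    show "\<exists>N. \<forall>n\<ge>N. Lq_le lebesgue q (\<lambda>y. T (G n) y - h y) e"
    proof (intro exI allI impI)
      fix n assume n: "max N1 (max N2 N3) \<le> n"
      have "Lq_le lebesgue p (\<lambda>x. (G n x - f x) + (f x - F n x)) (e' / 2 + e' / 2)"
        using n p by (intro Lq_le_add N2 Lq_le_minus_commute[THEN iffD1, OF N1]) auto
      then have "Lq_le lebesgue q (\<lambda>y. T (G n) y - T (F n) y) (e / 2)"
        using e'(2) by (intro T_diff_bound F(1) G(1)) auto
      then have "Lq_le lebesgue q (\<lambda>y. (T (G n) y - T (F n) y) + (T (F n) y - h y)) (e / 2 + e / 2)"
        using n q by (intro Lq_le_add N3) auto
      then show "Lq_le lebesgue q (\<lambda>y. T (G n) y - h y) e" by simp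
    qed
  qed
  have "\<forall>f\<in>Lp (ennreal p). \<exists>h. \<forall>F. (\<forall>n. F n \<in> ?bcs) \<and> Lq_tendsto lebesgue p F f \<longrightarrow> Lq_tendsto lebesgue q (\<lambda>n. T (F n)) h"
  proof
    fix f :: "'a \<Rightarrow> complex" assume "f \<in> Lp (ennreal p)"
    then obtain C where C: "Lq_le lebesgue p f C" by (rule Lp_imp_Lq_le[OF _ p0])
    obtain F where "\<And>n x. norm (F n x) \<le> norm (f x)" and F: "\<And>n. F n \<in> ?bcs" "Lq_tendsto lebesgue p F f"
      by (rule bounded_compact_support_dense[OF p0 C]) (rule that)
    then show "\<exists>h. \<forall>F. (\<forall>n. F n \<in> ?bcs) \<and> Lq_tendsto lebesgue p F f \<longrightarrow> Lq_tendsto lebesgue q (\<lambda>n. T (F n)) h"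
      using limit_exists[OF F] limit_indep[OF F] by blast
  qed
  then obtain S where S: "\<And>f F. f \<in> Lp (ennreal p) \<Longrightarrow> (\<And>n. F n \<in> ?bcs) \<Longrightarrow> Lq_tendsto lebesgue p F f
      \<Longrightarrow> Lq_tendsto lebesgue q (\<lambda>n. T (F n)) (S f)"
    by metis
  have Lp_add: "(\<lambda>x. f x + g x) \<in> Lp (ennreal p)" if f: "f \<in> Lp (ennreal p)" and g: "g \<in> Lp (ennreal p)" for f g :: "'a \<Rightarrow> complex"
  proof -
    obtain C where C: "Lq_le lebesgue p f C" by (rule Lp_imp_Lq_le[OF f p0])
    obtain D where D: "Lq_le lebesgue p g D" by (rule Lp_imp_Lq_le[OF g p0])
    show ?thesis by (rule Lq_le_imp_Lp(1)[OF Lq_le_add[OF C D p] p0])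
  qed
  have Lp_cmult: "(\<lambda>x. c * f x) \<in> Lp (ennreal p)" if f: "f \<in> Lp (ennreal p)" for c and f :: "'a \<Rightarrow> complex"
  proof -
    obtain C where C: "Lq_le lebesgue p f C" by (rule Lp_imp_Lq_le[OF f p0])
    show ?thesis by (rule Lq_le_imp_Lp(1)[OF Lq_le_cmult[OF C] p0])
  qed
  have approx: "\<exists>F. (\<forall>n. F n \<in> ?bcs) \<and> (\<forall>n x. norm (F n x) \<le> norm (f x)) \<and> Lq_tendsto lebesgue p F f"
    if f: "f \<in> Lp (ennreal p)" for f
  proof -
    obtain C where C: "Lq_le lebesgue p f C" by (rule Lp_imp_Lq_le[OF f p0])
    obtain F where "\<And>n. F n \<in> ?bcs" "\<And>n x. norm (F n x) \<le> norm (f x)" "Lq_tendsto lebesgue p F f"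
      by (rule bounded_compact_support_dense[OF p0 C]) (rule that)
    then show ?thesis by blast
  qed
  have S_bound: "Lq_le lebesgue q (S f) (K * C)" if f: "f \<in> Lp (ennreal p)" "Lq_le lebesgue p f C" for f C
  proof -
    obtain F where F: "\<And>n. F n \<in> ?bcs" "\<And>n x. norm (F n x) \<le> norm (f x)" "Lq_tendsto lebesgue p F f"
      using approx[OF f(1)] by blast
    have "Lq_le lebesgue p (F n) C" for n
      using F(1)[of n] F(2) p0 by (intro Lq_le_mono[OF f(2)]) (auto simp: bounded_compact_support_iff)
    then have "Lq_le lebesgue q (T (F n)) (K * C)" for n by (intro bound F(1))
    then show ?thesis by (rule Lq_le_of_Lq_tendsto[OF S[OF f(1) F(1,3)] _ tendsto_const q])
  qed
  have S_Lp: "S f \<in> Lp (ennreal q) \<and> Lp_norm (ennreal q) (S f) \<le> ennreal K * Lp_norm (ennreal p) f"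
    if f: "f \<in> Lp (ennreal p)" for f
  proof -
    obtain C where C: "Lq_le lebesgue p f C" "Lp_norm (ennreal p) f = ennreal C" by (rule Lp_imp_Lq_le[OF f p0])
    from Lq_le_imp_Lp[OF S_bound[OF f C(1)] q0] show ?thesis
      using K by (simp add: C(2) ennreal_mult' )
  qed
  have S_add: "AE y in lebesgue. S (\<lambda>x. f x + g x) y = S f y + S g y"
    if f: "f \<in> Lp (ennreal p)" and g: "g \<in> Lp (ennreal p)" for f g
  proof -
    obtain F where F: "\<And>n. F n \<in> ?bcs" "Lq_tendsto lebesgue p F f" using approx[OF f] by blast
    obtain G where G: "\<And>n. G n \<in> ?bcs" "Lq_tendsto lebesgue p G g" using approx[OF g] by blast
    have "Lq_tendsto lebesgue q (\<lambda>n. T (\<lambda>x. F n x + G n x)) (S (\<lambda>x. f x + g x))"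
      by (intro S Lp_add f g bounded_compact_support_add F G Lq_tendsto_add p)
    then have "Lq_tendsto lebesgue q (\<lambda>n y. T (F n) y + T (G n) y) (S (\<lambda>x. f x + g x))"
      by (simp add: add[OF F(1) G(1), abs_def])
    moreover have "Lq_tendsto lebesgue q (\<lambda>n y. T (F n) y + T (G n) y) (\<lambda>y. S f y + S g y)"
      by (intro Lq_tendsto_add S f g F G q)
    ultimately show ?thesis using q by (rule Lq_tendsto_unique)
  qed
  have S_cmult: "AE y in lebesgue. S (\<lambda>x. c * f x) y = c * S f y" if f: "f \<in> Lp (ennreal p)" for c f
  proof -
    obtain F where F: "\<And>n. F n \<in> ?bcs" "Lq_tendsto lebesgue p F f" using approx[OF f] by blast
    have "Lq_tendsto lebesgue q (\<lambda>n. T (\<lambda>x. c * F n x)) (S (\<lambda>x. c * f x))"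
      by (intro S Lp_cmult f bounded_compact_support_cmult F Lq_tendsto_cmult p0)
    then have "Lq_tendsto lebesgue q (\<lambda>n y. c * T (F n) y) (S (\<lambda>x. c * f x))"
      by (simp add: cmult[OF F(1), abs_def])
    moreover have "Lq_tendsto lebesgue q (\<lambda>n y. c * T (F n) y) (\<lambda>y. c * S f y)"
      by (intro Lq_tendsto_cmult S f F q0)
    ultimately show ?thesis using q by (rule Lq_tendsto_unique)
  qed
  have S_T: "AE y in lebesgue. S f y = T f y" if f: "f \<in> ?bcs" for f
  proof -
    have fm: "f \<in> borel_measurable lebesgue" using f by (simp add: bounded_compact_support_iff)
    have zero: "Lq_tendsto M r (\<lambda>n. h) h" if "h \<in> borel_measurable M" for M :: "'z measure" and r h
      using that by (auto simp: Lq_tendsto_def Lq_le_def)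
    have "f \<in> Lp (ennreal p)"
      using bounded_compact_support_Lq_le[OF f p0] Lq_le_imp_Lp(1)[OF _ p0] by blast
    from S[OF this f zero[OF fm]] have "Lq_tendsto lebesgue q (\<lambda>n. T f) (S f)" by simp
    then show ?thesis using Lq_tendsto_unique[OF _ zero[OF meas[OF f]] q] by blast
  qed
  show ?thesis
    unfolding extends_to_bounded_operator_def
    using S_Lp S_add S_cmult S_T by (intro exI[of _ S] conjI exI[of _ K]) auto
qed

section \<open>From the bilinear hypothesis to restricted and strong type\<close>

lemma borel_representative:
  assumes "f \<in> borel_measurable lebesgue"
  obtains g :: "'a::euclidean_space \<Rightarrow> complex" where "g \<in> borel_measurable borel" "AE x in lebesgue. f x = g x"
proof -
  have "(\<lambda>x. Re (f x)) \<in> borel_measurable lebesgue" "(\<lambda>x. Im (f x)) \<in> borel_measurable lebesgue"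
    using assms by auto
  from this[THEN completion_ex_borel_measurable_real]
  obtain u v where uv: "u \<in> borel_measurable lborel" "AE x in lborel. Re (f x) = u x"
    "v \<in> borel_measurable lborel" "AE x in lborel. Im (f x) = v x" by blast
  show thesis
  proof (rule that[of "\<lambda>x. Complex (u x) (v x)"])
    have "(\<lambda>x. complex_of_real (u x) + \<i> * complex_of_real (v x)) \<in> borel_measurable borel"
      using uv(1,3) by measurable
    then show "(\<lambda>x. Complex (u x) (v x)) \<in> borel_measurable borel" by (simp add: Complex_eq)
    show "AE x in lebesgue. f x = Complex (u x) (v x)"
      using AE_completion[OF uv(2)] AE_completion[OF uv(4)] by eventually_elim (simp add: complex_eq_iff)
  qed
qed

lemma integrable_representative:
  assumes "integrable lebesgue f"
  obtains g where "integrable lborel g" "AE x in lebesgue. f x = g x" "extension_op f = extension_op g"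
proof -
  obtain g where g: "g \<in> borel_measurable borel" "AE x in lebesgue. f x = g x"
    using borel_representative[of f] assms by auto
  have gl: "g \<in> borel_measurable lebesgue" using g(1) by (intro measurable_completion) simp
  have "integrable lebesgue g"
    using assms g(2) gl by (subst integrable_cong_AE[of _ _ f]) (auto elim: eventually_mono)
  then have "integrable lborel g" using g(1) by (subst (asm) integrable_completion) auto
  moreover have "extension_op f = extension_op g"
    using assms g gl by (intro extension_op_cong_AE) auto
  ultimately show thesis using g(2) that by blast
qed

lemma extension_op_lebesgue: "extension_op f z = (\<integral>\<xi>. phase z \<xi> * f \<xi> \<partial>lebesgue)"
  by (cases z) (simp add: extension_op_def phase_def cis_conv_exp)

lemma integrable_phase_mult_lebesgue:
  assumes "integrable lebesgue f"
  shows "integrable lebesgue (\<lambda>\<xi>. phase z \<xi> * f \<xi>)"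
proof (rule Bochner_Integration.integrable_bound[OF assms])
  have "phase z \<in> borel_measurable lebesgue" by (intro measurable_completion) simp
  then show "(\<lambda>\<xi>. phase z \<xi> * f \<xi>) \<in> borel_measurable lebesgue"
    using assms by (intro borel_measurable_times) auto
qed (simp add: norm_mult)

lemma extension_op_add_lebesgue:
  assumes "integrable lebesgue f" "integrable lebesgue g"
  shows "extension_op (\<lambda>\<xi>. f \<xi> + g \<xi>) z = extension_op f z + extension_op g z"
  using assms[THEN integrable_phase_mult_lebesgue] by (simp add: extension_op_lebesgue distrib_left)

lemma extension_op_cmult_lebesgue: "extension_op (\<lambda>\<xi>. c * f \<xi>) z = c * extension_op f z"
  by (simp add: extension_op_lebesgue mult.left_commute[of _ c])

lemma borel_measurable_extension_op_lebesgue: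
  assumes "integrable lebesgue f"
  shows "extension_op f \<in> borel_measurable borel"
proof -
  obtain g where "integrable lborel g" "extension_op f = extension_op g"
    using assms by (rule integrable_representative)
  then show ?thesis using borel_measurable_extension_op[of g] by simp
qed

lemma measurable_lebesgue_of_borel: "f \<in> borel_measurable borel \<Longrightarrow> f \<in> borel_measurable lebesgue"
  by (intro measurable_completion) simp

lemma bounded_compact_support_integrable:
  fixes f :: "'a::euclidean_space \<Rightarrow> complex"
  assumes "f \<in> bounded_compact_support"
  shows "integrable lebesgue f"
proof -
  obtain C where "Lq_le lebesgue 1 f C" using bounded_compact_support_Lq_le[OF assms, of 1] by auto
  then have "(\<integral>\<^sup>+x. ennreal (norm (f x)) \<partial>lebesgue) < \<infinity>"
    by (auto simp: Lq_le_def intro: le_less_trans)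
  then show ?thesis
    using assms by (intro integrableI_bounded) (auto simp: bounded_compact_support_iff)
qed

lemma dual_exponent_ennreal:
  assumes "1 < \<sigma>"
  shows "dual_exponent (ennreal \<sigma>) = ennreal (\<sigma> / (\<sigma> - 1))"
proof -
  have "1 - inverse (ennreal \<sigma>) = ennreal (1 - 1 / \<sigma>)"
    using assms by (simp add: inverse_ennreal ennreal_minus[symmetric] inverse_eq_divide)
  also have "1 - 1 / \<sigma> = (\<sigma> - 1) / \<sigma>" using assms by (simp add: field_simps)
  finally show ?thesis
    using assms by (simp add: dual_exponent_def inverse_ennreal)
qed

lemma setdist_unit_intervals:
  fixes a b :: real
  assumes "\<bar>b - a\<bar> = 2"
  shows "setdist {a..a + 1} {b..b + 1} = 1"
proof -
  have base: "setdist {a..a + 1} {a + 2..a + 2 + 1} = 1" for a :: real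
  proof (rule antisym)
    show "setdist {a..a + 1} {a + 2..a + 2 + 1} \<le> 1"
      using setdist_le_dist[of "a + 1" "{a..a + 1}" "a + 2" "{a + 2..a + 2 + 1}"] by (simp add: dist_real_def)
    show "1 \<le> setdist {a..a + 1} {a + 2..a + 2 + 1}"
      by (rule le_setdistI) (auto simp: dist_real_def)
  qed
  consider "b = a + 2" | "a = b + 2" using assms by linarith
  then show ?thesis using base[of a] base[of b] by cases (simp_all add: setdist_sym)
qed

lemma Lq_le_indicator:
  assumes A: "fin_borel A" and q: "0 < q"
  shows "Lq_le lebesgue q (indicator A) (measure lborel A powr (1 / q))"
proof -
  have [measurable]: "A \<in> sets borel" using A by (simp add: fin_borel_def)
  have "(\<integral>\<^sup>+x. ennreal (norm (indicator A x :: complex) powr q) \<partial>lborel) = (\<integral>\<^sup>+x. indicator A x \<partial>lborel)"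
    by (intro nn_integral_cong) (auto simp: indicator_def)
  also have "\<dots> = ennreal (measure lborel A)"
    using A by (simp add: emeasure_eq_ennreal_measure fin_borel_def)
  finally have "Lq_le lborel q (indicator A) (measure lborel A powr (1 / q))"
    using q by (simp add: Lq_le_def powr_powr)
  then show ?thesis by (subst Lq_le_lebesgue_iff) auto
qed

lemma Lp_one_iff:
  fixes f :: "'a::euclidean_space \<Rightarrow> complex"
  shows "f \<in> Lp 1 \<longleftrightarrow> integrable lebesgue f"
    and "f \<in> Lp 1 \<Longrightarrow> Lp_norm 1 f = ennreal (\<integral>x. norm (f x) \<partial>lebesgue)"
proof -
  define I where "I = (\<integral>\<^sup>+x. ennreal (norm (f x)) \<partial>lebesgue)"
  have N: "Lp_norm 1 f = I"
    by (cases I) (auto simp: Lp_norm_def I_def[symmetric] Let_def)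
  show iff: "f \<in> Lp 1 \<longleftrightarrow> integrable lebesgue f"
    by (simp add: Lp_def N integrable_iff_bounded I_def)
  show "Lp_norm 1 f = ennreal (\<integral>x. norm (f x) \<partial>lebesgue)" if "f \<in> Lp 1"
    using that iff unfolding N I_def by (intro nn_integral_eq_integral) auto
qed

text \<open>
  The endpoint \<open>\<sigma> = \<infinity>\<close>: on \<open>L\<^sup>1\<close> the defining integral converges absolutely.
\<close>

lemma extension_op_L1_Linf:
  assumes "f \<in> Lp 1"
  shows "extension_op f \<in> Lp \<infinity>" "Lp_norm \<infinity> (extension_op f) \<le> Lp_norm 1 f"
proof -
  have f: "integrable lebesgue f" using assms by (simp add: Lp_one_iff(1))
  have bound: "norm (extension_op f z) \<le> (\<integral>\<xi>. norm (f \<xi>) \<partial>lebesgue)" for z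
  proof -
    have "norm (extension_op f z) \<le> (\<integral>\<xi>. norm (phase z \<xi> * f \<xi>) \<partial>lebesgue)"
      unfolding extension_op_lebesgue by (rule integral_norm_bound)
    then show ?thesis by (simp add: norm_mult)
  qed
  have meas: "extension_op f \<in> borel_measurable lebesgue"
    by (intro measurable_lebesgue_of_borel borel_measurable_extension_op_lebesgue f)
  show le: "Lp_norm \<infinity> (extension_op f) \<le> Lp_norm 1 f"
  proof -
    have "esssup lebesgue (\<lambda>z. ennreal (norm (extension_op f z))) \<le> ennreal (\<integral>\<xi>. norm (f \<xi>) \<partial>lebesgue)"
    proof (rule esssup_I)
      show "(\<lambda>z. ennreal (norm (extension_op f z))) \<in> borel_measurable lebesgue" using meas by measurable
      show "AE z in lebesgue. ennreal (norm (extension_op f z)) \<le> ennreal (\<integral>\<xi>. norm (f \<xi>) \<partial>lebesgue)"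
        by (intro AE_I2 ennreal_leI bound)
    qed
    then show ?thesis by (simp add: Lp_one_iff(2)[OF assms]) (simp add: Lp_norm_def)
  qed
  then show "extension_op f \<in> Lp \<infinity>"
    using meas by (auto simp: Lp_def Lp_one_iff(2)[OF assms] intro: le_less_trans)
qed

context bilinear_extension_estimate
begin

text \<open>
  A Lebesgue measurable set differs from a Borel set by a null set, on which the extension does not depend.
\<close>

lemma restricted_strong_type_extension_op:
  "restricted_strong_type extension_op (dual_exponent (ennreal s)) (2 * ennreal s)"
  unfolding restricted_strong_type_def
proof (intro exI ballI)
  fix \<Omega> :: "(real \<times> real) set" assume \<Omega>: "\<Omega> \<in> lmeasurable"
  then have "\<Omega> \<in> sets lebesgue" by (simp add: fmeasurable_def)
  then obtain A N N' where dec: "\<Omega> = A \<union> N" "N \<subseteq> N'" "N' \<in> null_sets lborel" "A \<in> sets lborel"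
    by (rule sets_completionE)
  have "AE \<xi> in lborel. \<xi> \<notin> N'" by (rule AE_not_in[OF dec(3)])
  then have AE: "AE \<xi> in lebesgue. indicator \<Omega> \<xi> = (indicator A \<xi> :: complex)"
    using dec by (intro AE_completion) (auto elim!: eventually_mono simp: indicator_def)
  then have "AE \<xi> in lebesgue. \<xi> \<in> \<Omega> \<longleftrightarrow> \<xi> \<in> A"
    by (rule eventually_mono) (auto simp: indicator_def split: if_splits)
  then have em: "emeasure lebesgue \<Omega> = emeasure lborel A"
    using dec \<Omega> by (subst emeasure_eq_AE[of _ A]) (auto simp: fmeasurable_def)
  then have A: "fin_borel A" using \<Omega> dec by (simp add: fin_borel_def fmeasurable_def)
  have m: "measure lebesgue \<Omega> = measure lborel A" using em by (simp add: measure_def)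
  have "extension_op (indicator \<Omega>) = ext_ind A"
  proof (rule extension_op_cong_AE[OF _ _ AE])
    show "indicator \<Omega> \<in> borel_measurable lebesgue"
      using \<Omega> by (intro borel_measurable_indicator) (auto simp: fmeasurable_def)
    show "indicator A \<in> borel_measurable lebesgue"
      using dec(4) by (intro measurable_lebesgue_of_borel borel_measurable_indicator) simp
  qed
  moreover have "Lp_norm (ennreal (2 * s)) (ext_ind A) \<le> ennreal (restricted_const * measure lborel A powr (1 - 1 / s))"
    by (rule Lq_le_imp_Lp(2))
      (use restricted_estimate[OF A] s_gt in \<open>auto simp: Lq_le_lebesgue_iff[OF borel_measurable_ext_ind[OF A]]\<close>)
  moreover have "enn2real (inverse (dual_exponent (ennreal s))) = 1 - 1 / s"
    using s_gt by (subst dual_exponent_ennreal) (auto simp: inverse_ennreal field_simps)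
  moreover have "2 * ennreal s = ennreal (2 * s)" using s_gt by (simp add: ennreal_mult)
  ultimately show "Lp_norm (2 * ennreal s) (extension_op (indicator \<Omega>))
      \<le> ennreal (restricted_const * measure lebesgue \<Omega> powr enn2real (inverse (dual_exponent (ennreal s))))"
    by (simp add: m)
qed

lemma strong_estimate_bounded_compact_support:
  assumes \<sigma>: "s < \<sigma>" and f: "f \<in> bounded_compact_support" and C: "Lq_le lebesgue (\<sigma> / (\<sigma> - 1)) f C"
  shows "Lq_le lebesgue (2 * \<sigma>) (extension_op f) (strong_const \<sigma> * C)"
proof -
  obtain g where g: "integrable lborel g" "AE x in lebesgue. f x = g x" "extension_op f = extension_op g"
    using bounded_compact_support_integrable[OF f] by (rule integrable_representative)
  have gb: "g \<in> borel_measurable borel" using g(1) by simp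
  have "Lq_le lebesgue (\<sigma> / (\<sigma> - 1)) g C"
    by (rule Lq_le_cong_AE[OF C measurable_lebesgue_of_borel[OF gb] g(2)])
  then have "Lq_le lborel (\<sigma> / (\<sigma> - 1)) g C" using Lq_le_lebesgue_iff[OF gb] by simp
  then have "Lq_le lborel (2 * \<sigma>) (extension_op g) (strong_const \<sigma> * C)"
    by (intro strong_estimate \<sigma> g(1) Lq_leD[of lborel _ g])
  then show ?thesis
    using Lq_le_lebesgue_iff[OF borel_measurable_extension_op[OF gb]] g(3) by simp
qed

lemma strong_type_extension_op:
  assumes \<sigma>: "s < \<sigma>"
  shows "strong_type extension_op (dual_exponent (ennreal \<sigma>)) (2 * ennreal \<sigma>)"
    and "extends_to_bounded_operator extension_op (dual_exponent (ennreal \<sigma>)) (2 * ennreal \<sigma>)"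
proof -
  have \<sigma>1: "1 < \<sigma>" using \<sigma> s_gt by simp
  define p where "p = \<sigma> / (\<sigma> - 1)"
  have p: "1 \<le> p" using \<sigma>1 by (simp add: p_def)
  have exps: "dual_exponent (ennreal \<sigma>) = ennreal p" "2 * ennreal \<sigma> = ennreal (2 * \<sigma>)"
    using \<sigma>1 by (simp_all add: dual_exponent_ennreal p_def ennreal_mult)
  show "strong_type extension_op (dual_exponent (ennreal \<sigma>)) (2 * ennreal \<sigma>)"
    unfolding exps strong_type_def
  proof (intro exI ballI)
    fix f :: "real \<times> real \<Rightarrow> complex" assume f: "f \<in> bounded_compact_support"
    obtain C' where "Lq_le lebesgue p f C'" using bounded_compact_support_Lq_le[OF f, of p] p by auto
    then have "f \<in> Lp (ennreal p)" using p by (intro Lq_le_imp_Lp(1)) auto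
    then obtain C where C: "Lq_le lebesgue p f C" "Lp_norm (ennreal p) f = ennreal C"
      using p by (auto elim: Lp_imp_Lq_le)
    have "Lq_le lebesgue (2 * \<sigma>) (extension_op f) (strong_const \<sigma> * C)"
      using strong_estimate_bounded_compact_support[OF \<sigma> f] C(1) by (simp add: p_def)
    then have "Lp_norm (ennreal (2 * \<sigma>)) (extension_op f) \<le> ennreal (strong_const \<sigma> * C)"
      using \<sigma>1 by (intro Lq_le_imp_Lp(2)) auto
    then show "Lp_norm (ennreal (2 * \<sigma>)) (extension_op f) \<le> ennreal (strong_const \<sigma>) * Lp_norm (ennreal p) f"
      using strong_const_nonneg[of \<sigma>] by (simp add: C(2) ennreal_mult')
  qed
  show "extends_to_bounded_operator extension_op (dual_exponent (ennreal \<sigma>)) (2 * ennreal \<sigma>)"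
    unfolding exps
  proof (rule extension_by_density[OF p _ strong_const_nonneg[of \<sigma>]])
    show "extension_op (\<lambda>x. f x + g x) y = extension_op f y + extension_op g y"
      if "f \<in> bounded_compact_support" "g \<in> bounded_compact_support" for f g y
      using that by (intro extension_op_add_lebesgue bounded_compact_support_integrable)
    show "extension_op (\<lambda>x. c * f x) y = c * extension_op f y" for c f y
      by (rule extension_op_cmult_lebesgue)
    show "Lq_le lebesgue (2 * \<sigma>) (extension_op f) (strong_const \<sigma> * C)"
      if "f \<in> bounded_compact_support" "Lq_le lebesgue p f C" for f C
      using strong_estimate_bounded_compact_support[OF \<sigma> that(1)] that(2) by (simp add: p_def)
    show "extension_op f \<in> borel_measurable lebesgue" if "f \<in> bounded_compact_support" for f
      using that by (intro measurable_lebesgue_of_borel borel_measurable_extension_op_lebesgue bounded_compact_support_integrable)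
  qed (use \<sigma>1 in simp)
qed

end

lemma strong_type_extension_op_infinity:
  shows "strong_type extension_op 1 \<infinity>" and "extends_to_bounded_operator extension_op 1 \<infinity>"
proof -
  have bcs: "f \<in> Lp 1" if "f \<in> bounded_compact_support" for f :: "real \<times> real \<Rightarrow> complex"
    using bounded_compact_support_integrable[OF that] by (simp add: Lp_one_iff(1))
  show "strong_type extension_op 1 \<infinity>"
    unfolding strong_type_def using extension_op_L1_Linf(2)[OF bcs] by (intro exI[of _ 1]) auto
  show "extends_to_bounded_operator extension_op 1 \<infinity>"
    unfolding extends_to_bounded_operator_def
  proof (intro exI[of _ extension_op] conjI ballI allI AE_I2)
    show "extension_op f \<in> Lp \<infinity>" if "f \<in> Lp 1" for f
      using that by (rule extension_op_L1_Linf(1))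
    show "extension_op (\<lambda>x. f x + g x) y = extension_op f y + extension_op g y" if "f \<in> Lp 1" "g \<in> Lp 1" for f g y
      using that by (intro extension_op_add_lebesgue) (simp_all add: Lp_one_iff(1))
    show "\<exists>C::real. \<forall>f\<in>Lp 1. Lp_norm \<infinity> (extension_op f) \<le> ennreal C * Lp_norm 1 f"
      using extension_op_L1_Linf(2) by (intro exI[of _ 1]) auto
  qed (simp_all add: extension_op_cmult_lebesgue)
qed

theorem theorem1p1:
  fixes s r :: ennreal
  assumes "3 / 2 < s" and "s < 2"
    and "1 \<le> r" and "r < dual_exponent s"
    and bilinear: "\<exists>B::real. \<forall>Q Q'. separated_unit_rectangles Q Q' \<longrightarrow>
      (\<forall>f\<in>Lp r. \<forall>g\<in>Lp r. (\<forall>\<xi>. \<xi> \<notin> Q \<longrightarrow> f \<xi> = 0) \<longrightarrow> (\<forall>\<xi>. \<xi> \<notin> Q' \<longrightarrow> g \<xi> = 0) \<longrightarrow>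
        Lp_norm s (\<lambda>z. extension_op f z * extension_op g z)
          \<le> ennreal B * Lp_norm r f * Lp_norm r g)"
  shows "restricted_strong_type extension_op (dual_exponent s) (2 * s) \<and>
    (\<forall>\<sigma>>s. strong_type extension_op (dual_exponent \<sigma>) (2 * \<sigma>) \<and>
      (dual_exponent \<sigma> < \<infinity> \<longrightarrow>
        extends_to_bounded_operator extension_op (dual_exponent \<sigma>) (2 * \<sigma>)))"
proof -
  have "s \<noteq> \<infinity>" using assms(2) by (auto simp: less_top[symmetric])
  then obtain s' where s: "s = ennreal s'" "0 \<le> s'" by (cases s) auto
  have s_bounds: "3 / 2 < s'" "s' < 2"
  proof -
    have "ennreal (3 / 2) < ennreal s'"
      using assms(1) unfolding s by (simp add: divide_ennreal[symmetric])
    then show "3 / 2 < s'" by (simp add: ennreal_less_iff)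
    have "ennreal s' < ennreal 2" using assms(2) unfolding s by simp
    then show "s' < 2" using s(2) by (simp only: ennreal_less_iff)
  qed
  have ds: "dual_exponent s = ennreal (s' / (s' - 1))"
    unfolding s using s_bounds by (intro dual_exponent_ennreal) auto
  obtain r' where r: "r = ennreal r'" "0 \<le> r'" using assms(4) unfolding ds by (cases r) auto
  have r_bounds: "1 \<le> r'" "r' < s' / (s' - 1)"
    using assms(3,4) r(2) unfolding ds r(1) by (auto simp: ennreal_less_iff ennreal_1[symmetric] simp del: ennreal_1)
  obtain B :: real where B: "\<forall>Q Q'. separated_unit_rectangles Q Q' \<longrightarrow>
      (\<forall>f\<in>Lp r. \<forall>g\<in>Lp r. (\<forall>\<xi>. \<xi> \<notin> Q \<longrightarrow> f \<xi> = 0) \<longrightarrow> (\<forall>\<xi>. \<xi> \<notin> Q' \<longrightarrow> g \<xi> = 0) \<longrightarrow>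
        Lp_norm s (\<lambda>z. extension_op f z * extension_op g z)
          \<le> ennreal B * Lp_norm r f * Lp_norm r g)"
    using bilinear ..
  interpret bilinear_extension_estimate s' r' "max 0 B"
  proof
    fix a1 a2 b1 b2 :: real and A A' :: "(real \<times> real) set"
    assume ab: "\<bar>b1 - a1\<bar> = 2" "\<bar>b2 - a2\<bar> = 2" and A: "fin_borel A" "fin_borel A'"
      and sub: "A \<subseteq> {a1..a1 + 1} \<times> {a2..a2 + 1}" "A' \<subseteq> {b1..b1 + 1} \<times> {b2..b2 + 1}"
    let ?F = "\<lambda>z. ext_ind A z * ext_ind A' z"
    have sep: "separated_unit_rectangles ({a1..a1 + 1} \<times> {a2..a2 + 1}) ({b1..b1 + 1} \<times> {b2..b2 + 1})"
      unfolding separated_unit_rectangles_def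
      using setdist_unit_intervals[OF ab(1)] setdist_unit_intervals[OF ab(2)] by blast
    have r0: "0 < r'" using r_bounds by simp
    note ind = Lq_le_imp_Lp[OF Lq_le_indicator[OF A(1) r0] r0] Lq_le_imp_Lp[OF Lq_le_indicator[OF A(2) r0] r0]
    have "Lp_norm s ?F \<le> ennreal B * Lp_norm r (indicator A :: _ \<Rightarrow> complex) * Lp_norm r (indicator A' :: _ \<Rightarrow> complex)"
      by (rule B[rule_format, OF sep]) (use ind sub in \<open>auto simp: r indicator_def\<close>)
    also have "\<dots> \<le> ennreal (max 0 B) * ennreal (measure lborel A powr (1 / r')) * ennreal (measure lborel A' powr (1 / r'))"
      unfolding r by (intro mult_mono ind(2,4) ennreal_leI) auto
    also have "\<dots> = ennreal (max 0 B * (measure lborel A * measure lborel A') powr (1 / r'))"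
      by (simp add: ennreal_mult powr_mult mult.assoc)
    finally have le: "Lp_norm (ennreal s') ?F \<le> ennreal (max 0 B * (measure lborel A * measure lborel A') powr (1 / r'))"
      unfolding s .
    have F: "?F \<in> borel_measurable borel" by (intro borel_measurable_times borel_measurable_ext_ind A)
    have "Lq_le lebesgue s' ?F (max 0 B * (measure lborel A * measure lborel A') powr (1 / r'))"
      using le s_bounds Lp_norm_le_iff[of s' _ ?F, OF _ _ measurable_lebesgue_of_borel[OF F]] by simp
    then show "Lq_le lborel s' ?F (max 0 B * (measure lborel A * measure lborel A') powr (1 / r'))"
      using Lq_le_lebesgue_iff[OF F] by simp
  qed (use s_bounds r_bounds in auto)
  have strong: "strong_type extension_op (dual_exponent \<sigma>) (2 * \<sigma>)
      \<and> extends_to_bounded_operator extension_op (dual_exponent \<sigma>) (2 * \<sigma>)" if "s < \<sigma>" for \<sigma>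
  proof (cases \<sigma>)
    case (real t)
    then have "s' < t" using that s by (simp add: ennreal_less_iff)
    then show ?thesis unfolding real using strong_type_extension_op[of t] by simp
  next
    case top
    have "dual_exponent \<infinity> = 1" "2 * \<infinity> = (\<infinity> :: ennreal)"
      by (simp_all add: dual_exponent_def ennreal_mult_top)
    then show ?thesis using strong_type_extension_op_infinity by (simp add: top)
  qed
  show ?thesis
    using restricted_strong_type_extension_op strong unfolding s by blast
qed

end
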